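(* Let $F$ be a Kropina metric on an $n$-dimensional manifold $M$ defined by navigation data $(h,W)$, let $f$ be a smooth function on $M$, and let $a,c$ be constants with $\nu:=3(n-1)-4a(n+1)-c(n+1)^2\neq0$. Then $F$ is a weakly weighted Einstein metric with weight constants $a$ and $c$ with respect to the volume form $dV=e^{-(n+1)f}dV_{BH}$, i.e. there are a scalar function $\sigma$ and a 1-form $\theta=\theta_iy^i$ on $M$ with $$\mathrm{Ric}_{a,c}=(n-1)\left(\frac{3\theta}{F}+\sigma\right)F^2,$$ if and only if there exists a scalar function $\mu$ on $M$ such that the Ricci curvature $Ric^h$ of $h$ satisfies $$Ric^h+a(n+1)\mathrm{Hess}_hf-c(n+1)^2(df\otimes df)=(n-1)\mu h^2$$ and $W$ satisfies $\mathcal R_{ij}=0$. In this case, $$\sigma=\mu-\frac1{n-1}\Big\{Ric^h(W)+\mathcal S^p_{\ q}\mathcal S^q_{\ p}+a(n+1)\mathrm{Hess}_hf(W)-c(n+1)^2(f_pW^p)^2\Big\}$$ and $$\theta_i=\frac1{3(n-1)}\Big[2a(n+1)\big(f_{ip}W^p+f_p\mathcal S^p_{\ i}\big)-2c(n+1)^2f_if_pW^p\Big].$$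
   Context: A Kropina metric is $F=\alpha^2/\beta$ with $\alpha=\sqrt{a_{ij}(x)y^iy^j}$ Riemannian and $\beta=b_i(x)y^i$ a 1-form, defined on $\{\beta>0\}\subset TM$. Its navigation data is the pair $(h,W)$, $h_{ij}=\frac4{b^2}a_{ij}$, $W^i=\frac12b^i$ (where $b=\|\beta\|_\alpha$, $b^i=a^{ij}b_j$); $h=\sqrt{h_{ij}y^iy^j}$ is a Riemannian metric, $W=W^i\partial/\partial x^i$ is a vector field with $\|W\|_h=1$, and $F=\frac{h^2}{2W_0}$ with $W_0=W_iy^i$, $W_i=h_{ij}W^j$, on the conic domain $\{W_0>0\}$. This is a one-to-one correspondence. With $|$ the Levi-Civita covariant derivative of $h$: $\mathcal R_{ij}=\frac12(W_{i|j}+W_{j|i})$, $\mathcal S_{ij}=\frac12(W_{i|j}-W_{j|i})$, $\mathcal S^i_{\ j}=h^{ik}\mathcal S_{kj}$. Also $f_i=\partial f/\partial x^i$, $f_{ij}=\frac{\partial^2f}{\partial x^i\partial x^j}-\overline\Gamma^m_{ij}\frac{\partial f}{\partial x^m}$ (with $\overline\Gamma$ the Christoffel symbols of $h$), and $\mathrm{Hess}_hf(y)=f_{ij}y^iy^j$. $Ric^h(y)$ denotes the Ricci curvature of $h$ as a quadratic form. For a Finsler metric $F$ put $g_{ij}=\frac12[F^2]_{y^iy^j}$, $(g^{ij})=(g_{ij})^{-1}$. Geodesic coefficients: $G^i=\frac14 g^{il}\{[F^2]_{x^ky^l}y^k-[F^2]_{x^l}\}$. Riemann curvature: $R^i_{\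 k}=2\frac{\partial G^i}{\partial x^k}-\frac{\partial^2G^i}{\partial x^m\partial y^k}y^m+2G^m\frac{\partial^2G^i}{\partial y^m\partial y^k}-\frac{\partial G^i}{\partial y^m}\frac{\partial G^m}{\partial y^k}$; Ricci curvature: $\mathrm{Ric}(y)=R^m_{\ m}$. For a volume form $dV=\sigma_{V}(x)dx^1\cdots dx^n$, the distortion is $\tau(x,y)=\ln\big(\sqrt{\det(g_{ij}(x,y))}/\sigma_{V}(x)\big)$. The S-curvature is $\mathbf S(x,y)=\frac{d}{dt}[\tau(c(t),\dot c(t))]|_{t=0}$ and $\dot{\mathbf S}(x,y)=\frac{d}{dt}[\mathbf S(c(t),\dot c(t))]|_{t=0}$, where $c(t)$ is the geodesic of $F$ with $c(0)=x$, $\dot c(0)=y$. The generalized weighted Ricci curvature with weight constants $a,c$ is $\mathrm{Ric}_{a,c}=\mathrm{Ric}+a\dot{\mathbf S}-c\,\mathbf S^2$, with $\mathbf S,\dot{\mathbf S}$ taken with respect to $dV$. The Busemann-Hausdorff volume form is $dV_{BH}=\sigma_{BH}(x)dx^1\cdots dx^n$ with $\sigma_{BH}(x)=\mathrm{Vol}(\mathbf B^n(1))/\mathrm{Vol}\{(y^i)\in\mathbf R^n: F(x,y)<1\}$ (for a conic metric, $y$ ranges over the conic domain). *)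

theory Defs
  imports "HOL-Analysis.Analysis"
begin

section \<open>Partial derivatives and smoothness in \<open>\<real>\<^sup>n\<close>\<close>

definition pd :: "'n::finite \<Rightarrow> (real ^ 'n \<Rightarrow> real) \<Rightarrow> real ^ 'n \<Rightarrow> real" where
  "pd i f x = deriv (\<lambda>t. f (x + t *\<^sub>R axis i 1)) 0"

fun Ck_on :: "nat \<Rightarrow> (real ^ 'n) set \<Rightarrow> (real ^ 'n::finite \<Rightarrow> real) \<Rightarrow> bool" where
  "Ck_on 0 S f \<longleftrightarrow> continuous_on S f"
| "Ck_on (Suc k) S f \<longleftrightarrow> f differentiable_on S \<and> (\<forall>i. Ck_on k S (pd i f))"

text \<open>Only meant for open \<open>S\<close>.\<close>

definition smooth_on :: "(real ^ 'n) set \<Rightarrow> (real ^ 'n::finite \<Rightarrow> real) \<Rightarrow> bool" where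
  "smooth_on S f \<longleftrightarrow> (\<forall>k. Ck_on k S f)"

definition quad :: "real ^ 'n ^ 'n \<Rightarrow> real ^ 'n::finite \<Rightarrow> real" where
  "quad A y = (\<Sum>i\<in>UNIV. \<Sum>j\<in>UNIV. A $ i $ j * y $ i * y $ j)"

section \<open>Smooth manifolds and tensor fields\<close>

text \<open>
  A manifold is a Hausdorff second countable type \<open>'m\<close> with a smooth atlas. A chart is a pair of
  its domain and the coordinate map. A tensor field is the family of its component functions, one
  for each chart and defined on the image of that chart, subject to the usual transformation law;
  the values of the family for non-charts or outside the image carry no information.
\<close>

type_synonym ('m, 'n) chart = "'m set \<times> ('m \<Rightarrow> real ^ 'n)"

definition img :: "('m, 'n::finite) chart \<Rightarrow> (real ^ 'n) set" where
  "img C = snd C ` fst C"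

definition pt :: "('m, 'n::finite) chart \<Rightarrow> real ^ 'n \<Rightarrow> 'm" where
  "pt C = inv_into (fst C) (snd C)"

definition overlap :: "('m, 'n::finite) chart \<Rightarrow> ('m, 'n) chart \<Rightarrow> (real ^ 'n) set" where
  "overlap C D = snd C ` (fst C \<inter> fst D)"

definition transition ::
    "('m, 'n::finite) chart \<Rightarrow> ('m, 'n) chart \<Rightarrow> real ^ 'n \<Rightarrow> real ^ 'n" where
  "transition C D = snd D \<circ> pt C"

definition smooth_atlas ::
    "('m::{t2_space, second_countable_topology}, 'n::finite) chart set \<Rightarrow> bool" where
  "smooth_atlas \<A> \<longleftrightarrow>
     (\<Union>C\<in>\<A>. fst C) = UNIV \<and>
     (\<forall>C\<in>\<A>. open (fst C) \<and> open (img C) \<and> homeomorphism (fst C) (img C) (snd C) (pt C)) \<and>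
     (\<forall>C\<in>\<A>. \<forall>D\<in>\<A>. \<forall>i. smooth_on (overlap C D) (\<lambda>x. transition C D x $ i))"

definition jac :: "(real ^ 'n \<Rightarrow> real ^ 'n) \<Rightarrow> real ^ 'n::finite \<Rightarrow> real ^ 'n ^ 'n" where
  "jac T x = (\<chi> i j. pd j (\<lambda>z. T z $ i) x)"

definition smooth_function :: "('m, 'n::finite) chart set \<Rightarrow> ('m \<Rightarrow> real) \<Rightarrow> bool" where
  "smooth_function \<A> f \<longleftrightarrow> (\<forall>C\<in>\<A>. smooth_on (img C) (f \<circ> pt C))"

definition one_form ::
    "('m, 'n::finite) chart set \<Rightarrow> (('m, 'n) chart \<Rightarrow> real ^ 'n \<Rightarrow> real ^ 'n) \<Rightarrow> bool" where
  "one_form \<A> \<omega> \<longleftrightarrow>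
     (\<forall>C\<in>\<A>. \<forall>i. smooth_on (img C) (\<lambda>x. \<omega> C x $ i)) \<and>
     (\<forall>C\<in>\<A>. \<forall>D\<in>\<A>. \<forall>x\<in>overlap C D.
        \<omega> C x = transpose (jac (transition C D) x) *v \<omega> D (transition C D x))"

definition riemannian_metric ::
    "('m, 'n::finite) chart set \<Rightarrow> (('m, 'n) chart \<Rightarrow> real ^ 'n \<Rightarrow> real ^ 'n ^ 'n) \<Rightarrow> bool" where
  "riemannian_metric \<A> g \<longleftrightarrow>
     (\<forall>C\<in>\<A>. \<forall>i j. smooth_on (img C) (\<lambda>x. g C x $ i $ j)) \<and>
     (\<forall>C\<in>\<A>. \<forall>x\<in>img C. transpose (g C x) = g C x \<and> (\<forall>y. y \<noteq> 0 \<longrightarrow> quad (g C x) y > 0)) \<and>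
     (\<forall>C\<in>\<A>. \<forall>D\<in>\<A>. \<forall>x\<in>overlap C D.
        g C x = transpose (jac (transition C D) x) ** g D (transition C D x)
                  ** jac (transition C D) x)"

section \<open>Conic Finsler metrics in local coordinates\<close>

text \<open>
  \<open>F x y\<close> is the metric in the coordinates of a chart, and \<open>\<Omega>\<close> is the open set of the \<open>(x, y)\<close> on
  which it is defined. Values of \<open>F\<close> outside \<open>\<Omega>\<close> carry no information.
\<close>

definition fundamental_tensor ::
    "(real ^ 'n::finite \<Rightarrow> real ^ 'n \<Rightarrow> real) \<Rightarrow> real ^ 'n \<Rightarrow> real ^ 'n \<Rightarrow> real ^ 'n ^ 'n" where
  "fundamental_tensor F x y =
     (\<chi> i j. 1 / 2 * pd j (\<lambda>v. pd i (\<lambda>u. (F x u)\<^sup>2) v) y)"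

definition spray ::
    "(real ^ 'n::finite \<Rightarrow> real ^ 'n \<Rightarrow> real) \<Rightarrow> real ^ 'n \<Rightarrow> real ^ 'n \<Rightarrow> real ^ 'n" where
  "spray F x y =
     (\<chi> i. 1 / 4 * (\<Sum>l\<in>UNIV. matrix_inv (fundamental_tensor F x y) $ i $ l *
        ((\<Sum>k\<in>UNIV. pd l (\<lambda>v. pd k (\<lambda>z. (F z v)\<^sup>2) x) y * y $ k) - pd l (\<lambda>z. (F z y)\<^sup>2) x)))"

definition riemann_curvature ::
    "(real ^ 'n::finite \<Rightarrow> real ^ 'n \<Rightarrow> real) \<Rightarrow> real ^ 'n \<Rightarrow> real ^ 'n \<Rightarrow> 'n \<Rightarrow> 'n \<Rightarrow> real" where
  "riemann_curvature F x y i k =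
     2 * pd k (\<lambda>z. spray F z y $ i) x
     - (\<Sum>m\<in>UNIV. pd m (\<lambda>z. pd k (\<lambda>v. spray F z v $ i) y) x * y $ m)
     + 2 * (\<Sum>m\<in>UNIV. spray F x y $ m * pd m (\<lambda>v. pd k (\<lambda>u. spray F x u $ i) v) y)
     - (\<Sum>m\<in>UNIV. pd m (\<lambda>v. spray F x v $ i) y * pd k (\<lambda>v. spray F x v $ m) y)"

definition ricci_curvature ::
    "(real ^ 'n::finite \<Rightarrow> real ^ 'n \<Rightarrow> real) \<Rightarrow> real ^ 'n \<Rightarrow> real ^ 'n \<Rightarrow> real" where
  "ricci_curvature F x y = (\<Sum>m\<in>UNIV. riemann_curvature F x y m m)"

abbreviation velocity :: "(real \<Rightarrow> real ^ 'n::finite) \<Rightarrow> real \<Rightarrow> real ^ 'n" where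
  "velocity \<gamma> t \<equiv> vector_derivative \<gamma> (at t)"

definition geodesic_from ::
    "(real ^ 'n::finite \<Rightarrow> real ^ 'n \<Rightarrow> real) \<Rightarrow> ((real ^ 'n) \<times> (real ^ 'n)) set \<Rightarrow>
     real ^ 'n \<Rightarrow> real ^ 'n \<Rightarrow> (real \<Rightarrow> real ^ 'n) \<Rightarrow> bool" where
  "geodesic_from F \<Omega> x y \<gamma> \<longleftrightarrow>
     \<gamma> 0 = x \<and> velocity \<gamma> 0 = y \<and>
     (\<exists>\<epsilon>>0. \<forall>t\<in>{-\<epsilon><..<\<epsilon>}.
        \<gamma> differentiable at t \<and> (\<gamma> t, velocity \<gamma> t) \<in> \<Omega> \<and>
        (velocity \<gamma> has_vector_derivative - 2 *\<^sub>R spray F (\<gamma> t) (velocity \<gamma> t)) (at t))"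

text \<open>
  The derivatives along a geodesic taken below depend only on its germ at \<open>0\<close>, so any local
  solution of the geodesic equation may be chosen.
\<close>

definition the_geodesic ::
    "(real ^ 'n::finite \<Rightarrow> real ^ 'n \<Rightarrow> real) \<Rightarrow> ((real ^ 'n) \<times> (real ^ 'n)) set \<Rightarrow>
     real ^ 'n \<Rightarrow> real ^ 'n \<Rightarrow> real \<Rightarrow> real ^ 'n" where
  "the_geodesic F \<Omega> x y = (SOME \<gamma>. geodesic_from F \<Omega> x y \<gamma>)"

text \<open>In the following, \<open>vol\<close> is the density of a volume form in the given coordinates.\<close>

definition distortion ::
    "(real ^ 'n::finite \<Rightarrow> real ^ 'n \<Rightarrow> real) \<Rightarrow> (real ^ 'n \<Rightarrow> real) \<Rightarrow>
     real ^ 'n \<Rightarrow> real ^ 'n \<Rightarrow> real" where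
  "distortion F vol x y = ln (sqrt (det (fundamental_tensor F x y)) / vol x)"

definition S_curvature ::
    "(real ^ 'n::finite \<Rightarrow> real ^ 'n \<Rightarrow> real) \<Rightarrow> ((real ^ 'n) \<times> (real ^ 'n)) set \<Rightarrow>
     (real ^ 'n \<Rightarrow> real) \<Rightarrow> real ^ 'n \<Rightarrow> real ^ 'n \<Rightarrow> real" where
  "S_curvature F \<Omega> vol x y =
     (let \<gamma> = the_geodesic F \<Omega> x y in deriv (\<lambda>t. distortion F vol (\<gamma> t) (velocity \<gamma> t)) 0)"

definition S_dot ::
    "(real ^ 'n::finite \<Rightarrow> real ^ 'n \<Rightarrow> real) \<Rightarrow> ((real ^ 'n) \<times> (real ^ 'n)) set \<Rightarrow>
     (real ^ 'n \<Rightarrow> real) \<Rightarrow> real ^ 'n \<Rightarrow> real ^ 'n \<Rightarrow> real" where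
  "S_dot F \<Omega> vol x y =
     (let \<gamma> = the_geodesic F \<Omega> x y in deriv (\<lambda>t. S_curvature F \<Omega> vol (\<gamma> t) (velocity \<gamma> t)) 0)"

definition weighted_ricci ::
    "(real ^ 'n::finite \<Rightarrow> real ^ 'n \<Rightarrow> real) \<Rightarrow> ((real ^ 'n) \<times> (real ^ 'n)) set \<Rightarrow>
     (real ^ 'n \<Rightarrow> real) \<Rightarrow> real \<Rightarrow> real \<Rightarrow> real ^ 'n \<Rightarrow> real ^ 'n \<Rightarrow> real" where
  "weighted_ricci F \<Omega> vol a c x y =
     ricci_curvature F x y + a * S_dot F \<Omega> vol x y - c * (S_curvature F \<Omega> vol x y)\<^sup>2"

definition BH_density ::
    "(real ^ 'n::finite \<Rightarrow> real ^ 'n \<Rightarrow> real) \<Rightarrow> ((real ^ 'n) \<times> (real ^ 'n)) set \<Rightarrow>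
     real ^ 'n \<Rightarrow> real" where
  "BH_density F \<Omega> x =
     measure lborel (ball (0 :: real ^ 'n) 1) / measure lborel {y. (x, y) \<in> \<Omega> \<and> F x y < 1}"

section \<open>Riemannian metrics in local coordinates\<close>

definition christoffel ::
    "(real ^ 'n::finite \<Rightarrow> real ^ 'n ^ 'n) \<Rightarrow> real ^ 'n \<Rightarrow> 'n \<Rightarrow> 'n \<Rightarrow> 'n \<Rightarrow> real" where
  "christoffel h x m i j =
     1 / 2 * (\<Sum>k\<in>UNIV. matrix_inv (h x) $ m $ k *
       (pd i (\<lambda>z. h z $ k $ j) x + pd j (\<lambda>z. h z $ k $ i) x - pd k (\<lambda>z. h z $ i $ j) x))"

definition riem_ricci ::
    "(real ^ 'n::finite \<Rightarrow> real ^ 'n ^ 'n) \<Rightarrow> real ^ 'n \<Rightarrow> real ^ 'n ^ 'n" where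
  "riem_ricci h x =
     (\<chi> i j. (\<Sum>m\<in>UNIV. pd m (\<lambda>z. christoffel h z m i j) x - pd j (\<lambda>z. christoffel h z m i m) x)
       + (\<Sum>m\<in>UNIV. \<Sum>p\<in>UNIV. christoffel h x m m p * christoffel h x p i j
                               - christoffel h x m j p * christoffel h x p i m))"

definition hessian ::
    "(real ^ 'n::finite \<Rightarrow> real ^ 'n ^ 'n) \<Rightarrow> (real ^ 'n \<Rightarrow> real) \<Rightarrow> real ^ 'n \<Rightarrow> real ^ 'n ^ 'n"
  where
  "hessian h \<phi> x =
     (\<chi> i j. pd j (pd i \<phi>) x - (\<Sum>m\<in>UNIV. christoffel h x m i j * pd m \<phi> x))"

text \<open>\<open>cov_deriv h W x i j\<close> is \<open>W\<^bsub>i|j\<^esub>\<close>, for a vector field \<open>W\<close> given by its contravariant components.\<close>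

definition cov_deriv ::
    "(real ^ 'n::finite \<Rightarrow> real ^ 'n ^ 'n) \<Rightarrow> (real ^ 'n \<Rightarrow> real ^ 'n) \<Rightarrow> real ^ 'n \<Rightarrow>
     'n \<Rightarrow> 'n \<Rightarrow> real" where
  "cov_deriv h W x i j =
     pd j (\<lambda>z. (h z *v W z) $ i) x - (\<Sum>m\<in>UNIV. christoffel h x m i j * (h x *v W x) $ m)"

definition R_tensor ::
    "(real ^ 'n::finite \<Rightarrow> real ^ 'n ^ 'n) \<Rightarrow> (real ^ 'n \<Rightarrow> real ^ 'n) \<Rightarrow> real ^ 'n \<Rightarrow>
     real ^ 'n ^ 'n" where
  "R_tensor h W x = (\<chi> i j. 1 / 2 * (cov_deriv h W x i j + cov_deriv h W x j i))"

definition S_tensor ::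
    "(real ^ 'n::finite \<Rightarrow> real ^ 'n ^ 'n) \<Rightarrow> (real ^ 'n \<Rightarrow> real ^ 'n) \<Rightarrow> real ^ 'n \<Rightarrow>
     real ^ 'n ^ 'n" where
  "S_tensor h W x = (\<chi> i j. 1 / 2 * (cov_deriv h W x i j - cov_deriv h W x j i))"

text \<open>The endomorphism with entries \<open>h\<^sup>i\<^sup>k S\<^sub>k\<^sub>j\<close>, row index \<open>i\<close>.\<close>

definition S_endo ::
    "(real ^ 'n::finite \<Rightarrow> real ^ 'n ^ 'n) \<Rightarrow> (real ^ 'n \<Rightarrow> real ^ 'n) \<Rightarrow> real ^ 'n \<Rightarrow>
     real ^ 'n ^ 'n" where
  "S_endo h W x = matrix_inv (h x) ** S_tensor h W x"

definition df :: "(real ^ 'n::finite \<Rightarrow> real) \<Rightarrow> real ^ 'n \<Rightarrow> real ^ 'n" where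
  "df \<phi> x = (\<chi> i. pd i \<phi> x)"

section \<open>Kropina metrics and their navigation data\<close>

text \<open>
  A Kropina metric is given by a Riemannian metric \<open>al\<close> and a nowhere vanishing 1-form \<open>be\<close>.
\<close>

definition kropina_data ::
    "('m, 'n::finite) chart set \<Rightarrow> (('m, 'n) chart \<Rightarrow> real ^ 'n \<Rightarrow> real ^ 'n ^ 'n) \<Rightarrow>
     (('m, 'n) chart \<Rightarrow> real ^ 'n \<Rightarrow> real ^ 'n) \<Rightarrow> bool" where
  "kropina_data \<A> al be \<longleftrightarrow>
     riemannian_metric \<A> al \<and> one_form \<A> be \<and> (\<forall>C\<in>\<A>. \<forall>x\<in>img C. be C x \<noteq> 0)"

definition kropina_metric ::
    "(('m, 'n::finite) chart \<Rightarrow> real ^ 'n \<Rightarrow> real ^ 'n ^ 'n) \<Rightarrow>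
     (('m, 'n) chart \<Rightarrow> real ^ 'n \<Rightarrow> real ^ 'n) \<Rightarrow>
     ('m, 'n) chart \<Rightarrow> real ^ 'n \<Rightarrow> real ^ 'n \<Rightarrow> real" where
  "kropina_metric al be C x y = (sqrt (quad (al C x) y))\<^sup>2 / (be C x \<bullet> y)"

definition kropina_domain ::
    "(('m, 'n::finite) chart \<Rightarrow> real ^ 'n \<Rightarrow> real ^ 'n) \<Rightarrow>
     ('m, 'n) chart \<Rightarrow> ((real ^ 'n) \<times> (real ^ 'n)) set" where
  "kropina_domain be C = {(x, y). x \<in> img C \<and> be C x \<bullet> y > 0}"

definition raise :: "real ^ 'n ^ 'n \<Rightarrow> real ^ 'n \<Rightarrow> real ^ 'n::finite" where
  "raise A \<omega> = matrix_inv A *v \<omega>"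

text \<open>
  Note that \<open>\<parallel>\<beta>\<parallel>\<^sup>2 = a\<^sup>i\<^sup>j b\<^sub>i b\<^sub>j\<close> is the inner product of the component vectors of \<open>\<beta>\<close> and of its
  raised version.
\<close>

definition navigation_data ::
    "(('m, 'n::finite) chart \<Rightarrow> real ^ 'n \<Rightarrow> real ^ 'n ^ 'n) \<Rightarrow>
     (('m, 'n) chart \<Rightarrow> real ^ 'n \<Rightarrow> real ^ 'n) \<Rightarrow>
     (('m, 'n) chart \<Rightarrow> real ^ 'n \<Rightarrow> real ^ 'n ^ 'n) \<times> (('m, 'n) chart \<Rightarrow> real ^ 'n \<Rightarrow> real ^ 'n)"
  where
  "navigation_data al be =
     (\<lambda>C x. (4 / (be C x \<bullet> raise (al C x) (be C x))) *\<^sub>R al C x,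
      \<lambda>C x. (1 / 2) *\<^sub>R raise (al C x) (be C x))"

section \<open>Weakly weighted Einstein metrics\<close>

text \<open>
  Chartwise data: \<open>F C\<close> is the metric in the chart \<open>C\<close>, \<open>\<Omega> C\<close> its domain, \<open>vol C\<close> the density of
  the volume form.
\<close>

definition weakly_weighted_einstein_with ::
    "('m, 'n::finite) chart set \<Rightarrow> (('m, 'n) chart \<Rightarrow> real ^ 'n \<Rightarrow> real ^ 'n \<Rightarrow> real) \<Rightarrow>
     (('m, 'n) chart \<Rightarrow> ((real ^ 'n) \<times> (real ^ 'n)) set) \<Rightarrow> (('m, 'n) chart \<Rightarrow> real ^ 'n \<Rightarrow> real) \<Rightarrow>
     real \<Rightarrow> real \<Rightarrow> ('m \<Rightarrow> real) \<Rightarrow> (('m, 'n) chart \<Rightarrow> real ^ 'n \<Rightarrow> real ^ 'n) \<Rightarrow> bool" where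
  "weakly_weighted_einstein_with \<A> F \<Omega> vol a c \<sigma> \<theta> \<longleftrightarrow>
     smooth_function \<A> \<sigma> \<and> one_form \<A> \<theta> \<and>
     (\<forall>C\<in>\<A>. \<forall>(x, y)\<in>\<Omega> C.
        weighted_ricci (F C) (\<Omega> C) (vol C) a c x y =
          (real CARD('n) - 1) * (3 * (\<theta> C x \<bullet> y) / F C x y + \<sigma> (pt C x)) * (F C x y)\<^sup>2)"

definition weakly_weighted_einstein ::
    "('m, 'n::finite) chart set \<Rightarrow> (('m, 'n) chart \<Rightarrow> real ^ 'n \<Rightarrow> real ^ 'n \<Rightarrow> real) \<Rightarrow>
     (('m, 'n) chart \<Rightarrow> ((real ^ 'n) \<times> (real ^ 'n)) set) \<Rightarrow> (('m, 'n) chart \<Rightarrow> real ^ 'n \<Rightarrow> real) \<Rightarrow>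
     real \<Rightarrow> real \<Rightarrow> bool" where
  "weakly_weighted_einstein \<A> F \<Omega> vol a c \<longleftrightarrow>
     (\<exists>\<sigma> \<theta>. weakly_weighted_einstein_with \<A> F \<Omega> vol a c \<sigma> \<theta>)"

text \<open>The condition \<open>Ric\<^sup>h + a(n+1) Hess\<^sub>h f - c(n+1)\<^sup>2 df \<otimes> df = (n-1) \<mu> h\<^sup>2\<close> of quadratic forms.\<close>

definition weighted_ricci_condition ::
    "('m, 'n::finite) chart set \<Rightarrow> (('m, 'n) chart \<Rightarrow> real ^ 'n \<Rightarrow> real ^ 'n ^ 'n) \<Rightarrow>
     ('m \<Rightarrow> real) \<Rightarrow> real \<Rightarrow> real \<Rightarrow> ('m \<Rightarrow> real) \<Rightarrow> bool" where
  "weighted_ricci_condition \<A> h f a c \<mu> \<longleftrightarrow>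
     smooth_function \<A> \<mu> \<and>
     (\<forall>C\<in>\<A>. \<forall>x\<in>img C. \<forall>y.
        quad (riem_ricci (h C) x) y
          + a * (real CARD('n) + 1) * quad (hessian (h C) (f \<circ> pt C) x) y
          - c * (real CARD('n) + 1)\<^sup>2 * (df (f \<circ> pt C) x \<bullet> y)\<^sup>2
        = (real CARD('n) - 1) * \<mu> (pt C x) * quad (h C x) y)"

end

theory Submission
  imports Defs "HOL-Computational_Algebra.Polynomial"
begin

text \<open>
  The spray of \<open>F\<close> is \<open>G + p y\<close> with \<open>p = - W\<^sub>0 R\<^sub>0\<^sub>0 / h\<^sup>2\<close> and \<open>G\<close> polynomial in \<open>y\<close> and \<open>1 / W\<^sub>0\<close>. Modulo
  such polynomials \<open>h\<^sup>2 Ric\<^sub>a\<^sub>,\<^sub>c\<close> equals \<open>\<nu> h\<^sup>2 p\<^sup>2\<close>, so by the Einstein equation and \<open>\<nu> \<noteq> 0\<close> the form \<open>h\<^sup>2\<close>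
  divides \<open>(W\<^sub>0 R\<^sub>0\<^sub>0)\<^sup>2\<close> among them. Along the lines \<open>W + t u\<close> with \<open>u\<close> orthogonal to \<open>W\<close> one has \<open>W\<^sub>0 = 1\<close>
  and \<open>h\<^sup>2 = 1 + t\<^sup>2 h\<^sup>2(u)\<close>. This quadratic in \<open>t\<close> has no real zeros, and it divides the square of
  \<open>R\<^sub>0\<^sub>0\<close>, a real polynomial of degree at most 2 that vanishes at \<open>t = 0\<close> because \<open>W\<close> has unit length;
  hence \<open>R\<^sub>0\<^sub>0 = 0\<close>.

  Once \<open>W\<close> is a Killing field, the spray is that of \<open>h\<close> minus \<open>F S\<^sup>i\<^sub>0\<close>, the S-curvature is \<open>(n + 1) df\<close>,
  and \<open>Ric\<^sub>F(y) = Ric\<^sup>h(y) - 2 F Ric\<^sup>h(y, W) - F\<^sup>2 tr S\<^sup>2\<close>. Comparing coefficients along the lines \<open>u + t W\<close>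
  turns the Einstein equation into the condition on \<open>Ric\<^sup>h\<close>, with \<open>\<mu> = \<sigma> + 3/2 \<theta>(W)\<close>.
\<close>

subsection \<open>Calculus of partial derivatives\<close>

text \<open>Partial derivatives, S-curvature and geodesics are given by \<open>deriv\<close> and by
  choice, so no formula can be used before differentiability and local existence of geodesics are
  known.

  The constant \<nu> has three sources. Up to terms that lose their pole after multiplication by
  h^2, the derivative of p along G is -2 p^2. The projective change of the Ricci curvature thus
  gives 3(n-1), the derivative of the S-curvature gives -4a(n+1), and its square gives -c(n+1)^2.

  For the converse, \<theta> must be a global 1-form although its formula contains a Hessian. For a
  Killing field, f_ip W^p + f_p S^p_i is the differential of df(W), so \<theta> is a combination of
  two differentials. The formula for \<sigma> amounts to (n-1)\<sigma> = -tr S^2, because the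
  condition on Ric^h evaluated at W has the value (n-1)\<mu>.\<close>

lemma pd_eq_derivative:
  assumes "(f has_derivative f') (at x)"
  shows "pd i f x = f' (axis i 1)"
proof -
  interpret f': bounded_linear f' using assms by (rule has_derivative_bounded_linear)
  have "((\<lambda>t. x + t *\<^sub>R axis i 1) has_derivative (\<lambda>t. t *\<^sub>R axis i 1)) (at 0)"
    by (auto intro!: derivative_eq_intros)
  moreover have "(f has_derivative f') (at (x + 0 *\<^sub>R axis i 1))"
    using assms by simp
  ultimately have "((\<lambda>t. f (x + t *\<^sub>R axis i 1)) has_derivative (\<lambda>t. f' (t *\<^sub>R axis i 1))) (at 0)"
    by (rule has_derivative_compose)
  moreover have "(\<lambda>t. f' (t *\<^sub>R axis i 1)) = (*) (f' (axis i 1))"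
    by (auto simp: f'.scaleR)
  ultimately have "((\<lambda>t. f (x + t *\<^sub>R axis i 1)) has_real_derivative f' (axis i 1)) (at 0)"
    by (simp add: has_field_derivative_def)
  then show ?thesis
    unfolding pd_def by (rule DERIV_imp_deriv)
qed

lemma derivative_eq_sum_pd:
  fixes f :: "real ^ 'n::finite \<Rightarrow> real"
  assumes "(f has_derivative f') (at x)"
  shows "f' v = (\<Sum>i\<in>UNIV. pd i f x * v $ i)"
proof -
  interpret f': bounded_linear f' using assms by (rule has_derivative_bounded_linear)
  have "f' v = f' (\<Sum>i\<in>UNIV. v $ i *\<^sub>R axis i 1)"
    by (simp add: basis_expansion flip: scalar_mult_eq_scaleR)
  also have "\<dots> = (\<Sum>i\<in>UNIV. v $ i * f' (axis i 1))"
    by (simp add: f'.sum f'.scaleR)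
  finally show ?thesis
    by (simp add: pd_eq_derivative[OF assms] mult.commute)
qed

lemma pd_cong:
  assumes "open S" "x \<in> S" "\<And>z. z \<in> S \<Longrightarrow> f z = g z"
  shows "pd i f x = pd i g x"
  unfolding pd_def
proof (rule deriv_cong_ev)
  have "((\<lambda>t. x + t *\<^sub>R axis i 1) \<longlongrightarrow> x + 0 *\<^sub>R axis i 1) (nhds (0::real))"
    by (intro tendsto_intros filterlim_ident)
  from topological_tendstoD[OF this assms(1)] assms(2)
  have "\<forall>\<^sub>F t in nhds 0. x + t *\<^sub>R axis i 1 \<in> S"
    by simp
  then show "\<forall>\<^sub>F t in nhds 0. f (x + t *\<^sub>R axis i 1) = g (x + t *\<^sub>R axis i 1)"
    by eventually_elim (rule assms(3))
qed simp

lemma pd_const [simp]: "pd i (\<lambda>_. c) x = 0"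
  by (simp add: pd_def)

lemma pd_add:
  assumes "f differentiable at x" "g differentiable at x"
  shows "pd i (\<lambda>z. f z + g z) x = pd i f x + pd i g x"
proof -
  obtain f' g' where d: "(f has_derivative f') (at x)" "(g has_derivative g') (at x)"
    using assms unfolding differentiable_def by blast
  show ?thesis
    using pd_eq_derivative[OF has_derivative_add[OF d]] d[THEN pd_eq_derivative] by simp
qed

lemma pd_mult:
  assumes "f differentiable at x" "g differentiable at x"
  shows "pd i (\<lambda>z. f z * g z) x = pd i f x * g x + f x * pd i g x"
proof -
  obtain f' g' where d: "(f has_derivative f') (at x)" "(g has_derivative g') (at x)"
    using assms unfolding differentiable_def by blast
  show ?thesis
    using pd_eq_derivative[OF has_derivative_mult[OF d]] d[THEN pd_eq_derivative] by simp
qed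

lemma pd_inverse:
  assumes "f differentiable at x" "f x \<noteq> 0"
  shows "pd i (\<lambda>z. inverse (f z)) x = - (pd i f x * (inverse (f x) * inverse (f x)))"
proof -
  obtain f' where d: "(f has_derivative f') (at x)"
    using assms unfolding differentiable_def by blast
  show ?thesis
    using pd_eq_derivative[OF Deriv.has_derivative_inverse[OF assms(2) d]] pd_eq_derivative[OF d]
    by simp
qed

lemma pd_line:
  assumes "f differentiable at (x + t *\<^sub>R axis i 1)"
  shows "((\<lambda>s. f (x + s *\<^sub>R axis i 1)) has_real_derivative pd i f (x + t *\<^sub>R axis i 1)) (at t)"
proof -
  obtain f' where d: "(f has_derivative f') (at (x + t *\<^sub>R axis i 1))"
    using assms unfolding differentiable_def by blast
  interpret f': bounded_linear f' using d by (rule has_derivative_bounded_linear)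
  have "((\<lambda>s. x + s *\<^sub>R axis i 1) has_derivative (\<lambda>s. s *\<^sub>R axis i 1)) (at t)"
    by (auto intro!: derivative_eq_intros)
  from has_derivative_compose[OF this d]
  have "((\<lambda>s. f (x + s *\<^sub>R axis i 1)) has_derivative (\<lambda>s. s *\<^sub>R f' (axis i 1))) (at t)"
    by (simp add: f'.scaleR)
  also have "(\<lambda>s. s *\<^sub>R f' (axis i 1)) = (*) (f' (axis i 1))"
    by (simp add: fun_eq_iff)
  finally have "((\<lambda>s. f (x + s *\<^sub>R axis i 1)) has_derivative (*) (f' (axis i 1))) (at t)" .
  then show ?thesis
    by (simp add: has_field_derivative_def pd_eq_derivative[OF d])
qed

subsection \<open>Closure properties of smooth functions\<close>

lemma Ck_on_cong:
  assumes "open S"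
  shows "(\<And>x. x \<in> S \<Longrightarrow> f x = g x) \<Longrightarrow> Ck_on k S f \<Longrightarrow> Ck_on k S g"
proof (induction k arbitrary: f g)
  case 0
  then show ?case by (simp cong: continuous_on_cong)
next
  case (Suc k)
  have "g differentiable_on S"
    using Suc.prems unfolding differentiable_on_def differentiable_def Ck_on.simps
    by (metis has_derivative_transform)
  moreover have "Ck_on k S (pd i g)" for i
    by (rule Suc.IH[of "pd i f"]) (use Suc.prems assms in \<open>auto intro: pd_cong\<close>)
  ultimately show ?case by simp
qed

lemma Ck_on_SucD: "Ck_on (Suc k) S f \<Longrightarrow> Ck_on k S f"
proof (induction k arbitrary: f)
  case (Suc k)
  then have "Ck_on k S (pd i f)" for i
    by (metis Ck_on.simps(2))
  with Suc.prems show ?case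
    unfolding Ck_on.simps by blast
qed (simp add: differentiable_imp_continuous_on)

lemma Ck_on_differentiable:
  "open S \<Longrightarrow> x \<in> S \<Longrightarrow> Ck_on (Suc k) S f \<Longrightarrow> f differentiable at x"
  by (auto simp: differentiable_on_eq_differentiable_at)

lemma Ck_on_const:
  fixes S :: "(real ^ 'n::finite) set"
  shows "Ck_on k S (\<lambda>_. c)"
proof (induction k arbitrary: c)
  case (Suc k)
  have "pd i (\<lambda>_ :: real ^ 'n. c) = (\<lambda>_. 0)" for i by (auto simp: fun_eq_iff)
  with Suc show ?case by simp
qed simp

lemma Ck_on_add:
  assumes "open S"
  shows "Ck_on k S f \<Longrightarrow> Ck_on k S g \<Longrightarrow> Ck_on k S (\<lambda>x. f x + g x)"
proof (induction k arbitrary: f g)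
  case (Suc k)
  have "Ck_on k S (pd i (\<lambda>x. f x + g x))" for i
    by (rule Ck_on_cong[OF assms, of "\<lambda>x. pd i f x + pd i g x"])
      (use Suc assms in \<open>auto simp: pd_add differentiable_on_eq_differentiable_at\<close>)
  with Suc show ?case by (auto intro: differentiable_on_add)
qed (auto intro: continuous_intros)

lemma Ck_on_mult:
  assumes "open S"
  shows "Ck_on k S f \<Longrightarrow> Ck_on k S g \<Longrightarrow> Ck_on k S (\<lambda>x. f x * g x)"
proof (induction k arbitrary: f g)
  case (Suc k)
  \<comment> \<open>The Leibniz rule leaves undifferentiated factors, which must be lowered to order
    \<open>k\<close> before the induction hypothesis applies to the products.\<close>
  have "Ck_on k S f" "Ck_on k S g"
    using Suc.prems by (blast dest: Ck_on_SucD)+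
  then have "Ck_on k S (\<lambda>x. pd i f x * g x + f x * pd i g x)" for i
    using Suc by (intro Ck_on_add assms Suc.IH) auto
  then have "Ck_on k S (pd i (\<lambda>x. f x * g x))" for i
    by (rule Ck_on_cong[OF assms, rotated])
      (use Suc assms in \<open>auto simp: pd_mult differentiable_on_eq_differentiable_at\<close>)
  with Suc show ?case by (auto intro: differentiable_on_mult)
qed (auto intro: continuous_intros)

text \<open>The derivative of 1/f is built from \<open>pd i f\<close> and two copies of 1/f, so
  order \<open>k\<close> of the inverse itself yields order \<open>Suc k\<close>.\<close>

lemma Ck_on_inverse:
  assumes "open S" and nz: "\<And>x. x \<in> S \<Longrightarrow> f x \<noteq> 0"
  shows "Ck_on k S f \<Longrightarrow> Ck_on k S (\<lambda>x. inverse (f x))"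
proof (induction k)
  case 0
  then show ?case using nz by (auto intro!: continuous_intros)
next
  case (Suc k)
  have "Ck_on k S f"
    using Suc.prems by (rule Ck_on_SucD)
  then have inv: "Ck_on k S (\<lambda>x. inverse (f x))"
    by (rule Suc.IH)
  have "Ck_on k S (\<lambda>x. (-1) * (pd i f x * (inverse (f x) * inverse (f x))))" for i
    using Suc.prems by (intro Ck_on_mult assms Ck_on_const inv) auto
  then have "Ck_on k S (pd i (\<lambda>x. inverse (f x)))" for i
    by (rule Ck_on_cong[OF assms(1), rotated])
      (use Suc assms in \<open>auto simp: pd_inverse differentiable_on_eq_differentiable_at\<close>)
  with Suc nz assms(1) show ?case
    by (auto simp: differentiable_on_eq_differentiable_at intro: differentiable_inverse)
qed

lemma smooth_on_cong:
  assumes "open S" "\<And>x. x \<in> S \<Longrightarrow> f x = g x" "smooth_on S f"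
  shows "smooth_on S g"
  using assms Ck_on_cong unfolding smooth_on_def by metis

lemma smooth_on_differentiable: "open S \<Longrightarrow> x \<in> S \<Longrightarrow> smooth_on S f \<Longrightarrow> f differentiable at x"
  unfolding smooth_on_def using Ck_on_differentiable by blast

lemma smooth_on_const [simp]: "smooth_on S (\<lambda>_. c)"
  by (simp add: smooth_on_def Ck_on_const)

lemma smooth_on_add: "open S \<Longrightarrow> smooth_on S f \<Longrightarrow> smooth_on S g \<Longrightarrow> smooth_on S (\<lambda>x. f x + g x)"
  by (simp add: smooth_on_def Ck_on_add)

lemma smooth_on_mult: "open S \<Longrightarrow> smooth_on S f \<Longrightarrow> smooth_on S g \<Longrightarrow> smooth_on S (\<lambda>x. f x * g x)"
  by (simp add: smooth_on_def Ck_on_mult)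

lemma smooth_on_minus: "open S \<Longrightarrow> smooth_on S f \<Longrightarrow> smooth_on S (\<lambda>x. - f x)"
  using smooth_on_mult[of S "\<lambda>_. -1" f] by simp

lemma smooth_on_diff: "open S \<Longrightarrow> smooth_on S f \<Longrightarrow> smooth_on S g \<Longrightarrow> smooth_on S (\<lambda>x. f x - g x)"
  using smooth_on_add[of S f "\<lambda>x. - g x"] by (simp add: smooth_on_minus)

lemma smooth_on_inverse:
  "open S \<Longrightarrow> smooth_on S f \<Longrightarrow> (\<And>x. x \<in> S \<Longrightarrow> f x \<noteq> 0) \<Longrightarrow> smooth_on S (\<lambda>x. inverse (f x))"
  by (simp add: smooth_on_def Ck_on_inverse)

lemma smooth_on_divide:
  "open S \<Longrightarrow> smooth_on S f \<Longrightarrow> smooth_on S g \<Longrightarrow> (\<And>x. x \<in> S \<Longrightarrow> g x \<noteq> 0) \<Longrightarrow>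
    smooth_on S (\<lambda>x. f x / g x)"
  unfolding divide_inverse by (intro smooth_on_mult smooth_on_inverse)

lemma smooth_on_sum:
  "open S \<Longrightarrow> (\<And>i. i \<in> I \<Longrightarrow> smooth_on S (f i)) \<Longrightarrow> smooth_on S (\<lambda>x. \<Sum>i\<in>I. f i x)"
  by (induction I rule: infinite_finite_induct) (auto intro: smooth_on_add)

lemma smooth_on_prod:
  "open S \<Longrightarrow> (\<And>i. i \<in> I \<Longrightarrow> smooth_on S (f i)) \<Longrightarrow> smooth_on S (\<lambda>x. \<Prod>i\<in>I. f i x)"
  by (induction I rule: infinite_finite_induct) (auto intro: smooth_on_mult)

lemma smooth_on_pd: "smooth_on S f \<Longrightarrow> smooth_on S (pd i f)"
  unfolding smooth_on_def by (metis Ck_on.simps(2))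

lemma smooth_on_det:
  assumes "open S" "\<And>i j. smooth_on S (\<lambda>x. A x $ i $ j)"
  shows "smooth_on S (\<lambda>x. det (A x))"
  unfolding det_def by (intro smooth_on_sum smooth_on_mult smooth_on_prod smooth_on_const assms)

lemma matrix_inv_right_left:
  fixes A :: "real ^ 'n ^ 'n"
  assumes "det A \<noteq> 0"
  shows "A ** matrix_inv A = mat 1" "matrix_inv A ** A = mat 1"
  using assms invertible_det_nz someI_ex[of "\<lambda>B. A ** B = mat 1 \<and> B ** A = mat 1"]
  unfolding matrix_inv_def invertible_def by blast+

text \<open>Writing the entries of the inverse as quotients of determinants, hence of polynomials in
  the entries of \<open>A\<close>, reduces smoothness of the inverse to that of
  \<open>A\<close>.\<close>

lemma matrix_inv_cramer:
  fixes A :: "real ^ 'n ^ 'n"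
  assumes "det A \<noteq> 0"
  shows "matrix_inv A $ i $ j =
    det (\<chi> k l. if l = i then (if k = j then 1 else 0) else A $ k $ l) / det A"
proof -
  have "A *v (matrix_inv A *v axis j 1) = axis j 1"
    by (simp add: matrix_vector_mul_assoc matrix_inv_right_left assms)
  then have "(matrix_inv A *v axis j 1) $ i =
      det (\<chi> k l. if l = i then axis j 1 $ k else A $ k $ l) / det A"
    by (simp add: cramer[OF assms])
  moreover have "(matrix_inv A *v axis j 1) $ i = matrix_inv A $ i $ j"
    by (simp add: matrix_vector_mult_def axis_def if_distrib cong: if_cong)
  moreover have "(axis j 1 :: real ^ 'n) $ k = (if k = j then 1 else 0)" for k
    by (simp add: axis_def)
  ultimately show ?thesis by (simp cong: if_cong)
qed

lemma smooth_on_matrix_inv: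
  fixes A :: "real ^ 'm \<Rightarrow> real ^ 'n ^ 'n"
  assumes "open S" "\<And>i j. smooth_on S (\<lambda>x. A x $ i $ j)" "\<And>x. x \<in> S \<Longrightarrow> det (A x) \<noteq> 0"
  shows "smooth_on S (\<lambda>x. matrix_inv (A x) $ i $ j)"
proof (rule smooth_on_cong[OF assms(1)])
  show "smooth_on S (\<lambda>x. det (\<chi> k l. if l = i then (if k = j then 1 else 0) else A x $ k $ l) / det (A x))"
  proof (intro smooth_on_divide smooth_on_det assms)
    fix k l
    show "smooth_on S (\<lambda>x. (\<chi> k l. if l = i then (if k = j then 1 else 0) else A x $ k $ l) $ k $ l)"
      using assms(2) by (cases "l = i") auto
  qed
qed (simp add: matrix_inv_cramer assms)

subsection \<open>Symmetry of second derivatives\<close>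

text \<open>The mean value theorem acts twice: in direction \<open>i\<close> on the difference
  \<open>g\<close> of \<open>f\<close> along two parallel edges, then in direction \<open>j\<close>
  on \<open>pd i f\<close>. The bound \<open>2 * e < r\<close> keeps the whole square in the ball,
  its points being at distance at most \<open>e + e\<close> from \<open>x\<close>.\<close>

lemma second_difference_mvt:
  fixes f :: "real ^ 'n::finite \<Rightarrow> real"
  assumes "open S" "smooth_on S f" "ball x r \<subseteq> S" "0 < e" "2 * e < r"
  shows "\<exists>z\<in>ball x r.
    f (x + e *\<^sub>R axis i 1 + e *\<^sub>R axis j 1) - f (x + e *\<^sub>R axis i 1) - f (x + e *\<^sub>R axis j 1) + f x =
      e * e * pd j (pd i f) z"
proof -
  have in_ball: "x + s *\<^sub>R axis i 1 + t *\<^sub>R axis j 1 \<in> ball x r"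
    if "0 \<le> s" "s \<le> e" "0 \<le> t" "t \<le> e" for s t
  proof -
    have "norm (s *\<^sub>R axis i 1 + t *\<^sub>R axis j (1::real)) \<le> s + t"
      using that norm_triangle_ineq[of "s *\<^sub>R axis i 1" "t *\<^sub>R axis j (1::real)"] by simp
    with that assms(5) show ?thesis
      by (simp add: dist_norm norm_minus_commute algebra_simps)
  qed
  have diff: "f differentiable at z" "pd i f differentiable at z" if "z \<in> ball x r" for z
    using that assms(1-3) smooth_on_differentiable smooth_on_pd by blast+
  define g where "g s = f (x + e *\<^sub>R axis j 1 + s *\<^sub>R axis i 1) - f (x + s *\<^sub>R axis i 1)" for s
  have "(g has_real_derivative
      pd i f (x + e *\<^sub>R axis j 1 + s *\<^sub>R axis i 1) - pd i f (x + s *\<^sub>R axis i 1)) (at s)"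
    if "0 \<le> s" "s \<le> e" for s
    unfolding g_def
    using in_ball[of s e] in_ball[of s 0] that assms(4)
    by (intro DERIV_diff pd_line diff) (auto simp: algebra_simps)
  from MVT2[OF assms(4) this] obtain s where s: "0 < s" "s < e"
    and gs: "g e - g 0 = e * (pd i f (x + e *\<^sub>R axis j 1 + s *\<^sub>R axis i 1) - pd i f (x + s *\<^sub>R axis i 1))"
    by auto
  have "((\<lambda>t. pd i f (x + s *\<^sub>R axis i 1 + t *\<^sub>R axis j 1)) has_real_derivative
      pd j (pd i f) (x + s *\<^sub>R axis i 1 + t *\<^sub>R axis j 1)) (at t)"
    if "0 \<le> t" "t \<le> e" for t
    using in_ball[of s t] that s by (intro pd_line diff) auto
  from MVT2[OF assms(4) this] obtain t where t: "0 < t" "t < e"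
    and ht: "pd i f (x + s *\<^sub>R axis i 1 + e *\<^sub>R axis j 1) - pd i f (x + s *\<^sub>R axis i 1)
        = e * pd j (pd i f) (x + s *\<^sub>R axis i 1 + t *\<^sub>R axis j 1)"
    by auto
  have "x + s *\<^sub>R axis i 1 + t *\<^sub>R axis j 1 \<in> ball x r"
    using in_ball s t by auto
  moreover have "f (x + e *\<^sub>R axis i 1 + e *\<^sub>R axis j 1) - f (x + e *\<^sub>R axis i 1) - f (x + e *\<^sub>R axis j 1) + f x
      = g e - g 0"
    by (simp add: g_def algebra_simps)
  moreover have "x + e *\<^sub>R axis j 1 + s *\<^sub>R axis i 1 = x + s *\<^sub>R axis i 1 + e *\<^sub>R axis j 1"
    by simp
  ultimately show ?thesis
    using gs ht by (metis mult.assoc)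
qed

text \<open>The second difference is symmetric in the two directions, so both mixed derivatives take
  a common value at points of an arbitrarily small ball; continuity does the rest.\<close>

lemma pd_pd_commute:
  fixes f :: "real ^ 'n::finite \<Rightarrow> real"
  assumes "open S" "smooth_on S f" "x \<in> S"
  shows "pd i (pd j f) x = pd j (pd i f) x"
proof (rule ccontr)
  assume neq: "pd i (pd j f) x \<noteq> pd j (pd i f) x"
  \<comment> \<open>Half of the supposed gap: two values that are equal, each within
    \<open>d\<close> of its limit, leave no room for a gap of \<open>2 * d\<close>.\<close>
  define d where "d = \<bar>pd i (pd j f) x - pd j (pd i f) x\<bar> / 2"
  have "d > 0" using neq by (simp add: d_def)
  have cont: "continuous (at x) (pd k (pd l f))" for k l
    using assms by (intro differentiable_imp_continuous_within smooth_on_differentiable[of S] smooth_on_pd)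
  obtain r1 where r1: "r1 > 0" "\<And>z. dist z x < r1 \<Longrightarrow> dist (pd i (pd j f) z) (pd i (pd j f) x) < d"
    using cont[of i j] \<open>d > 0\<close> unfolding continuous_at_eps_delta by blast
  obtain r2 where r2: "r2 > 0" "\<And>z. dist z x < r2 \<Longrightarrow> dist (pd j (pd i f) z) (pd j (pd i f) x) < d"
    using cont[of j i] \<open>d > 0\<close> unfolding continuous_at_eps_delta by blast
  obtain r3 where r3: "r3 > 0" "ball x r3 \<subseteq> S"
    using assms openE by blast
  define r where "r = min r1 (min r2 r3)"
  have r: "r > 0" "ball x r \<subseteq> S"
    using r1 r2 r3 by (auto simp: r_def)
  obtain z1 where z1: "z1 \<in> ball x r"
    "f (x + (r/3) *\<^sub>R axis i 1 + (r/3) *\<^sub>R axis j 1) - f (x + (r/3) *\<^sub>R axis i 1) - f (x + (r/3) *\<^sub>R axis j 1) + f x =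
      (r/3) * (r/3) * pd j (pd i f) z1"
    using second_difference_mvt[OF assms(1,2) r(2), of "r/3" i j] r(1) by auto
  obtain z2 where z2: "z2 \<in> ball x r"
    "f (x + (r/3) *\<^sub>R axis j 1 + (r/3) *\<^sub>R axis i 1) - f (x + (r/3) *\<^sub>R axis j 1) - f (x + (r/3) *\<^sub>R axis i 1) + f x =
      (r/3) * (r/3) * pd i (pd j f) z2"
    using second_difference_mvt[OF assms(1,2) r(2), of "r/3" j i] r(1) by auto
  have swap: "x + (r/3) *\<^sub>R axis j 1 + (r/3) *\<^sub>R axis i 1 = x + (r/3) *\<^sub>R axis i 1 + (r/3) *\<^sub>R axis j 1"
    by simp
  have "(r/3) * (r/3) * pd j (pd i f) z1 = (r/3) * (r/3) * pd i (pd j f) z2"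
    using z1(2) z2(2) unfolding swap by linarith
  then have "pd j (pd i f) z1 = pd i (pd j f) z2"
    using r(1) by simp
  moreover have "dist (pd j (pd i f) z1) (pd j (pd i f) x) < d"
    using z1 by (intro r2) (simp add: r_def dist_commute)
  moreover have "dist (pd i (pd j f) z2) (pd i (pd j f) x) < d"
    using z2 by (intro r1) (simp add: r_def dist_commute)
  ultimately show False
    by (simp add: d_def dist_real_def abs_if split: if_splits)
qed

subsection \<open>Functions of position and direction\<close>

text \<open>The sum type as index set treats positions (\<open>Inl\<close>) and directions
  (\<open>Inr\<close>) alike, so that each differentiation rule and the commutation law need only
  one statement.\<close>

definition dd :: "'n + 'n \<Rightarrow> (real ^ 'n::finite \<Rightarrow> real ^ 'n \<Rightarrow> real) \<Rightarrow> real ^ 'n \<Rightarrow> real ^ 'n \<Rightarrow> real" where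
  "dd s \<phi> x y = (case s of Inl k \<Rightarrow> pd k (\<lambda>z. \<phi> z y) x | Inr k \<Rightarrow> pd k (\<phi> x) y)"

text \<open>Joint differentiability is required: the mere existence of partial derivatives would not
  justify the chain rule along curves in the tangent bundle.\<close>

definition tdiff :: "(real ^ 'n::finite \<Rightarrow> real ^ 'n \<Rightarrow> real) \<Rightarrow> real ^ 'n \<Rightarrow> real ^ 'n \<Rightarrow> bool" where
  "tdiff \<phi> x y \<longleftrightarrow> (\<lambda>p. \<phi> (fst p) (snd p)) differentiable at (x, y)"

lemma tdiffE:
  assumes "tdiff \<phi> x y"
  obtains "(\<lambda>z. \<phi> z y) differentiable at x" "\<phi> x differentiable at y"
proof -
  obtain D where D: "((\<lambda>p. \<phi> (fst p) (snd p)) has_derivative D) (at (x, y))"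
    using assms unfolding tdiff_def differentiable_def by blast
  have "((\<lambda>z. (z, y)) has_derivative (\<lambda>v. (v, 0))) (at x)"
    "((\<lambda>z. (x, z)) has_derivative (\<lambda>v. (0, v))) (at y)"
    by (auto intro!: derivative_eq_intros)
  from this[THEN has_derivative_compose, OF D] show thesis
    by (intro that) (auto simp: differentiable_def)
qed

lemma tdiff_deriv:
  assumes "((\<lambda>p. \<phi> (fst p) (snd p)) has_derivative D) (at (x, y))"
  shows "D (u, v) = (\<Sum>k\<in>UNIV. dd (Inl k) \<phi> x y * u $ k) + (\<Sum>k\<in>UNIV. dd (Inr k) \<phi> x y * v $ k)"
proof -
  interpret D: bounded_linear D using assms by (rule has_derivative_bounded_linear)
  have "((\<lambda>z. (z, y)) has_derivative (\<lambda>v. (v, 0))) (at x)"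
    "((\<lambda>z. (x, z)) has_derivative (\<lambda>v. (0, v))) (at y)"
    by (auto intro!: derivative_eq_intros)
  note this[THEN has_derivative_compose, OF assms]
  then have "D (u, 0) = (\<Sum>k\<in>UNIV. dd (Inl k) \<phi> x y * u $ k)"
    "D (0, v) = (\<Sum>k\<in>UNIV. dd (Inr k) \<phi> x y * v $ k)"
    by (auto simp: dd_def dest: derivative_eq_sum_pd)
  moreover have "D (u, v) = D (u, 0) + D (0, v)"
    by (simp flip: D.add)
  ultimately show ?thesis by simp
qed

lemma tdiff_chain:
  assumes "tdiff \<phi> (c t) (v t)" "(c has_vector_derivative c') (at t)" "(v has_vector_derivative v') (at t)"
  shows "((\<lambda>t. \<phi> (c t) (v t)) has_real_derivative
    (\<Sum>k\<in>UNIV. dd (Inl k) \<phi> (c t) (v t) * c' $ k) + (\<Sum>k\<in>UNIV. dd (Inr k) \<phi> (c t) (v t) * v' $ k)) (at t)"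
proof -
  obtain D where D: "((\<lambda>p. \<phi> (fst p) (snd p)) has_derivative D) (at (c t, v t))"
    using assms(1) unfolding tdiff_def differentiable_def by blast
  interpret D: bounded_linear D using D by (rule has_derivative_bounded_linear)
  have "((\<lambda>t. (c t, v t)) has_derivative (\<lambda>h. (h *\<^sub>R c', h *\<^sub>R v'))) (at t)"
    using assms(2,3) unfolding has_vector_derivative_def by (intro has_derivative_Pair)
  from has_derivative_compose[OF this D]
  have "((\<lambda>t. \<phi> (c t) (v t)) has_derivative (\<lambda>h. D (h *\<^sub>R c', h *\<^sub>R v'))) (at t)"
    by simp
  also have "(\<lambda>h. D (h *\<^sub>R c', h *\<^sub>R v')) = (*) (D (c', v'))"
    using D.scaleR[of _ "(c', v')"] by (simp add: fun_eq_iff)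
  finally show ?thesis
    by (simp add: has_field_derivative_def tdiff_deriv[OF D])
qed

lemma tdiff_add: "tdiff \<phi> x y \<Longrightarrow> tdiff \<psi> x y \<Longrightarrow> tdiff (\<lambda>x y. \<phi> x y + \<psi> x y) x y"
  and tdiff_mult: "tdiff \<phi> x y \<Longrightarrow> tdiff \<psi> x y \<Longrightarrow> tdiff (\<lambda>x y. \<phi> x y * \<psi> x y) x y"
  and tdiff_inverse: "tdiff \<phi> x y \<Longrightarrow> \<phi> x y \<noteq> 0 \<Longrightarrow> tdiff (\<lambda>x y. inverse (\<phi> x y)) x y"
  unfolding tdiff_def
  by (auto intro: differentiable_add differentiable_mult differentiable_inverse)

lemma dd_add:
  assumes "tdiff \<phi> x y" "tdiff \<psi> x y"
  shows "dd s (\<lambda>x y. \<phi> x y + \<psi> x y) x y = dd s \<phi> x y + dd s \<psi> x y"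
  using assms by (auto simp: dd_def pd_add elim!: tdiffE split: sum.split)

lemma dd_mult:
  assumes "tdiff \<phi> x y" "tdiff \<psi> x y"
  shows "dd s (\<lambda>x y. \<phi> x y * \<psi> x y) x y = dd s \<phi> x y * \<psi> x y + \<phi> x y * dd s \<psi> x y"
  using assms by (auto simp: dd_def pd_mult elim!: tdiffE split: sum.split)

lemma dd_inverse:
  assumes "tdiff \<phi> x y" "\<phi> x y \<noteq> 0"
  shows "dd s (\<lambda>x y. inverse (\<phi> x y)) x y = - (dd s \<phi> x y * (inverse (\<phi> x y) * inverse (\<phi> x y)))"
  using assms by (auto simp: dd_def pd_inverse elim!: tdiffE split: sum.split)

lemma dd_coef [simp]:
  "dd (Inl k) (\<lambda>x y. g x) x y = pd k g x"
  "dd (Inr k) (\<lambda>x y. g x) x y = 0"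
  by (simp_all add: dd_def)

lemma dd_var [simp]:
  "dd (Inl k) (\<lambda>x y. y $ i) x y = 0"
  "dd (Inr k) (\<lambda>x y. y $ i) x y = (if i = k then 1 else 0)"
proof -
  have "((\<lambda>y :: real ^ 'a. y $ i) has_derivative (\<lambda>v. v $ i)) (at y)"
    by (rule bounded_linear_imp_has_derivative[OF bounded_linear_vec_nth])
  from pd_eq_derivative[OF this, of k] show "dd (Inr k) (\<lambda>x y. y $ i) x y = (if i = k then 1 else 0)"
    by (simp add: dd_def axis_def)
qed (simp add: dd_def)

lemma dd_const [simp]: "dd s (\<lambda>_ _. c) x y = 0"
  by (simp add: dd_def split: sum.split)

lemma dd_cong:
  assumes "open \<Omega>" "(x, y) \<in> \<Omega>" "\<And>x y. (x, y) \<in> \<Omega> \<Longrightarrow> \<phi> x y = \<psi> x y"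
  shows "dd s \<phi> x y = dd s \<psi> x y"
proof -
  have "open ((\<lambda>z. (z, y)) -` \<Omega>)" "open (Pair x -` \<Omega>)"
    by (intro open_vimage assms(1) continuous_intros)+
  note eq = this[THEN pd_cong]
  have "pd k (\<lambda>z. \<phi> z y) x = pd k (\<lambda>z. \<psi> z y) x" "pd k (\<phi> x) y = pd k (\<psi> x) y" for k
    by (rule eq; use assms(2,3) in simp)+
  then show ?thesis
    by (simp add: dd_def split: sum.split)
qed

text \<open>Differentiate along the ray through \<open>y\<close> at \<open>s = 1\<close>, once by
  the chain rule and once by homogeneity. Only \<open>s > 0\<close> is available because the domains
  are conic.\<close>

lemma euler_homogeneous:
  fixes y :: "real ^ 'n::finite"
  assumes "tdiff \<phi> x y" "\<And>s. s > 0 \<Longrightarrow> \<phi> x (s *\<^sub>R y) = s ^ r * \<phi> x y"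
  shows "(\<Sum>k\<in>UNIV. y $ k * dd (Inr k) \<phi> x y) = real r * \<phi> x y"
proof -
  have "((\<lambda>s. s *\<^sub>R y) has_vector_derivative y) (at 1)"
    by (auto intro!: derivative_eq_intros)
  from tdiff_chain[OF _ has_vector_derivative_const this, of \<phi> x]
  have "((\<lambda>s. \<phi> x (s *\<^sub>R y)) has_real_derivative (\<Sum>k\<in>UNIV. dd (Inr k) \<phi> x y * y $ k)) (at 1)"
    using assms(1) by simp
  moreover have "((\<lambda>s. \<phi> x (s *\<^sub>R y)) has_real_derivative real r * \<phi> x y) (at 1)"
  proof (rule has_field_derivative_transform_within_open[where S = "{0<..}"])
    show "((\<lambda>s. s ^ r * \<phi> x y) has_real_derivative real r * \<phi> x y) (at 1)"
      by (auto intro!: derivative_eq_intros)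
  qed (use assms(2) in simp_all)
  ultimately have "(\<Sum>k\<in>UNIV. dd (Inr k) \<phi> x y * y $ k) = real r * \<phi> x y"
    by (rule DERIV_unique)
  then show ?thesis
    by (simp add: mult.commute)
qed

text \<open>Only members of \<open>dens\<close> may be inverted. With \<open>dens = UNIV\<close>
  this is the general calculus; with \<open>dens = {w}\<close> it consists of the polynomials in
  \<open>y\<close> and 1/w whose coefficients depend on \<open>x\<close>. The rule
  \<open>rat_cong\<close> makes membership a matter of the values on
  \<open>\<Omega>\<close>.\<close>

inductive_set rat ::
  "(real ^ 'n::finite) set \<Rightarrow> ((real ^ 'n) \<times> (real ^ 'n)) set \<Rightarrow> (real ^ 'n \<Rightarrow> real ^ 'n \<Rightarrow> real) set \<Rightarrow>
    (real ^ 'n \<Rightarrow> real ^ 'n \<Rightarrow> real) set"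
  for U \<Omega> dens where
  rat_coef: "smooth_on U g \<Longrightarrow> (\<lambda>x y. g x) \<in> rat U \<Omega> dens"
| rat_var: "(\<lambda>x y. y $ i) \<in> rat U \<Omega> dens"
| rat_add: "\<phi> \<in> rat U \<Omega> dens \<Longrightarrow> \<psi> \<in> rat U \<Omega> dens \<Longrightarrow> (\<lambda>x y. \<phi> x y + \<psi> x y) \<in> rat U \<Omega> dens"
| rat_mult: "\<phi> \<in> rat U \<Omega> dens \<Longrightarrow> \<psi> \<in> rat U \<Omega> dens \<Longrightarrow> (\<lambda>x y. \<phi> x y * \<psi> x y) \<in> rat U \<Omega> dens"
| rat_inverse: "\<phi> \<in> rat U \<Omega> dens \<Longrightarrow> \<phi> \<in> dens \<Longrightarrow> (\<And>x y. (x, y) \<in> \<Omega> \<Longrightarrow> \<phi> x y \<noteq> 0) \<Longrightarrow>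
    (\<lambda>x y. inverse (\<phi> x y)) \<in> rat U \<Omega> dens"
| rat_cong: "\<phi> \<in> rat U \<Omega> dens \<Longrightarrow> (\<And>x y. (x, y) \<in> \<Omega> \<Longrightarrow> \<psi> x y = \<phi> x y) \<Longrightarrow> \<psi> \<in> rat U \<Omega> dens"

lemma rat_const: "(\<lambda>x y. c) \<in> rat U \<Omega> dens"
  by (rule rat_coef) simp

lemma rat_minus: "\<phi> \<in> rat U \<Omega> dens \<Longrightarrow> (\<lambda>x y. - \<phi> x y) \<in> rat U \<Omega> dens"
  by (rule rat_cong[OF rat_mult[OF rat_const[where c = "-1"]]]) auto

lemma rat_diff:
  "\<phi> \<in> rat U \<Omega> dens \<Longrightarrow> \<psi> \<in> rat U \<Omega> dens \<Longrightarrow> (\<lambda>x y. \<phi> x y - \<psi> x y) \<in> rat U \<Omega> dens"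
  by (rule rat_cong[OF rat_add[OF _ rat_minus]]) auto

lemma rat_sum:
  "(\<And>i. i \<in> I \<Longrightarrow> \<phi> i \<in> rat U \<Omega> dens) \<Longrightarrow> (\<lambda>x y. \<Sum>i\<in>I. \<phi> i x y) \<in> rat U \<Omega> dens"
  by (induction I rule: infinite_finite_induct) (auto intro: rat_const rat_add)

lemma rat_divide_const: "\<phi> \<in> rat U \<Omega> dens \<Longrightarrow> (\<lambda>x y. \<phi> x y / c) \<in> rat U \<Omega> dens"
  unfolding divide_inverse by (intro rat_mult rat_const)

locale tangent_domain =
  fixes U :: "(real ^ 'n::finite) set" and \<Omega> :: "((real ^ 'n) \<times> (real ^ 'n)) set"
  assumes open_U: "open U" and open_\<Omega>: "open \<Omega>" and \<Omega>_base: "(x, y) \<in> \<Omega> \<Longrightarrow> x \<in> U"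
begin

abbreviation rats :: "(real ^ 'n \<Rightarrow> real ^ 'n \<Rightarrow> real) set" where
  "rats \<equiv> rat U \<Omega> UNIV"

lemma rat_tdiff: "\<phi> \<in> rat U \<Omega> dens \<Longrightarrow> (x, y) \<in> \<Omega> \<Longrightarrow> tdiff \<phi> x y"
proof (induction arbitrary: x y rule: rat.induct)
  case (rat_coef g)
  obtain D where "(g has_derivative D) (at x)"
    using smooth_on_differentiable[OF open_U \<Omega>_base[OF rat_coef(2)] rat_coef(1)]
    unfolding differentiable_def by blast
  then have "(g has_derivative D) (at (fst (x, y)))"
    by simp
  from has_derivative_compose[OF has_derivative_fst[OF has_derivative_ident] this]
  show ?case
    unfolding tdiff_def differentiable_def by blast
next
  case (rat_var i)
  have "((\<lambda>p :: (real ^ 'n) \<times> (real ^ 'n). snd p $ i) has_derivative (\<lambda>p. snd p $ i)) (at (x, y))"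
    by (intro bounded_linear_imp_has_derivative bounded_linear_compose[OF bounded_linear_vec_nth bounded_linear_snd])
  then show ?case
    unfolding tdiff_def differentiable_def by blast
next
  case (rat_cong \<phi> \<psi>)
  obtain D where D: "((\<lambda>p. \<phi> (fst p) (snd p)) has_derivative D) (at (x, y))"
    using rat_cong.IH[OF rat_cong.prems] unfolding tdiff_def differentiable_def by blast
  have "((\<lambda>p. \<psi> (fst p) (snd p)) has_derivative D) (at (x, y))"
    by (rule has_derivative_transform_within_open[OF D open_\<Omega>])
      (use rat_cong.prems rat_cong.hyps(2) in \<open>simp_all add: split_beta\<close>)
  then show ?case
    unfolding tdiff_def differentiable_def by blast
next
  case (rat_add \<phi> \<psi>)
  show ?case by (intro tdiff_add rat_add.IH rat_add.prems)
next
  case (rat_mult \<phi> \<psi>)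
  show ?case by (intro tdiff_mult rat_mult.IH rat_mult.prems)
next
  case (rat_inverse \<phi>)
  show ?case by (intro tdiff_inverse rat_inverse.IH rat_inverse.prems rat_inverse.hyps(3))
qed

text \<open>No new denominators appear: the derivative of an inverse involves only the same inverse,
  squared. Hence \<open>dens\<close> survives differentiation.\<close>

lemma rat_dd: "\<phi> \<in> rat U \<Omega> dens \<Longrightarrow> dd s \<phi> \<in> rat U \<Omega> dens"
proof (induction rule: rat.induct)
  case (rat_coef g)
  show ?case
  proof (cases s)
    case (Inl k)
    have "(\<lambda>x y. pd k g x) \<in> rat U \<Omega> dens"
      by (intro rat.rat_coef smooth_on_pd rat_coef)
    then show ?thesis
      by (rule rat_cong) (simp add: Inl)
  next
    case (Inr k)
    show ?thesis by (rule rat_cong[OF rat_const[where c = 0]]) (simp add: Inr)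
  qed
next
  case (rat_var i)
  show ?case
  proof (cases s)
    case (Inl k)
    show ?thesis by (rule rat_cong[OF rat_const[where c = 0]]) (simp add: Inl)
  next
    case (Inr k)
    show ?thesis by (rule rat_cong[OF rat_const[where c = "if i = k then 1 else 0"]]) (simp add: Inr)
  qed
next
  case (rat_add \<phi> \<psi>)
  show ?case
    by (rule rat_cong[OF rat.rat_add[OF rat_add.IH]]) (use rat_add in \<open>simp add: dd_add rat_tdiff\<close>)
next
  case (rat_mult \<phi> \<psi>)
  show ?case
    by (rule rat_cong[OF rat.rat_add[OF rat.rat_mult[OF rat_mult.IH(1) rat_mult.hyps(2)]
          rat.rat_mult[OF rat_mult.hyps(1) rat_mult.IH(2)]]])
      (use rat_mult in \<open>simp add: dd_mult rat_tdiff\<close>)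
next
  case (rat_inverse \<phi>)
  then have inv: "(\<lambda>x y. inverse (\<phi> x y)) \<in> rat U \<Omega> dens"
    by (intro rat.rat_inverse)
  show ?case
    by (rule rat_cong[OF rat_minus[OF rat.rat_mult[OF rat_inverse.IH rat.rat_mult[OF inv inv]]]])
      (use rat_inverse in \<open>simp add: dd_inverse rat_tdiff\<close>)
next
  case (rat_cong \<phi> \<psi>)
  show ?case
    by (rule rat.rat_cong[OF rat_cong.IH], rule dd_cong[OF open_\<Omega>]) (use rat_cong in auto)
qed

lemma dd_cong': "(x, y) \<in> \<Omega> \<Longrightarrow> (\<And>x y. (x, y) \<in> \<Omega> \<Longrightarrow> \<phi> x y = \<psi> x y) \<Longrightarrow> dd s \<phi> x y = dd s \<psi> x y"
  by (rule dd_cong[OF open_\<Omega>])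

lemmas rats_tdiff = rat_tdiff[where dens = UNIV]

lemma rats_dd_add:
  "\<phi> \<in> rats \<Longrightarrow> \<psi> \<in> rats \<Longrightarrow> (x, y) \<in> \<Omega> \<Longrightarrow>
    dd s (\<lambda>x y. \<phi> x y + \<psi> x y) x y = dd s \<phi> x y + dd s \<psi> x y"
  by (simp add: dd_add rat_tdiff)

lemma rats_dd_mult:
  "\<phi> \<in> rats \<Longrightarrow> \<psi> \<in> rats \<Longrightarrow> (x, y) \<in> \<Omega> \<Longrightarrow>
    dd s (\<lambda>x y. \<phi> x y * \<psi> x y) x y = dd s \<phi> x y * \<psi> x y + \<phi> x y * dd s \<psi> x y"
  by (simp add: dd_mult rat_tdiff)

lemma rats_dd_minus:
  "\<phi> \<in> rats \<Longrightarrow> (x, y) \<in> \<Omega> \<Longrightarrow> dd s (\<lambda>x y. - \<phi> x y) x y = - dd s \<phi> x y"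
  using rats_dd_mult[of "\<lambda>_ _. -1" \<phi> x y s] by (simp add: rat_const)

lemma rats_dd_diff:
  "\<phi> \<in> rats \<Longrightarrow> \<psi> \<in> rats \<Longrightarrow> (x, y) \<in> \<Omega> \<Longrightarrow>
    dd s (\<lambda>x y. \<phi> x y - \<psi> x y) x y = dd s \<phi> x y - dd s \<psi> x y"
  using rats_dd_add[of \<phi> "\<lambda>x y. - \<psi> x y" x y s] by (simp add: rats_dd_minus rat_minus)

lemma rats_dd_inverse:
  "\<phi> \<in> rats \<Longrightarrow> \<phi> x y \<noteq> 0 \<Longrightarrow> (x, y) \<in> \<Omega> \<Longrightarrow>
    dd s (\<lambda>x y. inverse (\<phi> x y)) x y = - (dd s \<phi> x y * (inverse (\<phi> x y) * inverse (\<phi> x y)))"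
  by (simp add: dd_inverse rat_tdiff)

lemma rats_dd_divide_const:
  "\<phi> \<in> rats \<Longrightarrow> (x, y) \<in> \<Omega> \<Longrightarrow> dd s (\<lambda>x y. \<phi> x y / c) x y = dd s \<phi> x y / c"
  unfolding divide_inverse by (subst rats_dd_mult) (auto intro: rat_const)

lemma rats_dd_sum:
  "(\<And>i. i \<in> I \<Longrightarrow> \<phi> i \<in> rats) \<Longrightarrow> (x, y) \<in> \<Omega> \<Longrightarrow>
    dd s (\<lambda>x y. \<Sum>i\<in>I. \<phi> i x y) x y = (\<Sum>i\<in>I. dd s (\<phi> i) x y)"
  by (induction I rule: infinite_finite_induct) (auto simp: rats_dd_add rat_sum)

lemmas rats_dd_simps = rats_dd_add rats_dd_mult rats_dd_minus rats_dd_diff rats_dd_sum rats_dd_divide_const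

text \<open>Only the coefficients need Schwarz's theorem. For sums, products and inverses the second
  derivative expands into an expression that is symmetric in \<open>s\<close> and \<open>t\<close>
  up to the induction hypotheses.\<close>

lemma rat_dd_commute: "\<phi> \<in> rats \<Longrightarrow> (x, y) \<in> \<Omega> \<Longrightarrow> dd s (dd t \<phi>) x y = dd t (dd s \<phi>) x y"
proof (induction arbitrary: x y s t rule: rat.induct)
  case (rat_coef g)
  have eta: "dd (Inl k) (\<lambda>x y. g x) = (\<lambda>x y. pd k g x)" "dd (Inr k) (\<lambda>x y. g x) = (\<lambda>x y. 0)" for k
    by (simp_all add: fun_eq_iff)
  have "pd k (pd l g) x = pd l (pd k g) x" for k l
    using pd_pd_commute[OF open_U rat_coef(1) \<Omega>_base] rat_coef(2) by blast
  then show ?case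
    by (cases s; cases t) (simp_all add: eta)
next
  case (rat_var i)
  have eta: "dd (Inl k) (\<lambda>x y. y $ i) = (\<lambda>x y. 0)"
    "dd (Inr k) (\<lambda>x y. y $ i) = (\<lambda>x y. if i = k then 1 else 0)" for k
    by (simp_all add: fun_eq_iff)
  show ?case
    by (cases s; cases t) (simp_all add: eta)
next
  case (rat_add \<phi> \<psi>)
  have *: "dd s (dd t (\<lambda>x y. \<phi> x y + \<psi> x y)) x y = dd s (dd t \<phi>) x y + dd s (dd t \<psi>) x y" for s t
  proof -
    have "dd s (dd t (\<lambda>x y. \<phi> x y + \<psi> x y)) x y = dd s (\<lambda>x y. dd t \<phi> x y + dd t \<psi> x y) x y"
      using rat_add by (intro dd_cong') (auto simp: rats_dd_add)
    with rat_add show ?thesis by (simp add: rats_dd_add rat_dd)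
  qed
  show ?case unfolding * using rat_add by simp
next
  case (rat_mult \<phi> \<psi>)
  have *: "dd s (dd t (\<lambda>x y. \<phi> x y * \<psi> x y)) x y =
      dd s (dd t \<phi>) x y * \<psi> x y + dd t \<phi> x y * dd s \<psi> x y + dd s \<phi> x y * dd t \<psi> x y + \<phi> x y * dd s (dd t \<psi>) x y" for s t
  proof -
    have "dd s (dd t (\<lambda>x y. \<phi> x y * \<psi> x y)) x y = dd s (\<lambda>x y. dd t \<phi> x y * \<psi> x y + \<phi> x y * dd t \<psi> x y) x y"
      using rat_mult by (intro dd_cong') (auto simp: rats_dd_mult)
    with rat_mult show ?thesis by (simp add: rats_dd_add rats_dd_mult rat_dd rat.rat_mult)
  qed
  show ?case unfolding * using rat_mult by simp
next
  case (rat_inverse \<phi>)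
  have *: "dd s (dd t (\<lambda>x y. inverse (\<phi> x y))) x y =
      - (dd s (dd t \<phi>) x y * (inverse (\<phi> x y) * inverse (\<phi> x y))) +
      2 * dd s \<phi> x y * dd t \<phi> x y * inverse (\<phi> x y) ^ 3" for s t
  proof -
    have inv: "(\<lambda>x y. inverse (\<phi> x y)) \<in> rats"
      using rat_inverse by (intro rat.rat_inverse) auto
    have "dd s (dd t (\<lambda>x y. inverse (\<phi> x y))) x y =
        dd s (\<lambda>x y. - (dd t \<phi> x y * (inverse (\<phi> x y) * inverse (\<phi> x y)))) x y"
      using rat_inverse by (intro dd_cong') (auto simp: rats_dd_inverse)
    with rat_inverse inv show ?thesis
      by (simp add: rats_dd_minus rats_dd_mult rats_dd_inverse rat_dd rat.rat_mult)
        (simp add: algebra_simps power3_eq_cube)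
  qed
  show ?case unfolding * using rat_inverse by simp
next
  case (rat_cong \<phi> \<psi>)
  have *: "dd s (dd t \<psi>) x y = dd s (dd t \<phi>) x y" for s t
    by (intro dd_cong' rat_cong) auto
  show ?case unfolding * using rat_cong by simp
qed

text \<open>The derivation by the spray vector field y^k d/dx^k - 2 G^k d/dy^k, whose integral
  curves are the lifted geodesics.\<close>

definition along :: "('n \<Rightarrow> real ^ 'n \<Rightarrow> real ^ 'n \<Rightarrow> real) \<Rightarrow> (real ^ 'n \<Rightarrow> real ^ 'n \<Rightarrow> real) \<Rightarrow>
    real ^ 'n \<Rightarrow> real ^ 'n \<Rightarrow> real" where
  "along G \<phi> x y = (\<Sum>k\<in>UNIV. y $ k * dd (Inl k) \<phi> x y) - 2 * (\<Sum>k\<in>UNIV. G k x y * dd (Inr k) \<phi> x y)"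

lemma rat_along:
  "(\<And>k. G k \<in> rat U \<Omega> dens) \<Longrightarrow> \<phi> \<in> rat U \<Omega> dens \<Longrightarrow> along G \<phi> \<in> rat U \<Omega> dens"
  unfolding along_def by (intro rat_diff rat_sum rat_mult rat_const rat_var rat_dd)

lemma along_cong:
  "(x, y) \<in> \<Omega> \<Longrightarrow> (\<And>x y. (x, y) \<in> \<Omega> \<Longrightarrow> \<phi> x y = \<psi> x y) \<Longrightarrow> along G \<phi> x y = along G \<psi> x y"
  unfolding along_def by (simp cong: dd_cong')

lemma along_add:
  "\<phi> \<in> rats \<Longrightarrow> \<psi> \<in> rats \<Longrightarrow> (x, y) \<in> \<Omega> \<Longrightarrow>
    along G (\<lambda>x y. \<phi> x y + \<psi> x y) x y = along G \<phi> x y + along G \<psi> x y"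
  by (simp add: along_def rats_dd_add algebra_simps sum.distrib)

lemma along_mult:
  "\<phi> \<in> rats \<Longrightarrow> \<psi> \<in> rats \<Longrightarrow> (x, y) \<in> \<Omega> \<Longrightarrow>
    along G (\<lambda>x y. \<phi> x y * \<psi> x y) x y = along G \<phi> x y * \<psi> x y + \<phi> x y * along G \<psi> x y"
  by (simp add: along_def rats_dd_mult algebra_simps sum.distrib sum_distrib_left)

lemma along_cmult:
  "\<phi> \<in> rats \<Longrightarrow> (x, y) \<in> \<Omega> \<Longrightarrow> along G (\<lambda>x y. c * \<phi> x y) x y = c * along G \<phi> x y"
  using along_mult[of "\<lambda>_ _. c" \<phi> x y G] by (simp add: rat_const along_def)

text \<open>A projective change of the spray alters the derivation by an Euler operator, which acts
  on homogeneous functions as a scalar.\<close>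

lemma along_homogeneous_shift:
  "along (\<lambda>k x y. G k x y + p x y * y $ k) \<phi> x y =
    along G \<phi> x y - 2 * p x y * (\<Sum>k\<in>UNIV. y $ k * dd (Inr k) \<phi> x y)"
  by (simp add: along_def algebra_simps sum.distrib sum_distrib_left)

end

subsection \<open>Local solutions of ordinary differential equations\<close>

text \<open>Used twice in the fixed-point argument: to bound the displacement of a solution and to
  prove the contraction estimate.\<close>

lemma indefinite_integral_lipschitz:
  fixes g :: "real \<Rightarrow> 'a::banach"
  assumes "continuous_on {a..b} g" "\<And>t. t \<in> {a..b} \<Longrightarrow> norm (g t) \<le> B" "s \<in> {a..b}" "t \<in> {a..b}"
  shows "norm (integral {a..t} g - integral {a..s} g) \<le> B * \<bar>t - s\<bar>"
proof -
  have "norm (integral {a..t} g - integral {a..s} g) \<le> B * norm (t - s)"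
  proof (rule differentiable_bound)
    show "((\<lambda>u. integral {a..u} g) has_derivative (\<lambda>h. h *\<^sub>R g u)) (at u within {a..b})"
      if "u \<in> {a..b}" for u
      using integral_has_vector_derivative[OF assms(1) that]
      by (simp add: has_vector_derivative_def)
    show "onorm (\<lambda>h. h *\<^sub>R g u) \<le> B" if "u \<in> {a..b}" for u
      using assms(2)[OF that] by (intro onorm_le) (simp add: mult.commute[of "\<bar>_\<bar>"] mult_right_mono)
  qed (use assms in auto)
  then show ?thesis by simp
qed

text \<open>Banach's fixed-point theorem on the bounded continuous functions on the whole line.
  Clamping time to \<open>{-e..e}\<close> by \<open>\<kappa>\<close> makes the integral operator act
  on this space, and \<open>e * L \<le> 1 / 2\<close> makes it a contraction.\<close>

lemma picard_lindelof_global: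
  fixes \<Psi> :: "'a::euclidean_space \<Rightarrow> 'a"
  assumes "L \<ge> 0" "\<And>z z'. norm (\<Psi> z - \<Psi> z') \<le> L * norm (z - z')"
    and "M \<ge> 0" "\<And>z. norm (\<Psi> z) \<le> M" and "e > 0" "e * L \<le> 1 / 2"
  shows "\<exists>z. z 0 = z0 \<and> (\<forall>t\<in>{-e<..<e}. norm (z t - z0) \<le> M * e \<and> (z has_vector_derivative \<Psi> (z t)) (at t))"
proof -
  define \<kappa> where "\<kappa> t = max (-e) (min e t)" for t
  have \<kappa>: "\<kappa> t \<in> {-e..e}" for t using assms(5) by (auto simp: \<kappa>_def)
  have cont_\<kappa>: "continuous_on UNIV \<kappa>"
    unfolding \<kappa>_def by (intro continuous_intros)
  have cont_\<Psi>: "continuous_on UNIV \<Psi>"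
    by (rule lipschitz_on_continuous_on[of L]) (auto simp: lipschitz_on_def dist_norm assms)
  \<comment> \<open>Integration starts at the left endpoint; the initial value at the interior time
    0 is restored by subtracting \<open>A u 0\<close> in \<open>T\<close>.\<close>
  define A where "A u t = integral {-e..t} (\<lambda>s. \<Psi> (u s))" for u :: "real \<Rightarrow> 'a" and t
  have cont_u: "continuous_on S (\<lambda>s. \<Psi> (apply_bcontfun u s))" for S and u :: "real \<Rightarrow>\<^sub>C 'a"
    by (rule continuous_on_compose2[OF cont_\<Psi>]) auto
  have A_lip: "norm (A u t - A u s) \<le> M * \<bar>t - s\<bar>"
    if "s \<in> {-e..e}" "t \<in> {-e..e}" for s t and u :: "real \<Rightarrow>\<^sub>C 'a"
    unfolding A_def by (rule indefinite_integral_lipschitz[OF cont_u _ that]) (rule assms)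
  define T where "T u t = z0 + (A u (\<kappa> t) - A u 0)" for u t
  have T_bcont: "T (apply_bcontfun u) \<in> bcontfun" for u :: "real \<Rightarrow>\<^sub>C 'a"
  proof (rule bcontfun_normI)
    have "continuous_on {-e..e} (A u)"
      unfolding A_def by (intro indefinite_integral_continuous_1 integrable_continuous_real cont_u)
    then have "continuous_on UNIV (\<lambda>t. A u (\<kappa> t))"
      by (rule continuous_on_compose2[OF _ cont_\<kappa>]) (use \<kappa> in auto)
    then show "continuous_on UNIV (T u)"
      unfolding T_def by (intro continuous_intros)
    fix t
    have "norm (A u (\<kappa> t) - A u 0) \<le> M * \<bar>\<kappa> t - 0\<bar>"
      using assms(5) by (intro A_lip \<kappa>) auto
    also have "\<dots> \<le> M * e"
      using \<kappa>[of t] assms(3) by (intro mult_left_mono) auto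
    finally show "norm (T u t) \<le> norm z0 + M * e"
      unfolding T_def by (intro norm_triangle_le) simp
  qed
  define TT where "TT u = Bcontfun (T (apply_bcontfun u))" for u
  have TT: "apply_bcontfun (TT u) = T (apply_bcontfun u)" for u
    unfolding TT_def by (rule Bcontfun_inverse[OF T_bcont])
  have "dist (TT u) (TT v) \<le> 1 / 2 * dist u v" for u v
  proof (rule dist_bound)
    fix t
    let ?g = "\<lambda>s. \<Psi> (apply_bcontfun u s) - \<Psi> (apply_bcontfun v s)"
    have eq: "integral {-e..s} ?g = A u s - A v s" for s
      unfolding A_def by (rule integral_diff) (intro integrable_continuous_real cont_u)+
    have "norm (integral {-e..\<kappa> t} ?g - integral {-e..0} ?g) \<le> (L * dist u v) * \<bar>\<kappa> t - 0\<bar>"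
    proof (rule indefinite_integral_lipschitz)
      show "continuous_on {-e..e} ?g" by (intro continuous_intros cont_u)
      fix s
      have "norm (?g s) \<le> L * norm (apply_bcontfun u s - apply_bcontfun v s)"
        by (rule assms)
      also have "\<dots> \<le> L * dist u v"
        using dist_bounded[of u s v] assms(1) by (intro mult_left_mono) (auto simp: dist_norm)
      finally show "norm (?g s) \<le> L * dist u v" .
    qed (use \<kappa> assms(5) in auto)
    also have "\<dots> \<le> (L * dist u v) * e"
      using \<kappa>[of t] assms(1) by (intro mult_left_mono) auto
    also have "\<dots> = (e * L) * dist u v" by simp
    also have "\<dots> \<le> 1 / 2 * dist u v"
      by (intro mult_right_mono assms) auto
    finally show "dist (apply_bcontfun (TT u) t) (apply_bcontfun (TT v) t) \<le> 1 / 2 * dist u v"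
      unfolding TT T_def eq dist_norm by (simp add: algebra_simps)
  qed
  then have "\<exists>!u. TT u = u"
    by (intro banach_fix_type[of "1/2"]) auto
  then obtain u where u: "TT u = u" by blast
  have u_eq: "apply_bcontfun u t = z0 + (A u (\<kappa> t) - A u 0)" for t
    using fun_cong[OF TT[of u], of t] by (simp only: u T_def)
  show ?thesis
  proof (intro exI[of _ "apply_bcontfun u"] conjI ballI)
    show "apply_bcontfun u 0 = z0"
      using assms(5) by (simp add: u_eq \<kappa>_def)
    fix t assume t: "t \<in> {-e<..<e}"
    then have \<kappa>t: "\<kappa> t = t" by (auto simp: \<kappa>_def)
    have "norm (apply_bcontfun u t - z0) \<le> M * \<bar>t - 0\<bar>"
      using A_lip[of 0 t u] t assms(5) by (subst u_eq) (auto simp: \<kappa>t)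
    also have "\<dots> \<le> M * e"
      using t assms(3) by (intro mult_left_mono) auto
    finally show "norm (apply_bcontfun u t - z0) \<le> M * e" .
    have "(A u has_vector_derivative \<Psi> (apply_bcontfun u t)) (at t within {-e..e})"
      unfolding A_def using t by (intro integral_has_vector_derivative cont_u) auto
    then have "(A u has_vector_derivative \<Psi> (apply_bcontfun u t)) (at t)"
      using t by (simp add: at_within_Icc_at)
    then have "((\<lambda>t. z0 + (A u t - A u 0)) has_vector_derivative \<Psi> (apply_bcontfun u t)) (at t)"
      by (auto intro!: derivative_eq_intros)
    then show "(apply_bcontfun u has_vector_derivative \<Psi> (apply_bcontfun u t)) (at t)"
      by (rule has_vector_derivative_transform_within_open[of _ _ _ "{-e<..<e}"])
        (simp, rule t, subst u_eq, simp add: \<kappa>_def)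
  qed
qed

text \<open>Composition with the nearest-point projection onto the ball, a 1-Lipschitz map, makes
  the field globally Lipschitz and bounded. A solution of the modified equation stays in the ball
  for a short time, where the projection is the identity.\<close>

lemma picard_lindelof:
  fixes \<Phi> :: "'a::euclidean_space \<Rightarrow> 'a"
  assumes "r > 0" "L \<ge> 0" "\<And>z z'. z \<in> cball z0 r \<Longrightarrow> z' \<in> cball z0 r \<Longrightarrow> norm (\<Phi> z - \<Phi> z') \<le> L * norm (z - z')"
  shows "\<exists>e>0. \<exists>z. z 0 = z0 \<and> (\<forall>t\<in>{-e<..<e}. z t \<in> cball z0 r \<and> (z has_vector_derivative \<Phi> (z t)) (at t))"
proof -
  define c where "c = closest_point (cball z0 r)"
  have c_in: "c z \<in> cball z0 r" for z
    unfolding c_def using assms(1) by (intro closest_point_in_set) auto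
  have c_lip: "norm (c z - c z') \<le> norm (z - z')" for z z'
    unfolding c_def using closest_point_lipschitz[of "cball z0 r" z z'] assms(1)
    by (simp add: dist_norm)
  define M where "M = norm (\<Phi> z0) + L * r"
  have M: "M \<ge> 0" "norm (\<Phi> (c z)) \<le> M" for z
  proof -
    show "M \<ge> 0" using assms(1,2) by (simp add: M_def)
    have "norm (\<Phi> (c z) - \<Phi> z0) \<le> L * norm (c z - z0)"
      using assms(1) by (intro assms(3) c_in) auto
    also have "\<dots> \<le> L * r"
      using c_in[of z] assms(2) by (intro mult_left_mono) (auto simp: dist_norm norm_minus_commute)
    finally show "norm (\<Phi> (c z)) \<le> M"
      unfolding M_def using norm_triangle_sub[of "\<Phi> (c z)" "\<Phi> z0"] by linarith
  qed
  \<comment> \<open>The first entry yields \<open>e * L \<le> 1 / 2\<close>, the second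
    \<open>M * e \<le> r\<close>, which confines the solution to the ball; the summands 1 avoid
    division by zero.\<close>
  define e where "e = min (1 / (2 * (L + 1))) (r / (M + 1))"
  have e: "e > 0" using assms M by (simp add: e_def)
  have "e * L \<le> 1 / (2 * (L + 1)) * L"
    using assms(2) by (intro mult_right_mono) (auto simp: e_def)
  also have "\<dots> \<le> 1 / 2" using assms(2) by (simp add: field_simps)
  finally have eL: "e * L \<le> 1 / 2" .
  have "M * e \<le> M * (r / (M + 1))"
    using M(1) by (intro mult_left_mono) (auto simp: e_def)
  also have "\<dots> \<le> r" using M(1) assms(1) by (simp add: field_simps)
  finally have eM: "M * e \<le> r" .
  have "norm (\<Phi> (c z) - \<Phi> (c z')) \<le> L * norm (z - z')" for z z'
    using assms(3)[OF c_in c_in] mult_left_mono[OF c_lip assms(2)] by (rule order_trans)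
  from picard_lindelof_global[OF assms(2) this M e eL, of z0]
  obtain z where z: "z 0 = z0" "\<And>t. t \<in> {-e<..<e} \<Longrightarrow> norm (z t - z0) \<le> M * e"
    "\<And>t. t \<in> {-e<..<e} \<Longrightarrow> (z has_vector_derivative \<Phi> (c (z t))) (at t)"
    by blast
  have in_ball: "z t \<in> cball z0 r" if "t \<in> {-e<..<e}" for t
    using z(2)[OF that] eM by (simp add: dist_norm norm_minus_commute)
  then have "c (z t) = z t" if "t \<in> {-e<..<e}" for t
    using that unfolding c_def by (intro closest_point_self)
  with z e in_ball show ?thesis
    by (intro exI[of _ e] conjI exI[of _ z]) auto
qed

subsection \<open>Sprays, their Ricci curvature and their geodesics\<close>

context tangent_domain begin

definition dvg :: "('n \<Rightarrow> real ^ 'n \<Rightarrow> real ^ 'n \<Rightarrow> real) \<Rightarrow> real ^ 'n \<Rightarrow> real ^ 'n \<Rightarrow> real" where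
  "dvg G x y = (\<Sum>m\<in>UNIV. dd (Inr m) (G m) x y)"

text \<open>The trace of \<open>riemann_curvature\<close> with its two second-order terms collected:
  together they are minus the derivative of the vertical divergence \<open>dvg G\<close> along the
  spray.\<close>

definition spray_ricci :: "('n \<Rightarrow> real ^ 'n \<Rightarrow> real ^ 'n \<Rightarrow> real) \<Rightarrow> real ^ 'n \<Rightarrow> real ^ 'n \<Rightarrow> real" where
  "spray_ricci G x y = 2 * (\<Sum>m\<in>UNIV. dd (Inl m) (G m) x y) - along G (dvg G) x y
     - (\<Sum>m\<in>UNIV. \<Sum>k\<in>UNIV. dd (Inr k) (G m) x y * dd (Inr m) (G k) x y)"

lemma rat_dvg: "(\<And>k. G k \<in> rat U \<Omega> dens) \<Longrightarrow> dvg G \<in> rat U \<Omega> dens"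
  unfolding dvg_def by (intro rat_sum rat_dd)

lemma rat_spray_ricci: "(\<And>k. G k \<in> rat U \<Omega> dens) \<Longrightarrow> spray_ricci G \<in> rat U \<Omega> dens"
  unfolding spray_ricci_def by (intro rat_diff rat_sum rat_mult rat_const rat_dd rat_along rat_dvg)

lemma dd_dvg:
  "(\<And>k. G k \<in> rats) \<Longrightarrow> (x, y) \<in> \<Omega> \<Longrightarrow> dd s (dvg G) x y = (\<Sum>m\<in>UNIV. dd s (dd (Inr m) (G m)) x y)"
  unfolding dvg_def by (simp add: rats_dd_sum rat_dd)

lemma ricci_curvature_spray:
  assumes "\<And>k. G k \<in> rats" "\<And>x y k. (x, y) \<in> \<Omega> \<Longrightarrow> spray F x y $ k = G k x y" "(x, y) \<in> \<Omega>"
  shows "ricci_curvature F x y = spray_ricci G x y"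
proof -
  define S where "S k x y = spray F x y $ k" for k x y
  have S: "S k x y = G k x y" if "(x, y) \<in> \<Omega>" for k x y
    using assms(2)[OF that] by (simp add: S_def)
  have S1: "dd s (S k) x y = dd s (G k) x y" if "(x, y) \<in> \<Omega>" for s k x y
    by (rule dd_cong'[OF that S])
  have S2: "dd t (dd s (S k)) x y = dd t (dd s (G k)) x y" if "(x, y) \<in> \<Omega>" for s t k x y
    by (rule dd_cong'[OF that S1])
  have "riemann_curvature F x y m m = 2 * dd (Inl m) (S m) x y
      - (\<Sum>k\<in>UNIV. dd (Inl k) (dd (Inr m) (S m)) x y * y $ k)
      + 2 * (\<Sum>k\<in>UNIV. S k x y * dd (Inr k) (dd (Inr m) (S m)) x y)
      - (\<Sum>k\<in>UNIV. dd (Inr k) (S m) x y * dd (Inr m) (S k) x y)" for m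
    by (simp add: riemann_curvature_def dd_def[abs_def] S_def[abs_def])
  then have "ricci_curvature F x y = (\<Sum>m\<in>UNIV. 2 * dd (Inl m) (G m) x y
      - (\<Sum>k\<in>UNIV. dd (Inl k) (dd (Inr m) (G m)) x y * y $ k)
      + 2 * (\<Sum>k\<in>UNIV. G k x y * dd (Inr k) (dd (Inr m) (G m)) x y)
      - (\<Sum>k\<in>UNIV. dd (Inr k) (G m) x y * dd (Inr m) (G k) x y))"
    using assms(3) by (simp add: ricci_curvature_def S S1 S2)
  also have "\<dots> = 2 * (\<Sum>m\<in>UNIV. dd (Inl m) (G m) x y)
      - (\<Sum>m\<in>UNIV. \<Sum>k\<in>UNIV. y $ k * dd (Inl k) (dd (Inr m) (G m)) x y)
      + 2 * (\<Sum>m\<in>UNIV. \<Sum>k\<in>UNIV. G k x y * dd (Inr k) (dd (Inr m) (G m)) x y)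
      - (\<Sum>m\<in>UNIV. \<Sum>k\<in>UNIV. dd (Inr k) (G m) x y * dd (Inr m) (G k) x y)"
    by (simp add: sum.distrib sum_subtractf sum_distrib_left mult.commute)
  also have "(\<Sum>m\<in>UNIV. \<Sum>k\<in>UNIV. y $ k * dd (Inl k) (dd (Inr m) (G m)) x y)
      = (\<Sum>k\<in>UNIV. y $ k * dd (Inl k) (dvg G) x y)"
    using assms(1,3) by (subst sum.swap) (simp add: dd_dvg sum_distrib_left)
  also have "(\<Sum>m\<in>UNIV. \<Sum>k\<in>UNIV. G k x y * dd (Inr k) (dd (Inr m) (G m)) x y)
      = (\<Sum>k\<in>UNIV. G k x y * dd (Inr k) (dvg G) x y)"
    using assms(1,3) by (subst sum.swap) (simp add: dd_dvg sum_distrib_left)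
  finally show ?thesis
    by (simp add: spray_ricci_def along_def)
qed

text \<open>The classical change of Ricci curvature under a projective change of the spray. The
  Euler identities for \<open>G\<close> and \<open>p\<close> turn every contraction with
  \<open>y\<close> into a multiple of the function itself.\<close>

lemma spray_ricci_projective:
  assumes G: "\<And>k. G k \<in> rats" and p: "p \<in> rats"
    and G_hom: "\<And>k x y. (x, y) \<in> \<Omega> \<Longrightarrow> (\<Sum>j\<in>UNIV. y $ j * dd (Inr j) (G k) x y) = 2 * G k x y"
    and p_hom: "\<And>x y. (x, y) \<in> \<Omega> \<Longrightarrow> (\<Sum>j\<in>UNIV. y $ j * dd (Inr j) p x y) = p x y"
    and xy: "(x, y) \<in> \<Omega>"
  shows "spray_ricci (\<lambda>k x y. G k x y + p x y * y $ k) x y =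
    spray_ricci G x y + (real CARD('n) - 1) * ((p x y)\<^sup>2 - along G p x y)"
proof -
  let ?N = "real CARD('n)"
  let ?G' = "\<lambda>k x y. G k x y + p x y * y $ k"
  have py: "(\<lambda>x y. p x y * y $ k) \<in> rats" for k
    by (intro rat_mult p rat_var)
  have dl: "dd (Inl k) (?G' m) x y = dd (Inl k) (G m) x y + dd (Inl k) p x y * y $ m"
    if "(x, y) \<in> \<Omega>" for x y k m
    using that by (simp add: rats_dd_simps G p py rat_var)
  have dr: "dd (Inr k) (?G' m) x y = dd (Inr k) (G m) x y + dd (Inr k) p x y * y $ m + (if m = k then p x y else 0)"
    if "(x, y) \<in> \<Omega>" for x y k m
    using that by (simp add: rats_dd_simps G p py rat_var)
  have dvg': "dvg ?G' x y = dvg G x y + (?N + 1) * p x y" if "(x, y) \<in> \<Omega>" for x y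
    using p_hom[OF that] unfolding dvg_def dr[OF that] sum.distrib by (simp add: algebra_simps)
  have along': "along ?G' \<phi> x y = along G \<phi> x y - 2 * p x y * (\<Sum>j\<in>UNIV. y $ j * dd (Inr j) \<phi> x y)" for \<phi>
    by (rule along_homogeneous_shift)
  \<comment> \<open>Obtained by differentiating the Euler identity of each \<open>G m\<close> in
    direction \<open>m\<close>, commuting the derivatives, and summing.\<close>
  have dvg_hom: "(\<Sum>j\<in>UNIV. y $ j * dd (Inr j) (dvg G) x y) = dvg G x y"
  proof -
    have "(\<Sum>j\<in>UNIV. y $ j * dd (Inr j) (dd (Inr m) (G m)) x y) = dd (Inr m) (G m) x y" for m
    proof -
      have "dd (Inr m) (\<lambda>x y. \<Sum>j\<in>UNIV. y $ j * dd (Inr j) (G m) x y) x y = dd (Inr m) (\<lambda>x y. 2 * G m x y) x y"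
        using xy G_hom by (rule dd_cong')
      then have "(\<Sum>j\<in>UNIV. (if j = m then 1 else 0) * dd (Inr j) (G m) x y + y $ j * dd (Inr m) (dd (Inr j) (G m)) x y)
          = 2 * dd (Inr m) (G m) x y"
        using xy by (simp add: rats_dd_simps G rat_var rat_const rat_dd rat_mult)
      then show ?thesis
        by (simp add: sum.distrib if_distrib[of "\<lambda>a. a * _"] rat_dd_commute[OF G xy, of "Inr m"] cong: if_cong)
    qed
    then show ?thesis
      by (simp add: dd_dvg G xy sum_distrib_left dvg_def sum.swap[of "\<lambda>j m. y $ j * dd (Inr j) (dd (Inr m) (G m)) x y"])
  qed
  have along_dvg: "along ?G' (dvg ?G') x y =
      along G (dvg G) x y + (?N + 1) * along G p x y - 2 * p x y * (dvg G x y + (?N + 1) * p x y)"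
  proof -
    have "along ?G' (dvg ?G') x y = along ?G' (\<lambda>x y. dvg G x y + (?N + 1) * p x y) x y"
      by (rule along_cong[OF xy dvg'])
    also have "\<dots> = along ?G' (dvg G) x y + (?N + 1) * along ?G' p x y"
      using xy by (simp add: along_add along_cmult rat_dvg G p rat_mult rat_const)
    finally show ?thesis
      unfolding along' dvg_hom p_hom[OF xy] by (simp add: algebra_simps)
  qed
  let ?a = "\<lambda>m k. dd (Inr k) (G m) x y"
  let ?p = "\<lambda>k. dd (Inr k) p x y"
  have tr: "(\<Sum>m\<in>UNIV. \<Sum>k\<in>UNIV. dd (Inr k) (?G' m) x y * dd (Inr m) (?G' k) x y) =
      (\<Sum>m\<in>UNIV. \<Sum>k\<in>UNIV. ?a m k * ?a k m) + 4 * (\<Sum>m\<in>UNIV. G m x y * ?p m)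
      + 2 * p x y * dvg G x y + (?N + 3) * (p x y)\<^sup>2"
  proof -
    have "(\<Sum>m\<in>UNIV. \<Sum>k\<in>UNIV. dd (Inr k) (?G' m) x y * dd (Inr m) (?G' k) x y) =
      (\<Sum>m\<in>UNIV. \<Sum>k\<in>UNIV. ?a m k * ?a k m + ?p m * (y $ k * ?a m k) + ?p k * (y $ m * ?a k m)
        + (y $ m * ?p m) * (y $ k * ?p k)
        + (if m = k then 2 * p x y * ?a m m + 2 * p x y * (y $ m * ?p m) + (p x y)\<^sup>2 else 0))"
      unfolding dr[OF xy]
      by (intro sum.cong refl) (simp add: algebra_simps power2_eq_square)
    also have "\<dots> = (\<Sum>m\<in>UNIV. \<Sum>k\<in>UNIV. ?a m k * ?a k m)
        + (\<Sum>m\<in>UNIV. \<Sum>k\<in>UNIV. ?p m * (y $ k * ?a m k)) + (\<Sum>m\<in>UNIV. \<Sum>k\<in>UNIV. ?p k * (y $ m * ?a k m))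
        + (\<Sum>m\<in>UNIV. \<Sum>k\<in>UNIV. (y $ m * ?p m) * (y $ k * ?p k))
        + (\<Sum>m\<in>UNIV. 2 * p x y * ?a m m + 2 * p x y * (y $ m * ?p m) + (p x y)\<^sup>2)"
      by (simp add: sum.distrib)
    also have "(\<Sum>m\<in>UNIV. \<Sum>k\<in>UNIV. ?p k * (y $ m * ?a k m)) = (\<Sum>k\<in>UNIV. \<Sum>m\<in>UNIV. ?p k * (y $ m * ?a k m))"
      by (rule sum.swap)
    also have "(\<Sum>m\<in>UNIV. \<Sum>k\<in>UNIV. (y $ m * ?p m) * (y $ k * ?p k)) =
        (\<Sum>k\<in>UNIV. y $ k * ?p k) * (\<Sum>m\<in>UNIV. y $ m * ?p m)"
      by (simp only: sum_product)
    also have "(\<Sum>m\<in>UNIV. 2 * p x y * ?a m m + 2 * p x y * (y $ m * ?p m) + (p x y)\<^sup>2) =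
        2 * p x y * (\<Sum>m\<in>UNIV. ?a m m) + 2 * p x y * (\<Sum>m\<in>UNIV. y $ m * ?p m) + ?N * (p x y)\<^sup>2"
      by (simp add: sum.distrib sum_distrib_left)
    also have "(\<Sum>m\<in>UNIV. \<Sum>k\<in>UNIV. ?a m k * ?a k m)
        + (\<Sum>m\<in>UNIV. \<Sum>k\<in>UNIV. ?p m * (y $ k * ?a m k)) + (\<Sum>k\<in>UNIV. \<Sum>m\<in>UNIV. ?p k * (y $ m * ?a k m))
        + (\<Sum>k\<in>UNIV. y $ k * ?p k) * (\<Sum>m\<in>UNIV. y $ m * ?p m)
        + (2 * p x y * (\<Sum>m\<in>UNIV. ?a m m) + 2 * p x y * (\<Sum>m\<in>UNIV. y $ m * ?p m) + ?N * (p x y)\<^sup>2)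
      = (\<Sum>m\<in>UNIV. \<Sum>k\<in>UNIV. ?a m k * ?a k m)
        + (\<Sum>m\<in>UNIV. ?p m * (\<Sum>k\<in>UNIV. y $ k * ?a m k)) + (\<Sum>k\<in>UNIV. ?p k * (\<Sum>m\<in>UNIV. y $ m * ?a k m))
        + (\<Sum>k\<in>UNIV. y $ k * ?p k) * (\<Sum>m\<in>UNIV. y $ m * ?p m)
        + (2 * p x y * (\<Sum>m\<in>UNIV. ?a m m) + 2 * p x y * (\<Sum>m\<in>UNIV. y $ m * ?p m) + ?N * (p x y)\<^sup>2)"
      by (simp only: sum_distrib_left)
    finally show ?thesis
      unfolding G_hom[OF xy] p_hom[OF xy] dvg_def[symmetric]
      by (simp add: algebra_simps power2_eq_square sum_distrib_left dvg_def)
  qed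
  have s1: "(\<Sum>m\<in>UNIV. dd (Inl m) (?G' m) x y) =
      (\<Sum>m\<in>UNIV. dd (Inl m) (G m) x y) + (\<Sum>m\<in>UNIV. y $ m * dd (Inl m) p x y)"
    unfolding dl[OF xy] by (simp add: sum.distrib mult.commute)
  have s2: "(\<Sum>m\<in>UNIV. y $ m * dd (Inl m) p x y) = along G p x y + 2 * (\<Sum>m\<in>UNIV. G m x y * ?p m)"
    by (simp add: along_def)
  show ?thesis
    unfolding spray_ricci_def along_dvg tr s1 s2 by (simp add: algebra_simps power2_eq_square)
qed

text \<open>As \<open>H\<close> has no vertical divergence, \<open>dvg\<close> is unchanged;
  \<open>H\<close> enters only through the direction of differentiation and by polarising the
  quadratic trace.\<close>

lemma spray_ricci_add:
  assumes G: "\<And>k. G k \<in> rats" and H: "\<And>k. H k \<in> rats"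
    and dvg_H: "\<And>x y. (x, y) \<in> \<Omega> \<Longrightarrow> dvg H x y = 0" and xy: "(x, y) \<in> \<Omega>"
  shows "spray_ricci (\<lambda>k x y. G k x y + H k x y) x y = spray_ricci G x y
    + 2 * ((\<Sum>m\<in>UNIV. dd (Inl m) (H m) x y) + (\<Sum>k\<in>UNIV. H k x y * dd (Inr k) (dvg G) x y)
           - (\<Sum>m\<in>UNIV. \<Sum>k\<in>UNIV. dd (Inr k) (G m) x y * dd (Inr m) (H k) x y))
    - (\<Sum>m\<in>UNIV. \<Sum>k\<in>UNIV. dd (Inr k) (H m) x y * dd (Inr m) (H k) x y)"
proof -
  let ?G' = "\<lambda>k x y. G k x y + H k x y"
  have d: "dd s (?G' m) x y = dd s (G m) x y + dd s (H m) x y" if "(x, y) \<in> \<Omega>" for x y s m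
    using that by (simp add: rats_dd_add G H)
  have dvg': "dvg ?G' x y = dvg G x y" if "(x, y) \<in> \<Omega>" for x y
    using dvg_H[OF that] by (simp add: dvg_def d[OF that] sum.distrib)
  have "along ?G' (dvg ?G') x y = along ?G' (dvg G) x y"
    by (rule along_cong[OF xy dvg'])
  then have al: "along ?G' (dvg ?G') x y = along G (dvg G) x y - 2 * (\<Sum>k\<in>UNIV. H k x y * dd (Inr k) (dvg G) x y)"
    by (simp add: along_def algebra_simps sum.distrib)
  let ?a = "\<lambda>m k. dd (Inr k) (G m) x y"
  let ?b = "\<lambda>m k. dd (Inr k) (H m) x y"
  have "(\<Sum>m\<in>UNIV. \<Sum>k\<in>UNIV. (?a m k + ?b m k) * (?a k m + ?b k m)) =
      (\<Sum>m\<in>UNIV. \<Sum>k\<in>UNIV. ?a m k * ?a k m) + (\<Sum>m\<in>UNIV. \<Sum>k\<in>UNIV. ?a m k * ?b k m)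
      + (\<Sum>m\<in>UNIV. \<Sum>k\<in>UNIV. ?a k m * ?b m k) + (\<Sum>m\<in>UNIV. \<Sum>k\<in>UNIV. ?b m k * ?b k m)"
    by (simp add: algebra_simps sum.distrib)
  also have "(\<Sum>m\<in>UNIV. \<Sum>k\<in>UNIV. ?a k m * ?b m k) = (\<Sum>m\<in>UNIV. \<Sum>k\<in>UNIV. ?a m k * ?b k m)"
    by (rule sum.swap)
  finally show ?thesis
    unfolding spray_ricci_def al d[OF xy] by (simp add: sum.distrib algebra_simps)
qed

section \<open>Existence of geodesics and differentiation along them\<close>

lemma rat_continuous_on:
  assumes "\<phi> \<in> rats" "S \<subseteq> \<Omega>"
  shows "continuous_on S (\<lambda>p. \<phi> (fst p) (snd p))"
proof (rule continuous_at_imp_continuous_on, rule ballI)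
  fix p assume "p \<in> S"
  with assms rats_tdiff[of \<phi> "fst p" "snd p"] show "isCont (\<lambda>p. \<phi> (fst p) (snd p)) p"
    unfolding tdiff_def by (intro differentiable_imp_continuous_within) auto
qed

text \<open>The sum \<open>\<beta>\<close> of the absolute first partial derivatives dominates the
  operator norm and is bounded on the compact ball.\<close>

lemma rat_lipschitz_cball:
  assumes "\<phi> \<in> rats" "cball q r \<subseteq> \<Omega>"
  shows "\<exists>L\<ge>0. \<forall>z\<in>cball q r. \<forall>z'\<in>cball q r.
    \<bar>\<phi> (fst z) (snd z) - \<phi> (fst z') (snd z')\<bar> \<le> L * norm (z - z')"
proof -
  define \<beta> where "\<beta> x y = (\<Sum>k\<in>UNIV. \<bar>dd (Inl k) \<phi> x y\<bar>) + (\<Sum>k\<in>UNIV. \<bar>dd (Inr k) \<phi> x y\<bar>)" for x y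
  have "continuous_on (cball q r) (\<lambda>p. \<beta> (fst p) (snd p))"
    unfolding \<beta>_def by (intro continuous_intros rat_continuous_on rat_dd assms)
  then have "bounded ((\<lambda>p. \<beta> (fst p) (snd p)) ` cball q r)"
    by (intro compact_imp_bounded compact_continuous_image) auto
  then obtain B where B0: "B > 0" "\<forall>v\<in>(\<lambda>p. \<beta> (fst p) (snd p)) ` cball q r. norm v \<le> B"
    unfolding bounded_pos by blast
  have B: "\<beta> (fst p) (snd p) \<le> B" if "p \<in> cball q r" for p
    using bspec[OF B0(2) imageI[OF that]] by simp
  have "\<exists>D. ((\<lambda>p. \<phi> (fst p) (snd p)) has_derivative D) (at p) \<and> onorm D \<le> B" if p: "p \<in> cball q r" for p
  proof -
    have in_\<Omega>: "(fst p, snd p) \<in> \<Omega>" using p assms(2) by auto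
    then obtain D where D: "((\<lambda>p. \<phi> (fst p) (snd p)) has_derivative D) (at (fst p, snd p))"
      using rats_tdiff[OF assms(1)] unfolding tdiff_def differentiable_def by blast
    have "onorm D \<le> B"
    proof (rule onorm_le)
      fix h :: "(real ^ 'n) \<times> (real ^ 'n)"
      have bnd: "\<bar>\<Sum>k\<in>UNIV. c k * v $ k\<bar> \<le> (\<Sum>k\<in>UNIV. \<bar>c k\<bar>) * norm h"
        if "norm v \<le> norm h" for c :: "'n \<Rightarrow> real" and v :: "real ^ 'n"
      proof -
        have "\<bar>\<Sum>k\<in>UNIV. c k * v $ k\<bar> \<le> (\<Sum>k\<in>UNIV. \<bar>c k * v $ k\<bar>)" by (rule sum_abs)
        also have "\<dots> \<le> (\<Sum>k\<in>UNIV. \<bar>c k\<bar> * norm h)"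
          unfolding abs_mult
          by (intro sum_mono mult_left_mono order_trans[OF component_le_norm_cart that]) simp
        finally show ?thesis by (simp add: sum_distrib_right)
      qed
      have "D h = D (fst h, snd h)" by simp
      also have "\<dots> = (\<Sum>k\<in>UNIV. dd (Inl k) \<phi> (fst p) (snd p) * fst h $ k)
          + (\<Sum>k\<in>UNIV. dd (Inr k) \<phi> (fst p) (snd p) * snd h $ k)"
        by (rule tdiff_deriv[OF D])
      finally have "\<bar>D h\<bar> \<le> \<beta> (fst p) (snd p) * norm h"
        using bnd[of "fst h" "\<lambda>k. dd (Inl k) \<phi> (fst p) (snd p)"] norm_fst_le[of "fst h" "snd h"]
          bnd[of "snd h" "\<lambda>k. dd (Inr k) \<phi> (fst p) (snd p)"] norm_snd_le[of "snd h" "fst h"]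
        by (simp add: \<beta>_def algebra_simps)
      also have "\<dots> \<le> B * norm h"
        by (intro mult_right_mono B p) simp
      finally show "norm (D h) \<le> B * norm h" by simp
    qed
    with D show ?thesis by auto
  qed
  then obtain D where D: "\<And>p. p \<in> cball q r \<Longrightarrow> ((\<lambda>p. \<phi> (fst p) (snd p)) has_derivative D p) (at p)"
    "\<And>p. p \<in> cball q r \<Longrightarrow> onorm (D p) \<le> B"
    by metis
  have "\<bar>\<phi> (fst z) (snd z) - \<phi> (fst z') (snd z')\<bar> \<le> B * norm (z - z')"
    if "z \<in> cball q r" "z' \<in> cball q r" for z z'
    using differentiable_bound[OF convex_cball, of q r "\<lambda>p. \<phi> (fst p) (snd p)" D B, OF _ D(2) that]
      D(1) by (simp add: has_derivative_at_withinI)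
  with B0(1) show ?thesis by (intro exI[of _ B]) auto
qed

text \<open>Nothing is known about the chosen curve \<open>the_geodesic\<close> unless some geodesic
  exists. The equation is solved as a first-order system for position and velocity in a ball inside
  \<open>\<Omega>\<close>.\<close>

lemma geodesic_exists:
  assumes G: "\<And>k. G k \<in> rats" and F: "\<And>x y k. (x, y) \<in> \<Omega> \<Longrightarrow> spray F x y $ k = G k x y"
    and xy: "(x, y) \<in> \<Omega>"
  shows "\<exists>\<gamma>. geodesic_from F \<Omega> x y \<gamma>"
proof -
  obtain r where r: "r > 0" "cball (x, y) r \<subseteq> \<Omega>"
    using open_\<Omega> xy open_contains_cball by blast
  obtain L where L: "\<And>k. L k \<ge> 0" "\<And>k z z'. z \<in> cball (x, y) r \<Longrightarrow> z' \<in> cball (x, y) r \<Longrightarrow>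
      \<bar>G k (fst z) (snd z) - G k (fst z') (snd z')\<bar> \<le> L k * norm (z - z')"
    using rat_lipschitz_cball[OF G r(2)] by metis
  define \<Phi> where "\<Phi> z = (snd z, - 2 *\<^sub>R spray F (fst z) (snd z))" for z
  have lip: "norm (\<Phi> z - \<Phi> z') \<le> (1 + 2 * (\<Sum>k\<in>UNIV. L k)) * norm (z - z')"
    if z: "z \<in> cball (x, y) r" "z' \<in> cball (x, y) r" for z z'
  proof -
    have in_\<Omega>: "(fst z, snd z) \<in> \<Omega>" "(fst z', snd z') \<in> \<Omega>" using z r(2) by auto
    let ?d = "spray F (fst z) (snd z) - spray F (fst z') (snd z')"
    have "norm ?d \<le> (\<Sum>k\<in>UNIV. \<bar>?d $ k\<bar>)" by (rule norm_le_l1_cart)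
    also have "\<dots> \<le> (\<Sum>k\<in>UNIV. L k * norm (z - z'))"
      using L(2)[OF z] unfolding vector_minus_component F[OF in_\<Omega>(1)] F[OF in_\<Omega>(2)]
      by (intro sum_mono)
    finally have "norm ?d \<le> (\<Sum>k\<in>UNIV. L k) * norm (z - z')" by (simp add: sum_distrib_right)
    moreover have "norm (snd z - snd z') \<le> norm (z - z')"
      using norm_snd_le[of "snd z - snd z'" "fst z - fst z'"] by (simp add: minus_prod_def)
    moreover have "norm (\<Phi> z - \<Phi> z') \<le> norm (snd z - snd z') + 2 * norm ?d"
    proof -
      have "\<Phi> z - \<Phi> z' = (snd z - snd z', - 2 *\<^sub>R ?d)"
        by (simp add: \<Phi>_def algebra_simps)
      then show ?thesis
        using norm_Pair_le[of "snd z - snd z'" "- 2 *\<^sub>R ?d"] by simp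
    qed
    ultimately show ?thesis by (simp add: algebra_simps)
  qed
  have "1 + 2 * (\<Sum>k\<in>UNIV. L k) \<ge> 0"
    using L(1) by (simp add: sum_nonneg add_nonneg_nonneg)
  from picard_lindelof[OF r(1) this lip]
  obtain e z where e: "e > 0" and z0: "z 0 = (x, y)"
    and z: "\<And>t. t \<in> {-e<..<e} \<Longrightarrow> z t \<in> cball (x, y) r"
    and dz: "\<And>t. t \<in> {-e<..<e} \<Longrightarrow> (z has_vector_derivative \<Phi> (z t)) (at t)"
    by blast
  have d1: "((\<lambda>t. fst (z t)) has_vector_derivative snd (z t)) (at t)"
    and d2: "((\<lambda>t. snd (z t)) has_vector_derivative - 2 *\<^sub>R spray F (fst (z t)) (snd (z t))) (at t)"
    if "t \<in> {-e<..<e}" for t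
    using has_derivative_fst[OF dz[OF that, unfolded has_vector_derivative_def]]
      has_derivative_snd[OF dz[OF that, unfolded has_vector_derivative_def]]
    by (simp_all add: has_vector_derivative_def \<Phi>_def)
  have vel: "velocity (\<lambda>t. fst (z t)) t = snd (z t)" if "t \<in> {-e<..<e}" for t
    using d1[OF that] by (rule vector_derivative_at)
  have "geodesic_from F \<Omega> x y (\<lambda>t. fst (z t))"
    unfolding geodesic_from_def
  proof (intro conjI exI[of _ e] ballI)
    show "fst (z 0) = x" "velocity (\<lambda>t. fst (z t)) 0 = y" "e > 0"
      using e by (simp_all add: z0 vel)
    fix t assume t: "t \<in> {-e<..<e}"
    show "(\<lambda>t. fst (z t)) differentiable at t"
      using d1[OF t] by (auto simp: has_vector_derivative_def differentiable_def)
    show "(fst (z t), velocity (\<lambda>t. fst (z t)) t) \<in> \<Omega>"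
      using subsetD[OF r(2) z[OF t]] by (simp add: vel[OF t])
    show "(velocity (\<lambda>t. fst (z t)) has_vector_derivative
        - 2 *\<^sub>R spray F (fst (z t)) (velocity (\<lambda>t. fst (z t)) t)) (at t)"
      unfolding vel[OF t]
      by (rule has_vector_derivative_transform_within_open[OF d2[OF t], of "{-e<..<e}"])
        (use t vel in auto)
  qed
  then show ?thesis by blast
qed

text \<open>The geodesic equation makes the lifted curve tangent to the spray, so the derivative
  does not depend on which geodesic was chosen. Passing from \<open>\<tau>\<close> to
  \<open>\<psi>\<close> is legitimate because the lifted curve remains in \<open>\<Omega>\<close>
  near time 0.\<close>

lemma deriv_along_geodesic:
  assumes G: "\<And>k. G k \<in> rats" and F: "\<And>x y k. (x, y) \<in> \<Omega> \<Longrightarrow> spray F x y $ k = G k x y"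
    and xy: "(x, y) \<in> \<Omega>" and \<gamma>: "\<gamma> = the_geodesic F \<Omega> x y"
    and \<psi>: "tdiff \<psi> x y" "\<And>x y. (x, y) \<in> \<Omega> \<Longrightarrow> \<tau> x y = \<psi> x y"
  shows "deriv (\<lambda>t. \<tau> (\<gamma> t) (velocity \<gamma> t)) 0 = along G \<psi> x y"
proof -
  have "geodesic_from F \<Omega> x y \<gamma>"
    unfolding \<gamma> the_geodesic_def using geodesic_exists[OF G F xy] by (rule someI_ex)
  then obtain e where e: "e > 0" and \<gamma>0: "\<gamma> 0 = x" "velocity \<gamma> 0 = y"
    and diff: "\<And>t. t \<in> {-e<..<e} \<Longrightarrow> \<gamma> differentiable at t"
    and in_\<Omega>: "\<And>t. t \<in> {-e<..<e} \<Longrightarrow> (\<gamma> t, velocity \<gamma> t) \<in> \<Omega>"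
    and dv: "\<And>t. t \<in> {-e<..<e} \<Longrightarrow>
      (velocity \<gamma> has_vector_derivative - 2 *\<^sub>R spray F (\<gamma> t) (velocity \<gamma> t)) (at t)"
    unfolding geodesic_from_def by metis
  have 0: "0 \<in> {-e<..<e}" using e by simp
  have "(\<gamma> has_vector_derivative y) (at 0)"
    using diff[OF 0] \<gamma>0(2) by (metis vector_derivative_works)
  moreover have "(velocity \<gamma> has_vector_derivative - 2 *\<^sub>R spray F x y) (at 0)"
    using dv[OF 0] by (simp add: \<gamma>0)
  ultimately have "((\<lambda>t. \<psi> (\<gamma> t) (velocity \<gamma> t)) has_real_derivative
      (\<Sum>k\<in>UNIV. dd (Inl k) \<psi> x y * y $ k) + (\<Sum>k\<in>UNIV. dd (Inr k) \<psi> x y * (- 2 *\<^sub>R spray F x y) $ k)) (at 0)"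
    using tdiff_chain[of \<psi> \<gamma> 0 "velocity \<gamma>" y "- 2 *\<^sub>R spray F x y", unfolded \<gamma>0, OF \<psi>(1)] by blast
  moreover have "(\<Sum>k\<in>UNIV. dd (Inl k) \<psi> x y * y $ k) + (\<Sum>k\<in>UNIV. dd (Inr k) \<psi> x y * (- 2 *\<^sub>R spray F x y) $ k)
      = along G \<psi> x y"
    by (simp add: along_def F[OF xy] mult.commute sum_distrib_left sum_negf algebra_simps)
  ultimately have "((\<lambda>t. \<psi> (\<gamma> t) (velocity \<gamma> t)) has_real_derivative along G \<psi> x y) (at 0)"
    by simp
  then have "deriv (\<lambda>t. \<psi> (\<gamma> t) (velocity \<gamma> t)) 0 = along G \<psi> x y"
    by (rule DERIV_imp_deriv)
  moreover have "\<forall>\<^sub>F t in nhds 0. \<tau> (\<gamma> t) (velocity \<gamma> t) = \<psi> (\<gamma> t) (velocity \<gamma> t)"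
    by (rule eventually_mono[OF eventually_nhds_in_open[OF _ 0]]) (simp, rule \<psi>(2)[OF in_\<Omega>])
  ultimately show ?thesis
    by (subst deriv_cong_ev) auto
qed

lemma S_curvature_eq_along:
  assumes "\<And>k. G k \<in> rats" "\<And>x y k. (x, y) \<in> \<Omega> \<Longrightarrow> spray F x y $ k = G k x y" "(x, y) \<in> \<Omega>"
    "tdiff \<psi> x y" "\<And>x y. (x, y) \<in> \<Omega> \<Longrightarrow> distortion F vol x y = \<psi> x y"
  shows "S_curvature F \<Omega> vol x y = along G \<psi> x y"
  unfolding S_curvature_def Let_def by (rule deriv_along_geodesic[OF assms(1-3) refl assms(4,5)])

lemma S_dot_eq_along:
  assumes "\<And>k. G k \<in> rats" "\<And>x y k. (x, y) \<in> \<Omega> \<Longrightarrow> spray F x y $ k = G k x y" "(x, y) \<in> \<Omega>"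
    "\<psi> \<in> rats" "\<And>x y. (x, y) \<in> \<Omega> \<Longrightarrow> S_curvature F \<Omega> vol x y = \<psi> x y"
  shows "S_dot F \<Omega> vol x y = along G \<psi> x y"
  unfolding S_dot_def Let_def
  by (rule deriv_along_geodesic[OF assms(1-3) refl rats_tdiff[OF assms(4,3)] assms(5)])

end

subsection \<open>Rank-one perturbations and positive definite matrices\<close>

definition outer :: "real ^ 'n \<Rightarrow> real ^ 'n \<Rightarrow> real ^ 'n ^ 'n" where
  "outer u v = (\<chi> i j. u $ i * v $ j)"

lemma matrix_mult_outer: "A ** outer u v = outer (A *v u) v"
  by (simp add: outer_def matrix_matrix_mult_def matrix_vector_mult_def vec_eq_iff sum_distrib_right mult.assoc)

lemma outer_mult_matrix: "outer u v ** A = outer u (transpose A *v v)"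
  by (simp add: outer_def matrix_matrix_mult_def matrix_vector_mult_def transpose_def vec_eq_iff
      sum_distrib_left mult_ac)

lemma matrix_add_mult_distrib: "(A + B) ** C = A ** C + B ** (C :: real ^ 'k ^ 'n)"
  by (simp add: matrix_matrix_mult_def vec_eq_iff sum.distrib distrib_right)

text \<open>Conjugation by \<open>col u\<close>, the identity with column \<open>k\<close> replaced
  by \<open>u\<close>, moves \<open>u\<close> to a coordinate vector; the perturbation is then
  confined to a single row, and its determinant is one diagonal entry.\<close>

lemma det_mat1_add_outer:
  fixes u v :: "real ^ 'n::finite"
  shows "det (mat 1 + outer u v) = 1 + u \<bullet> v"
proof (cases "u = 0")
  case True
  then have "outer u v = 0" by (simp add: outer_def vec_eq_iff)
  with True show ?thesis by simp
next
  case False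
  then obtain k where k: "u $ k \<noteq> 0" by (auto simp: vec_eq_iff)
  define col where "col a = (\<chi> i j. if j = k then a $ i else (mat 1 :: real ^ 'n ^ 'n) $ i $ j)" for a :: "real ^ 'n"
  have det_col: "det (col a) = a $ k" for a
    unfolding col_def using cramer_lemma[of k "mat 1 :: real ^ 'n ^ 'n" a]
    unfolding matrix_vector_mul_lid by simp
  have col_axis: "col u *v axis k 1 = u"
    by (simp add: col_def matrix_vector_mult_def axis_def vec_eq_iff if_distrib cong: if_cong)
  define c where "c = transpose (col u) *v v"
  have ck: "c $ k = u \<bullet> v"
    by (simp add: c_def col_def matrix_vector_mult_def transpose_def inner_vec_def)
  have "(mat 1 + outer u v) ** col u = col u ** (mat 1 + outer (axis k 1) c)"
    by (simp add: matrix_add_mult_distrib matrix_add_ldistrib matrix_mult_outer outer_mult_matrix col_axis c_def)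
  then have "det (mat 1 + outer u v) * u $ k = u $ k * det (mat 1 + outer (axis k 1) c)"
    by (metis det_mul det_col)
  also have "det (mat 1 + outer (axis k 1) c) = det (transpose (mat 1 + outer (axis k 1) c))"
    by (simp add: det_transpose)
  also have "transpose (mat 1 + outer (axis k 1) c) = col (axis k 1 + c)"
    by (auto simp: col_def transpose_def outer_def mat_def axis_def vec_eq_iff)
  finally show ?thesis
    using k by (simp add: det_col ck axis_def)
qed

section \<open>Positive definite matrices\<close>

lemma quad_inner: "quad A y = y \<bullet> (A *v y)"
  by (simp add: quad_def inner_vec_def matrix_vector_mult_def sum_distrib_left mult_ac)

text \<open>Gram-Schmidt for the inner product defined by \<open>A\<close>: fewer than
  \<open>CARD('n)\<close> vectors do not span, and a vector outside their span is orthogonalised and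
  normalised.\<close>

lemma posdef_orthonormal_set:
  fixes A :: "real ^ 'n::finite ^ 'n"
  assumes sym: "transpose A = A" and pos: "\<And>y. y \<noteq> 0 \<Longrightarrow> quad A y > 0"
  shows "k \<le> CARD('n) \<Longrightarrow> \<exists>S. finite S \<and> card S = k \<and> (\<forall>u\<in>S. \<forall>v\<in>S. u \<bullet> (A *v v) = (if u = v then 1 else 0))"
proof (induction k)
  case 0
  show ?case by (intro exI[of _ "{}"]) simp
next
  case (Suc k)
  then obtain S where S: "finite S" "card S = k" "\<And>u v. u \<in> S \<Longrightarrow> v \<in> S \<Longrightarrow> u \<bullet> (A *v v) = (if u = v then 1 else 0)"
    by auto
  have symA: "u \<bullet> (A *v v) = v \<bullet> (A *v u)" for u v
    by (metis sym dot_lmul_matrix inner_commute transpose_matrix_vector)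
  have "span S \<noteq> UNIV"
  proof
    assume "span S = UNIV"
    then have "dim S = CARD('n)"
      by (metis dim_span dim_UNIV DIM_cart DIM_real mult.right_neutral)
    moreover have "dim S \<le> card S" using S(1) by (rule dim_le_card')
    ultimately show False using Suc.prems S(2) by simp
  qed
  then obtain x where x: "x \<notin> span S" by auto
  define x' where "x' = x - (\<Sum>s\<in>S. (s \<bullet> (A *v x)) *\<^sub>R s)"
  have "x' \<noteq> 0"
  proof
    assume "x' = 0"
    then have "x = (\<Sum>s\<in>S. (s \<bullet> (A *v x)) *\<^sub>R s)" by (simp add: x'_def)
    also have "\<dots> \<in> span S" by (intro span_sum span_mul span_base)
    finally show False using x by simp
  qed
  have orth: "s \<bullet> (A *v x') = 0" if "s \<in> S" for s
  proof -
    have "s \<bullet> (A *v x') = s \<bullet> (A *v x) - (\<Sum>s'\<in>S. (s' \<bullet> (A *v x)) * (s \<bullet> (A *v s')))"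
      by (simp add: x'_def linear_diff[OF matrix_vector_mul_linear] linear_sum[OF matrix_vector_mul_linear]
          linear_cmul[OF matrix_vector_mul_linear] inner_diff_right inner_sum_right)
    also have "(\<Sum>s'\<in>S. (s' \<bullet> (A *v x)) * (s \<bullet> (A *v s'))) = (\<Sum>s'\<in>S. if s' = s then s \<bullet> (A *v x) else 0)"
      using that by (intro sum.cong) (auto simp: S(3))
    finally show ?thesis using that S(1) by simp
  qed
  define q where "q = quad A x'"
  have q: "q > 0" using pos \<open>x' \<noteq> 0\<close> by (simp add: q_def)
  define e where "e = (1 / sqrt q) *\<^sub>R x'"
  have ee: "e \<bullet> (A *v e) = 1"
    using q by (simp add: e_def linear_cmul[OF matrix_vector_mul_linear] q_def[unfolded quad_inner, symmetric])
  have se: "s \<bullet> (A *v e) = 0" if "s \<in> S" for s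
    using orth[OF that] by (simp add: e_def linear_cmul[OF matrix_vector_mul_linear])
  have es: "e \<bullet> (A *v s) = 0" if "s \<in> S" for s
    using se[OF that] symA by simp
  have "e \<notin> S" using ee se by force
  with S ee es se show ?case
    by (intro exI[of _ "insert e S"]) auto
qed

lemma posdef_congruent_mat1:
  fixes A :: "real ^ 'n::finite ^ 'n"
  assumes "transpose A = A" and "\<And>y. y \<noteq> 0 \<Longrightarrow> quad A y > 0"
  obtains Q :: "real ^ 'n ^ 'n" where "transpose Q ** A ** Q = mat 1"
proof -
  obtain S where S: "finite S" "card S = CARD('n)" "\<And>u v. u \<in> S \<Longrightarrow> v \<in> S \<Longrightarrow> u \<bullet> (A *v v) = (if u = v then 1 else 0)"
    using posdef_orthonormal_set[OF assms, of "CARD('n)"] by auto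
  obtain b where b: "bij_betw b (UNIV :: 'n set) S"
    using finite_same_card_bij[of "UNIV :: 'n set" S] S by auto
  define Q :: "real ^ 'n ^ 'n" where "Q = (\<chi> i j. b j $ i)"
  have "(transpose Q ** A ** Q) $ i $ j = b i \<bullet> (A *v b j)" for i j
    by (simp add: Q_def matrix_mul_assoc[symmetric])
       (simp add: matrix_matrix_mult_def transpose_def inner_vec_def matrix_vector_mult_def)
  also have "\<dots> i j = (mat 1 :: real ^ 'n ^ 'n) $ i $ j" for i j
    using b by (subst S(3)) (auto simp: bij_betw_def mat_def dest: injD)
  finally show thesis
    by (intro that[of Q]) (simp add: vec_eq_iff)
qed

lemma det_posdef_pos:
  fixes A :: "real ^ 'n::finite ^ 'n"
  assumes "transpose A = A" and "\<And>y. y \<noteq> 0 \<Longrightarrow> quad A y > 0"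
  shows "det A > 0"
proof -
  obtain Q :: "real ^ 'n ^ 'n" where Q: "transpose Q ** A ** Q = mat 1"
    by (rule posdef_congruent_mat1[OF assms])
  have "(det Q)\<^sup>2 * det A = 1"
    using arg_cong[OF Q, of det] by (simp add: det_mul det_transpose power2_eq_square mult_ac)
  then show ?thesis
    by (metis zero_less_mult_pos zero_less_one zero_less_power2 mult_zero_left power_zero_numeral zero_neq_one)
qed

text \<open>
  The change of variables formula of the library is restricted to wellordered index types; an
  isomorphic copy of the index type removes this restriction.
\<close>

typedef (overloaded) ('a::finite) enumerated = "{..<CARD('a)}"
  by (rule exI[of _ 0]) simp

instantiation enumerated :: (finite) linorder
begin
definition less_eq_enumerated where "i \<le> j \<longleftrightarrow> Rep_enumerated i \<le> Rep_enumerated j"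
definition less_enumerated where "i < j \<longleftrightarrow> Rep_enumerated i < Rep_enumerated j"
instance
  by standard (auto simp: less_eq_enumerated_def less_enumerated_def Rep_enumerated_inject)
end

instance enumerated :: (finite) wellorder
proof
  fix P :: "'a enumerated \<Rightarrow> bool" and a
  assume step: "\<And>x. (\<And>y. y < x \<Longrightarrow> P y) \<Longrightarrow> P x"
  show "P a"
    by (induction a rule: measure_induct_rule[of Rep_enumerated])
      (rule step, simp add: less_enumerated_def)
qed

lemma card_enumerated: "card (UNIV :: 'a::finite enumerated set) = CARD('a)"
  by (simp add: type_definition.card[OF type_definition_enumerated])

instance enumerated :: (finite) finite
proof
  have "CARD('a enumerated) \<noteq> 0" by (simp add: card_enumerated)
  then show "finite (UNIV :: 'a enumerated set)" by (metis card.infinite)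
qed

text \<open>Both sides are multiplicative in \<open>A\<close>, so elementary matrices suffice; this
  avoids transporting permutations and their signs between two index types. A shear is a rank-one
  perturbation of the identity, hence has determinant 1.\<close>

lemma det_reindex:
  fixes A :: "real ^ 'n::finite ^ 'n" and b :: "'k::finite \<Rightarrow> 'n"
  assumes "bij b"
  shows "det (\<chi> i j. A $ b i $ b j) = det A"
proof (induction A rule: induct_matrix_elementary)
  case (1 A B)
  have "(\<chi> i j. (A ** B) $ b i $ b j) = (\<chi> i j. A $ b i $ b j) ** (\<chi> i j. B $ b i $ b j)"
    unfolding matrix_matrix_mult_def vec_eq_iff vec_lambda_beta
    by (intro allI sum.reindex_bij_betw[OF assms, symmetric])
  with 1 show ?case by (simp add: det_mul)
next
  case (2 A i)
  have "row (inv b i) (\<chi> i j. A $ b i $ b j) = 0"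
    using 2 assms by (simp add: row_def vec_eq_iff bij_is_surj surj_f_inv_f)
  with 2 show ?case by (simp add: det_zero_row)
next
  case (3 A)
  then have "det (\<chi> i j. A $ b i $ b j) = (\<Prod>i\<in>UNIV. A $ b i $ b i)"
    using assms by (subst det_diagonal) (auto simp: bij_def inj_eq)
  with 3 show ?case
    using prod.reindex_bij_betw[OF assms, of "\<lambda>i. A $ i $ i"] by (simp add: det_diagonal)
next
  case (4 m n)
  let ?m = "inv b m" and ?n = "inv b n"
  have inv: "b (inv b i) = i" for i
    using assms by (simp add: bij_is_surj surj_f_inv_f)
  have b_transpose: "Transposition.transpose m n (b j) = b (Transposition.transpose ?m ?n j)" for j
    using inv assms by (auto simp: Transposition.transpose_def bij_def inj_eq inv_f_f)
  have "(\<chi> i j. (\<chi> i j. mat 1 $ i $ Transposition.transpose m n j) $ b i $ b j) =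
      (\<chi> i j. (mat 1 :: real ^ 'k ^ 'k) $ i $ Transposition.transpose ?m ?n j)"
    unfolding vec_lambda_beta b_transpose using assms by (simp add: mat_def bij_def inj_eq)
  moreover have "?m \<noteq> ?n"
    using 4 inv by metis
  ultimately show ?case
    using 4 by (simp add: det_permute_columns permutes_swap_id sign_swap_id)
next
  case (5 m n c)
  have elem: "det (\<chi> i j. if i = m \<and> j = n then c else of_bool (i = j)) = 1"
    if "m \<noteq> n" for m n :: "'l::finite" and c :: real
  proof -
    have "(\<chi> i j. if i = m \<and> j = n then c else of_bool (i = j)) = mat 1 + outer (axis m c) (axis n 1)"
      using that by (auto simp: vec_eq_iff mat_def outer_def axis_def)
    with that show ?thesis
      by (simp add: det_mat1_add_outer inner_axis_axis)
  qed
  let ?m = "inv b m" and ?n = "inv b n"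
  have "(\<chi> i j. (\<chi> i j. if i = m \<and> j = n then c else of_bool (i = j)) $ b i $ b j) =
      (\<chi> i j. if i = ?m \<and> j = ?n then c else of_bool (i = j))"
    using assms by (auto simp: vec_eq_iff bij_def inj_eq inv_f_f surj_f_inv_f)
  moreover have "?m \<noteq> ?n"
    using 5 assms by (metis bij_is_surj surj_f_inv_f)
  ultimately show ?case
    using 5 by (simp add: elem)
qed

section \<open>Volumes of ellipsoids\<close>

lemma Basis_vec_real: "(Basis :: (real ^ 'n::finite) set) = range (\<lambda>i. axis i 1)"
  by (auto simp: Basis_vec_def)

lemma prod_Basis_vec:
  "(\<Prod>e\<in>Basis. f e) = (\<Prod>i\<in>UNIV. f (axis i (1::real) :: real ^ 'n::finite))"
  unfolding Basis_vec_real by (subst prod.reindex) (auto simp: inj_on_def axis_eq_axis)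

text \<open>Lebesgue measure is determined by its values on boxes, and renaming coordinates only
  permutes the side lengths.\<close>

lemma measure_reindex:
  fixes b :: "'k::finite \<Rightarrow> 'n::finite"
  assumes "bij b" "S \<in> sets borel"
  shows "measure lborel {y :: real ^ 'n. (\<chi> i. y $ b i) \<in> S} = measure lborel S"
proof -
  let ?\<Phi> = "\<lambda>y :: real ^ 'n. (\<chi> i. y $ b i)"
  have cont: "continuous_on UNIV ?\<Phi>"
    by (intro continuous_intros)
  then have meas: "?\<Phi> \<in> borel_measurable lborel"
    using borel_measurable_continuous_onI by auto
  have inv: "b (inv b i) = i" "inv b (b j) = j" for i j
    using assms(1) by (simp_all add: bij_is_surj surj_f_inv_f bij_is_inj)
  have "lborel = distr lborel borel ?\<Phi>"
  proof (rule lborel_eqI)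
    fix l u :: "real ^ 'k"
    assume le: "\<And>e. e \<in> Basis \<Longrightarrow> l \<bullet> e \<le> u \<bullet> e"
    have le': "l $ i \<le> u $ i" for i
      using le[of "axis i 1"] by (simp add: Basis_vec_real inner_axis)
    have "emeasure (distr lborel borel ?\<Phi>) (box l u) = emeasure lborel (?\<Phi> -` box l u)"
      using meas by (simp add: emeasure_distr)
    also have "?\<Phi> -` box l u = box (\<chi> i. l $ inv b i) (\<chi> i. u $ inv b i)"
      unfolding mem_box_cart set_eq_iff vimage_def using inv by (auto simp: mem_box_cart) metis+
    also have "emeasure lborel \<dots> = (\<Prod>e\<in>Basis. ((\<chi> i. u $ inv b i) - (\<chi> i. l $ inv b i) :: real ^ 'n) \<bullet> e)"
      using le' by (intro emeasure_lborel_box) (auto simp: Basis_vec_real inner_axis)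
    also have "\<dots> = (\<Prod>i\<in>UNIV. u $ inv b i - l $ inv b i)"
      by (simp add: prod_Basis_vec inner_axis)
    also have "(\<Prod>i\<in>UNIV. u $ inv b i - l $ inv b i) = (\<Prod>i\<in>UNIV. u $ i - l $ i)"
      by (rule prod.reindex_bij_betw[OF bij_imp_bij_inv[OF assms(1)], of "\<lambda>i. u $ i - l $ i"])
    also have "\<dots> = (\<Prod>e\<in>Basis. (u - l) \<bullet> e)"
      by (simp add: prod_Basis_vec inner_axis)
    finally show "emeasure (distr lborel borel ?\<Phi>) (box l u) = (\<Prod>e\<in>Basis. (u - l) \<bullet> e)" .
  qed simp
  then have "measure lborel S = measure (distr lborel borel ?\<Phi>) S"
    by simp
  also have "\<dots> = measure lborel (?\<Phi> -` S)"
    using meas assms(2) by (simp add: measure_distr)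
  finally show ?thesis by (simp add: vimage_def)
qed

text \<open>The ellipsoid is the unit ball moved by \<open>p\<close> after applying
  \<open>Q\<close>, where \<open>Q\<close> carries the standard inner product to that of
  \<open>A\<close>, so that \<open>\<bar>det Q\<bar>\<close> is the reciprocal of
  \<open>sqrt (det A)\<close>.\<close>

lemma measure_ellipsoid_wellorder:
  fixes A :: "real ^ 'n::{finite, wellorder} ^ 'n::_"
  assumes "transpose A = A" and "\<And>y. y \<noteq> 0 \<Longrightarrow> quad A y > 0"
  shows "measure lborel {y. quad A (y - p) < 1} = measure lborel (ball (0 :: (real, 'n) vec) 1) / sqrt (det A)"
proof -
  obtain Q :: "((real, 'n) vec, 'n) vec" where Q: "transpose Q ** A ** Q = mat 1"
    by (rule posdef_congruent_mat1[OF assms])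
  have "det Q * det A * det Q = 1"
    using arg_cong[OF Q, of det] by (simp add: det_mul det_transpose)
  then have dQ: "(det Q)\<^sup>2 * det A = 1" by (simp add: power2_eq_square mult_ac)
  have pos: "det A > 0" by (rule det_posdef_pos[OF assms])
  have "\<bar>det Q\<bar> * sqrt (det A) = 1"
    using arg_cong[OF dQ, of sqrt] by (simp add: real_sqrt_mult)
  then have absQ: "\<bar>det Q\<bar> = 1 / sqrt (det A)"
    using pos by (simp add: field_simps)
  have quadQ: "quad A (Q *v v) = v \<bullet> v" for v
  proof -
    have "quad A (Q *v v) = (A *v (Q *v v)) \<bullet> (Q *v v)"
      by (simp only: quad_inner inner_commute)
    also have "\<dots> = (transpose Q *v (A *v (Q *v v))) \<bullet> v"
      by (simp only: transpose_matrix_vector dot_lmul_matrix)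
    also have "transpose Q *v (A *v (Q *v v)) = (transpose Q ** A ** Q) *v v"
      by (simp only: matrix_vector_mul_assoc matrix_mul_assoc)
    finally have "quad A (Q *v v) = ((transpose Q ** A ** Q) *v v) \<bullet> v" .
    then show ?thesis by (simp add: Q)
  qed
  have "{y. quad A (y - p) < 1} = (+) p ` ((*v) Q ` ball 0 1)"
  proof (intro set_eqI iffI)
    fix y assume y: "y \<in> {y. quad A (y - p) < 1}"
    define v where "v = matrix_inv Q *v (y - p)"
    have "det Q \<noteq> 0" using dQ by auto
    then have "Q *v v = y - p"
      by (simp add: v_def matrix_vector_mul_assoc matrix_inv_right_left(1))
    moreover from this have "v \<bullet> v < 1" using y quadQ[of v] by simp
    ultimately show "y \<in> (+) p ` ((*v) Q ` ball 0 1)"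
      by (intro image_eqI[of _ _ "Q *v v"] imageI) (auto simp: norm_eq_sqrt_inner)
  next
    fix y assume "y \<in> (+) p ` ((*v) Q ` ball 0 1)"
    then obtain v where v: "y = p + Q *v v" "norm v < 1" by auto
    then have "v \<bullet> v < 1"
      using real_sqrt_lt_1_iff by (metis norm_eq_sqrt_inner)
    then show "y \<in> {y. quad A (y - p) < 1}"
      by (simp add: v(1) quadQ)
  qed
  moreover have "{y. quad A (y - p) < 1} \<in> sets borel"
    unfolding quad_def by measurable
  ultimately have "measure lborel {y. quad A (y - p) < 1} = measure lebesgue ((+) p ` ((*v) Q ` ball 0 1))"
    by (metis measure_completion sets_lborel)
  also have "\<dots> = measure lebesgue ((*v) Q ` ball 0 1)"
    by (rule measure_translation)
  also have "\<dots> = \<bar>det (matrix ((*v) Q))\<bar> * measure lebesgue (ball (0 :: (real, 'n) vec) 1)"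
    by (intro measure_linear_image matrix_vector_mul_linear lmeasurable_ball)
  finally show "measure lborel {y. quad A (y - p) < 1} = measure lborel (ball (0 :: (real, 'n) vec) 1) / sqrt (det A)"
    by (simp add: absQ)
qed

lemma measure_ellipsoid:
  fixes A :: "real ^ 'n::finite ^ 'n"
  assumes "transpose A = A" and "\<And>y. y \<noteq> 0 \<Longrightarrow> quad A y > 0"
  shows "measure lborel {y. quad A (y - p) < 1} = measure lborel (ball (0 :: real ^ 'n) 1) / sqrt (det A)"
proof -
  obtain b :: "'n enumerated \<Rightarrow> 'n" where b: "bij b"
    using finite_same_card_bij[of "UNIV :: 'n enumerated set" "UNIV :: 'n set"] card_enumerated by auto
  have inv: "b (inv b i) = i" for i
    using b by (simp add: bij_is_surj surj_f_inv_f)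
  define A' where "A' = (\<chi> i j. A $ b i $ b j)"
  let ?\<Phi> = "\<lambda>y :: real ^ 'n. (\<chi> i. y $ b i)"
  have quad': "quad A' (?\<Phi> y) = quad A y" for y
    unfolding quad_def A'_def vec_lambda_beta
    by (subst (1 2) sum.reindex_bij_betw[OF b, symmetric]) (rule refl)
  have "measure lborel {y. quad A (y - p) < 1} = measure lborel {y. ?\<Phi> y \<in> {z. quad A' (z - ?\<Phi> p) < 1}}"
  proof -
    have "?\<Phi> (y - p) = ?\<Phi> y - ?\<Phi> p" for y by (simp add: vec_eq_iff)
    then show ?thesis by (simp flip: quad')
  qed
  also have "\<dots> = measure lborel {z. quad A' (z - ?\<Phi> p) < 1}"
    by (rule measure_reindex[OF b]) (unfold quad_def, measurable)
  also have "\<dots> = measure lborel (ball (0 :: real ^ 'n enumerated) 1) / sqrt (det A')"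
  proof (rule measure_ellipsoid_wellorder)
    show "transpose A' = A'"
      using assms(1) by (simp add: A'_def vec_eq_iff transpose_def)
    fix z :: "real ^ 'n enumerated" assume z: "z \<noteq> 0"
    define y where "y = (\<chi> i. z $ inv b i)"
    have zy: "z = ?\<Phi> y" using b by (simp add: y_def vec_eq_iff bij_is_inj)
    with z have "y \<noteq> 0" by (auto simp: vec_eq_iff)
    then show "quad A' z > 0" unfolding zy quad' by (rule assms(2))
  qed
  also have "det A' = det A" unfolding A'_def by (rule det_reindex[OF b])
  also have "measure lborel (ball (0 :: real ^ 'n enumerated) 1) = measure lborel {y. ?\<Phi> y \<in> ball 0 1}"
    by (rule measure_reindex[OF b, symmetric]) simp
  also have "{y. ?\<Phi> y \<in> ball 0 1} = ball 0 1"
  proof -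
    have "norm (?\<Phi> y) = norm y" for y
      unfolding norm_vec_def L2_set_def vec_lambda_beta
      by (subst sum.reindex_bij_betw[OF b, symmetric]) (rule refl)
    then show ?thesis by (simp add: set_eq_iff)
  qed
  finally show ?thesis .
qed

subsection \<open>Kropina metrics from navigation data in a chart\<close>

lemma mult_kronecker: "a * (if Q then 1 else 0) = (if Q then a else (0::real))"
  by simp

locale navigation =
  fixes U :: "(real ^ 'n::finite) set" and h :: "real ^ 'n \<Rightarrow> real ^ 'n ^ 'n" and W :: "real ^ 'n \<Rightarrow> real ^ 'n"
  assumes open_U: "open U"
    and smooth_h: "\<And>i j. smooth_on U (\<lambda>x. h x $ i $ j)"
    and smooth_W: "\<And>i. smooth_on U (\<lambda>x. W x $ i)"
    and h_transpose: "\<And>x. x \<in> U \<Longrightarrow> transpose (h x) = h x"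
    and h_pos: "\<And>x y. x \<in> U \<Longrightarrow> y \<noteq> 0 \<Longrightarrow> quad (h x) y > 0"
    and W_unit: "\<And>x. x \<in> U \<Longrightarrow> quad (h x) (W x) = 1"
begin

text \<open>
  Notation: \<open>P = h\<^sup>2\<close>, \<open>Wl i = W\<^sub>i\<close>, \<open>w = W\<^sub>0\<close>, \<open>yl i = y\<^sub>i\<close>, \<open>N m k\<close> is the nonlinear connection
  \<open>\<Gamma>\<^bsup>m\<^esup>\<^sub>k\<^sub>j y\<^bsup>j\<^esup>\<close>, \<open>R0 = R\<^sub>0\<^sub>0\<close>, \<open>A0 m = S\<^bsup>m\<^esup>\<^sub>0\<close>, \<open>s0 = W\<^sub>m S\<^bsup>m\<^esup>\<^sub>0\<close>.
\<close>

abbreviation \<Gamma> :: "'n \<Rightarrow> 'n \<Rightarrow> 'n \<Rightarrow> real ^ 'n \<Rightarrow> real" where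
  "\<Gamma> m i j x \<equiv> christoffel h x m i j"

definition Wl :: "'n \<Rightarrow> real ^ 'n \<Rightarrow> real" where "Wl i x = (h x *v W x) $ i"
definition w :: "real ^ 'n \<Rightarrow> real ^ 'n \<Rightarrow> real" where "w x y = (\<Sum>i\<in>UNIV. Wl i x * y $ i)"
definition P :: "real ^ 'n \<Rightarrow> real ^ 'n \<Rightarrow> real" where "P x y = quad (h x) y"
definition yl :: "'n \<Rightarrow> real ^ 'n \<Rightarrow> real ^ 'n \<Rightarrow> real" where "yl i x y = (\<Sum>j\<in>UNIV. h x $ i $ j * y $ j)"
definition N :: "'n \<Rightarrow> 'n \<Rightarrow> real ^ 'n \<Rightarrow> real ^ 'n \<Rightarrow> real" where "N m k x y = (\<Sum>j\<in>UNIV. \<Gamma> m k j x * y $ j)"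
definition Gbar :: "'n \<Rightarrow> real ^ 'n \<Rightarrow> real ^ 'n \<Rightarrow> real" where
  "Gbar m x y = 1 / 2 * (\<Sum>k\<in>UNIV. N m k x y * y $ k)"
definition wc :: "'n \<Rightarrow> real ^ 'n \<Rightarrow> real ^ 'n \<Rightarrow> real" where "wc k x y = (\<Sum>i\<in>UNIV. cov_deriv h W x i k * y $ i)"
definition R0 :: "real ^ 'n \<Rightarrow> real ^ 'n \<Rightarrow> real" where "R0 x y = (\<Sum>k\<in>UNIV. wc k x y * y $ k)"
definition A0 :: "'n \<Rightarrow> real ^ 'n \<Rightarrow> real ^ 'n \<Rightarrow> real" where "A0 m x y = (\<Sum>k\<in>UNIV. S_endo h W x $ m $ k * y $ k)"
definition s0 :: "real ^ 'n \<Rightarrow> real ^ 'n \<Rightarrow> real" where "s0 x y = (\<Sum>m\<in>UNIV. Wl m x * A0 m x y)"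
definition iw :: "real ^ 'n \<Rightarrow> real ^ 'n \<Rightarrow> real" where "iw x y = inverse (w x y)"

definition \<Omega> :: "((real ^ 'n) \<times> (real ^ 'n)) set" where "\<Omega> = {(x, y). x \<in> U \<and> w x y > 0}"

lemma h_sym: "x \<in> U \<Longrightarrow> h x $ i $ j = h x $ j $ i"
  using h_transpose[of x] by (simp add: transpose_def vec_eq_iff)

lemma det_h_pos: "x \<in> U \<Longrightarrow> det (h x) > 0"
  using h_transpose h_pos by (rule det_posdef_pos)

lemma Wl_eq: "Wl i x = (\<Sum>j\<in>UNIV. h x $ i $ j * W x $ j)"
  by (simp add: Wl_def matrix_vector_mult_def)

lemma smooth_Wl: "smooth_on U (Wl i)"
  unfolding Wl_eq[abs_def] by (intro smooth_on_sum smooth_on_mult smooth_h smooth_W open_U)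

lemma smooth_h_inv: "smooth_on U (\<lambda>x. matrix_inv (h x) $ i $ j)"
  by (rule smooth_on_matrix_inv[OF open_U smooth_h]) (use det_h_pos in force)

lemma smooth_\<Gamma>: "smooth_on U (\<Gamma> m i j)"
  unfolding christoffel_def
  by (intro smooth_on_sum smooth_on_mult smooth_on_const smooth_on_add smooth_on_diff smooth_on_pd
      smooth_h smooth_h_inv open_U)

lemma cov_deriv_Wl: "cov_deriv h W x i j = pd j (Wl i) x - (\<Sum>m\<in>UNIV. \<Gamma> m i j x * Wl m x)"
  by (simp add: cov_deriv_def Wl_def[abs_def])

lemma smooth_cov: "smooth_on U (\<lambda>x. cov_deriv h W x i j)"
  unfolding cov_deriv_Wl
  by (intro smooth_on_sum smooth_on_mult smooth_on_diff smooth_on_pd smooth_Wl smooth_\<Gamma> open_U)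

lemma smooth_A: "smooth_on U (\<lambda>x. S_endo h W x $ i $ j)"
  unfolding S_endo_def S_tensor_def matrix_matrix_mult_def vec_lambda_beta
  by (intro smooth_on_sum smooth_on_mult smooth_on_const smooth_on_diff smooth_cov smooth_h_inv open_U)

lemma smooth_diff: "x \<in> U \<Longrightarrow> smooth_on U f \<Longrightarrow> f differentiable at x"
  using open_U smooth_on_differentiable by blast

lemma open_\<Omega>: "open \<Omega>"
proof -
  have "continuous_on U (Wl i)" for i
    using smooth_Wl[of i] unfolding smooth_on_def by (metis Ck_on.simps(1))
  then have "continuous_on (U \<times> UNIV) (\<lambda>p. w (fst p) (snd p))"
    unfolding w_def by (intro continuous_intros continuous_on_compose2[of U "Wl _" _ fst]) auto
  from continuous_open_preimage[OF this _ open_greaterThan[of 0]]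
  have "open ((U \<times> UNIV) \<inter> (\<lambda>p. w (fst p) (snd p)) -` {0<..})"
    using open_U by (simp add: open_Times)
  also have "(U \<times> UNIV) \<inter> (\<lambda>p. w (fst p) (snd p)) -` {0<..} = \<Omega>"
    by (auto simp: \<Omega>_def)
  finally show ?thesis .
qed

sublocale tangent_domain U \<Omega>
  by unfold_locales (auto simp: open_U open_\<Omega>, simp add: \<Omega>_def)

lemma w_pos: "(x, y) \<in> \<Omega> \<Longrightarrow> w x y > 0"
  by (simp add: \<Omega>_def)

lemma w_neq_0: "(x, y) \<in> \<Omega> \<Longrightarrow> w x y \<noteq> 0"
  using w_pos by force

lemma P_pos: "(x, y) \<in> \<Omega> \<Longrightarrow> P x y > 0"
  unfolding P_def using w_pos[of x y] by (intro h_pos \<Omega>_base[of x y]) (auto simp: w_def)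

lemma w_iw: "(x, y) \<in> \<Omega> \<Longrightarrow> w x y * iw x y = 1"
  using w_neq_0 by (simp add: iw_def)

lemma rat_Wl: "(\<lambda>x y. Wl i x) \<in> rat U \<Omega> dens"
  and rat_W: "(\<lambda>x y. W x $ i) \<in> rat U \<Omega> dens"
  and rat_h: "(\<lambda>x y. h x $ i $ j) \<in> rat U \<Omega> dens"
  and rat_\<Gamma>: "(\<lambda>x y. \<Gamma> m i j x) \<in> rat U \<Omega> dens"
  and rat_cov: "(\<lambda>x y. cov_deriv h W x i j) \<in> rat U \<Omega> dens"
  and rat_A: "(\<lambda>x y. S_endo h W x $ i $ j) \<in> rat U \<Omega> dens"
  by (intro rat_coef smooth_Wl smooth_W smooth_h smooth_\<Gamma> smooth_cov smooth_A)+

lemma rat_w: "w \<in> rat U \<Omega> dens"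
  unfolding w_def[abs_def] by (intro rat_sum rat_mult rat_Wl rat_var)

lemma rat_yl: "yl i \<in> rat U \<Omega> dens"
  unfolding yl_def[abs_def] by (intro rat_sum rat_mult rat_h rat_var)

lemma rat_N: "N m k \<in> rat U \<Omega> dens"
  unfolding N_def[abs_def] by (intro rat_sum rat_mult rat_\<Gamma> rat_var)

lemma P_eq_sum: "P x y = (\<Sum>i\<in>UNIV. yl i x y * y $ i)"
  by (simp add: P_def quad_def yl_def sum_distrib_left sum_distrib_right mult_ac)

lemma rat_P: "P \<in> rat U \<Omega> dens"
  unfolding P_eq_sum[abs_def] by (intro rat_sum rat_mult rat_yl rat_var)

lemma rat_Gbar: "Gbar m \<in> rat U \<Omega> dens"
  unfolding Gbar_def[abs_def] by (intro rat_sum rat_mult rat_const rat_N rat_var)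

lemma rat_wc: "wc k \<in> rat U \<Omega> dens"
  unfolding wc_def[abs_def] by (intro rat_sum rat_mult rat_cov rat_var)

lemma rat_R0: "R0 \<in> rat U \<Omega> dens"
  unfolding R0_def[abs_def] by (intro rat_sum rat_mult rat_wc rat_var)

lemma rat_A0: "A0 m \<in> rat U \<Omega> dens"
  unfolding A0_def[abs_def] by (intro rat_sum rat_mult rat_A rat_var)

lemma rat_s0: "s0 \<in> rat U \<Omega> dens"
  unfolding s0_def[abs_def] by (intro rat_sum rat_mult rat_Wl rat_A0)

lemma rat_iw: "w \<in> dens \<Longrightarrow> iw \<in> rat U \<Omega> dens"
  unfolding iw_def[abs_def] by (intro rat_inverse rat_w w_neq_0)

lemma rats_iw: "iw \<in> rats"
  by (simp add: rat_iw)

lemmas rats_base = rat_Wl rat_W rat_h rat_\<Gamma> rat_cov rat_A rat_w rat_yl rat_N rat_P rat_Gbar rat_wc rat_R0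
  rat_A0 rat_s0 rats_iw rat_var rat_const rat_add rat_mult rat_diff rat_minus rat_sum rat_dd rat_divide_const

section \<open>Identities of the Levi-Civita connection\<close>

lemma pd_h_sym: "x \<in> U \<Longrightarrow> pd k (\<lambda>z. h z $ i $ j) x = pd k (\<lambda>z. h z $ j $ i) x"
  by (rule pd_cong[OF open_U]) (auto intro: h_sym)

lemma h_inv: "x \<in> U \<Longrightarrow> h x ** matrix_inv (h x) = mat 1" "x \<in> U \<Longrightarrow> matrix_inv (h x) ** h x = mat 1"
  using matrix_inv_right_left[of "h x"] det_h_pos[of x] by simp_all

lemma \<Gamma>_sym: "x \<in> U \<Longrightarrow> \<Gamma> m i j x = \<Gamma> m j i x"
  unfolding christoffel_def using pd_h_sym[of x _ i j] by (simp add: algebra_simps)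

lemma \<Gamma>_lower:
  assumes "x \<in> U"
  shows "(\<Sum>m\<in>UNIV. h x $ p $ m * \<Gamma> m i j x) =
    1 / 2 * (pd i (\<lambda>z. h z $ p $ j) x + pd j (\<lambda>z. h z $ p $ i) x - pd p (\<lambda>z. h z $ i $ j) x)"
proof -
  let ?t = "\<chi> k. 1 / 2 * (pd i (\<lambda>z. h z $ k $ j) x + pd j (\<lambda>z. h z $ k $ i) x - pd k (\<lambda>z. h z $ i $ j) x)"
  have "\<Gamma> m i j x = (matrix_inv (h x) *v ?t) $ m" for m
    by (simp add: christoffel_def matrix_vector_mult_def sum_distrib_left mult_ac)
  then have "(\<Sum>m\<in>UNIV. h x $ p $ m * \<Gamma> m i j x) = (h x *v (matrix_inv (h x) *v ?t)) $ p"
    by (simp add: matrix_vector_mult_def)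
  also have "\<dots> = ?t $ p"
    using h_inv[OF assms] by (simp add: matrix_vector_mul_assoc)
  finally show ?thesis by simp
qed

text \<open>Metric compatibility: adding two lowered Christoffel symbols cancels all but one
  derivative of \<open>h\<close>.\<close>

lemma pd_h:
  assumes "x \<in> U"
  shows "pd k (\<lambda>z. h z $ i $ j) x = (\<Sum>m\<in>UNIV. \<Gamma> m k i x * h x $ m $ j) + (\<Sum>m\<in>UNIV. \<Gamma> m k j x * h x $ m $ i)"
proof -
  have "(\<Sum>m\<in>UNIV. \<Gamma> m k i x * h x $ m $ j) = (\<Sum>m\<in>UNIV. h x $ j $ m * \<Gamma> m k i x)"
    "(\<Sum>m\<in>UNIV. \<Gamma> m k j x * h x $ m $ i) = (\<Sum>m\<in>UNIV. h x $ i $ m * \<Gamma> m k j x)"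
    using h_sym[OF assms] by (simp_all add: mult.commute)
  then show ?thesis
    unfolding \<Gamma>_lower[OF assms]
    using pd_h_sym[OF assms, of k i j] pd_h_sym[OF assms, of i j k] pd_h_sym[OF assms, of j i k]
    by (simp add: field_simps)
qed

lemma sum_N_y: "(\<Sum>k\<in>UNIV. N m k x y * y $ k) = 2 * Gbar m x y"
  by (simp add: Gbar_def)

lemma h_A: "x \<in> U \<Longrightarrow> h x ** S_endo h W x = S_tensor h W x"
  using h_inv[of x] by (simp add: S_endo_def matrix_mul_assoc)

lemma h_A0:
  assumes "x \<in> U"
  shows "(\<Sum>m\<in>UNIV. h x $ l $ m * A0 m x y) = (\<Sum>k\<in>UNIV. S_tensor h W x $ l $ k * y $ k)"
proof -
  have "S_tensor h W x $ l $ k = (\<Sum>m\<in>UNIV. h x $ l $ m * S_endo h W x $ m $ k)" for k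
    by (simp add: h_A[OF assms, symmetric] matrix_matrix_mult_def)
  then show ?thesis
    by (simp add: A0_def sum_distrib_left sum_distrib_right mult_ac)
       (rule sum.swap)
qed

text \<open>Lowering the index gives S_lk y^k y^l, which vanishes by skew-symmetry.\<close>

lemma yl_A0:
  assumes "x \<in> U"
  shows "(\<Sum>m\<in>UNIV. yl m x y * A0 m x y) = 0"
proof -
  have "(\<Sum>m\<in>UNIV. yl m x y * A0 m x y) = (\<Sum>m\<in>UNIV. \<Sum>l\<in>UNIV. y $ l * (h x $ l $ m * A0 m x y))"
    using h_sym[OF assms] by (simp add: yl_def sum_distrib_left sum_distrib_right mult_ac)
  also have "\<dots> = (\<Sum>l\<in>UNIV. y $ l * (\<Sum>m\<in>UNIV. h x $ l $ m * A0 m x y))"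
    by (subst sum.swap) (simp add: sum_distrib_left)
  also have "\<dots> = (\<Sum>l\<in>UNIV. \<Sum>k\<in>UNIV. S_tensor h W x $ l $ k * (y $ k * y $ l))"
    unfolding h_A0[OF assms] by (simp add: sum_distrib_left mult_ac)
  finally have eq: "(\<Sum>m\<in>UNIV. yl m x y * A0 m x y) = \<dots>" .
  also have "\<dots> = (\<Sum>k\<in>UNIV. \<Sum>l\<in>UNIV. S_tensor h W x $ l $ k * (y $ k * y $ l))"
    by (rule sum.swap)
  also have "\<dots> = - (\<Sum>l\<in>UNIV. \<Sum>k\<in>UNIV. S_tensor h W x $ l $ k * (y $ k * y $ l))"
    unfolding sum_negf[symmetric] by (intro sum.cong refl) (simp add: S_tensor_def algebra_simps)
  finally show ?thesis using eq by simp
qed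

text \<open>The minus sign occurs because the free index of \<open>wc\<close> is the differentiation
  index, that is, the second index of \<open>cov_deriv\<close>.\<close>

lemma wc_split:
  "wc l x y = (\<Sum>k\<in>UNIV. R_tensor h W x $ l $ k * y $ k) - (\<Sum>k\<in>UNIV. S_tensor h W x $ l $ k * y $ k)"
  unfolding sum_subtractf[symmetric] wc_def
  by (intro sum.cong refl) (simp add: R_tensor_def S_tensor_def field_simps)

lemma R0_eq_quad: "R0 x y = quad (R_tensor h W x) y"
proof -
  have "R0 x y = (\<Sum>k\<in>UNIV. \<Sum>i\<in>UNIV. cov_deriv h W x i k * (y $ i * y $ k))"
    by (simp add: R0_def wc_def sum_distrib_right sum_distrib_left mult_ac)
  moreover from this have "R0 x y = (\<Sum>k\<in>UNIV. \<Sum>i\<in>UNIV. cov_deriv h W x k i * (y $ i * y $ k))"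
    by (subst sum.swap) (simp add: mult_ac)
  ultimately have "R0 x y = (\<Sum>k\<in>UNIV. \<Sum>i\<in>UNIV. cov_deriv h W x i k * (y $ i * y $ k)) / 2
      + (\<Sum>k\<in>UNIV. \<Sum>i\<in>UNIV. cov_deriv h W x k i * (y $ i * y $ k)) / 2"
    by simp
  also have "\<dots> = quad (R_tensor h W x) y"
    unfolding quad_def sum_divide_distrib sum.distrib[symmetric]
    by (intro sum.cong refl) (simp add: R_tensor_def field_simps)
  finally show ?thesis .
qed

section \<open>First derivatives of the basic functions\<close>

lemma dr_yl: "(x, y) \<in> \<Omega> \<Longrightarrow> dd (Inr k) (yl i) x y = h x $ i $ k"
  unfolding yl_def[abs_def] by (simp add: rats_dd_simps rats_base mult_kronecker)

lemma dr_w: "(x, y) \<in> \<Omega> \<Longrightarrow> dd (Inr k) w x y = Wl k x"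
  unfolding w_def[abs_def] by (simp add: rats_dd_simps rats_base mult_kronecker)

lemma dr_N: "(x, y) \<in> \<Omega> \<Longrightarrow> dd (Inr k) (N m i) x y = \<Gamma> m i k x"
  unfolding N_def[abs_def] by (simp add: rats_dd_simps rats_base mult_kronecker)

lemma dr_wc: "(x, y) \<in> \<Omega> \<Longrightarrow> dd (Inr k) (wc i) x y = cov_deriv h W x k i"
  unfolding wc_def[abs_def] by (simp add: rats_dd_simps rats_base mult_kronecker)

lemma dr_A0: "(x, y) \<in> \<Omega> \<Longrightarrow> dd (Inr k) (A0 m) x y = S_endo h W x $ m $ k"
  unfolding A0_def[abs_def] by (simp add: rats_dd_simps rats_base mult_kronecker)

lemma dr_P:
  assumes "(x, y) \<in> \<Omega>"
  shows "dd (Inr k) P x y = 2 * yl k x y"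
proof -
  have "dd (Inr k) P x y = (\<Sum>i\<in>UNIV. h x $ i $ k * y $ i) + yl k x y"
    unfolding P_eq_sum[abs_def] using assms
    by (simp add: rats_dd_simps rats_base dr_yl mult_kronecker sum.distrib)
  also have "(\<Sum>i\<in>UNIV. h x $ i $ k * y $ i) = yl k x y"
    unfolding yl_def by (intro sum.cong refl arg_cong2[where f = "(*)"] h_sym \<Omega>_base[OF assms])
  finally show ?thesis by simp
qed

lemma dr_Gbar:
  assumes "(x, y) \<in> \<Omega>"
  shows "dd (Inr k) (Gbar m) x y = N m k x y"
proof -
  have "dd (Inr k) (Gbar m) x y = 1 / 2 * ((\<Sum>i\<in>UNIV. \<Gamma> m i k x * y $ i) + N m k x y)"
    unfolding Gbar_def[abs_def] using assms
    by (simp add: rats_dd_simps rats_base dr_N mult_kronecker sum.distrib)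
  also have "(\<Sum>i\<in>UNIV. \<Gamma> m i k x * y $ i) = N m k x y"
    unfolding N_def by (intro sum.cong refl arg_cong2[where f = "(*)"] \<Gamma>_sym \<Omega>_base[OF assms])
  finally show ?thesis by simp
qed

lemma dr_R0: "(x, y) \<in> \<Omega> \<Longrightarrow> dd (Inr l) R0 x y = 2 * (\<Sum>k\<in>UNIV. R_tensor h W x $ l $ k * y $ k)"
  unfolding R0_def[abs_def]
  by (simp add: rats_dd_simps rats_base dr_wc mult_kronecker sum.distrib)
     (simp add: wc_def R_tensor_def sum_distrib_left algebra_simps sum.distrib)

text \<open>A covariant part plus \<open>N\<close> contracted with the vertical derivative. The
  \<open>N\<close> terms are exactly those cancelled in \<open>along Gbar\<close>.\<close>

lemma dl_w:
  assumes "(x, y) \<in> \<Omega>"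
  shows "dd (Inl k) w x y = wc k x y + (\<Sum>m\<in>UNIV. N m k x y * Wl m x)"
proof -
  have "dd (Inl k) w x y = (\<Sum>i\<in>UNIV. pd k (Wl i) x * y $ i)"
    unfolding w_def[abs_def] using assms by (simp add: rats_dd_simps rats_base)
  also have "\<dots> = (\<Sum>i\<in>UNIV. cov_deriv h W x i k * y $ i) + (\<Sum>i\<in>UNIV. \<Sum>m\<in>UNIV. \<Gamma> m k i x * Wl m x * y $ i)"
    unfolding sum.distrib[symmetric] using \<Gamma>_sym[OF \<Omega>_base[OF assms], of _ _ k]
    by (intro sum.cong refl) (simp add: cov_deriv_Wl algebra_simps sum_distrib_left sum_distrib_right)
  also have "(\<Sum>i\<in>UNIV. \<Sum>m\<in>UNIV. \<Gamma> m k i x * Wl m x * y $ i) = (\<Sum>m\<in>UNIV. N m k x y * Wl m x)"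
    by (subst sum.swap) (simp add: N_def sum_distrib_left sum_distrib_right mult_ac)
  finally show ?thesis by (simp add: wc_def)
qed

text \<open>Unlike for \<open>w\<close>, no covariant term remains, since \<open>h\<close> is
  parallel.\<close>

lemma dl_P:
  assumes "(x, y) \<in> \<Omega>"
  shows "dd (Inl k) P x y = 2 * (\<Sum>m\<in>UNIV. N m k x y * yl m x y)"
proof -
  have "dd (Inl k) P x y = (\<Sum>i\<in>UNIV. \<Sum>j\<in>UNIV. pd k (\<lambda>z. h z $ i $ j) x * (y $ j * y $ i))"
    unfolding P_eq_sum[abs_def] yl_def[abs_def] using assms
    by (simp add: rats_dd_simps rats_base sum_distrib_left sum_distrib_right mult_ac)
  also have "\<dots> = (\<Sum>i\<in>UNIV. \<Sum>j\<in>UNIV. \<Sum>m\<in>UNIV. \<Gamma> m k i x * h x $ m $ j * (y $ j * y $ i))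
      + (\<Sum>i\<in>UNIV. \<Sum>j\<in>UNIV. \<Sum>m\<in>UNIV. \<Gamma> m k j x * h x $ m $ i * (y $ j * y $ i))"
    unfolding pd_h[OF \<Omega>_base[OF assms]] by (simp add: distrib_right sum.distrib sum_distrib_right)
  also have "(\<Sum>i\<in>UNIV. \<Sum>j\<in>UNIV. \<Sum>m\<in>UNIV. \<Gamma> m k j x * h x $ m $ i * (y $ j * y $ i)) =
      (\<Sum>i\<in>UNIV. \<Sum>j\<in>UNIV. \<Sum>m\<in>UNIV. \<Gamma> m k i x * h x $ m $ j * (y $ j * y $ i))"
    by (subst sum.swap) (simp add: mult_ac)
  also have "(\<Sum>i\<in>UNIV. \<Sum>j\<in>UNIV. \<Sum>m\<in>UNIV. \<Gamma> m k i x * h x $ m $ j * (y $ j * y $ i)) =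
      (\<Sum>i\<in>UNIV. \<Sum>m\<in>UNIV. \<Sum>j\<in>UNIV. \<Gamma> m k i x * h x $ m $ j * (y $ j * y $ i))"
    by (intro sum.cong refl sum.swap)
  also have "\<dots> = (\<Sum>m\<in>UNIV. \<Sum>i\<in>UNIV. \<Sum>j\<in>UNIV. \<Gamma> m k i x * h x $ m $ j * (y $ j * y $ i))"
    by (rule sum.swap)
  also have "\<dots> = (\<Sum>m\<in>UNIV. N m k x y * yl m x y)"
    by (simp add: N_def yl_def sum_product mult_ac)
  finally show ?thesis by simp
qed

lemma d_iw: "(x, y) \<in> \<Omega> \<Longrightarrow> dd s iw x y = - (dd s w x y * (iw x y * iw x y))"
  unfolding iw_def[abs_def] using w_neq_0 by (intro rats_dd_inverse rat_w) auto

end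

subsection \<open>The spray and the S-curvature of a Kropina metric\<close>

lemma det_scaleR:
  fixes A :: "real ^ 'n::finite ^ 'n"
  shows "det (c *\<^sub>R A) = c ^ CARD('n) * det A"
proof -
  have "c *\<^sub>R A = (\<chi> i. c *s A $ i)" by (simp add: vec_eq_iff)
  then show ?thesis by (simp add: det_rows_mul)
qed

lemma outer_mult_vec: "outer u v *v x = (v \<bullet> x) *\<^sub>R u"
  by (simp add: outer_def matrix_vector_mult_def vec_eq_iff inner_vec_def sum_distrib_left sum_distrib_right mult_ac)

lemma outer_add_left: "outer (u + u') v = outer u v + outer u' v"
  and outer_scaleR_left: "outer (c *\<^sub>R u) v = c *\<^sub>R outer u v"
  by (simp_all add: outer_def vec_eq_iff algebra_simps)

text \<open>The scalar identity behind the verification of the spray: \<open>hH\<close>,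
  \<open>yH\<close>, \<open>WH\<close> stand for the contractions of \<open>H\<close> with row l of
  \<open>h\<close>, with y and with W. It is isolated here so that denominators can be cleared
  without sums in sight.\<close>

lemma kropina_spray_contraction:
  fixes P w :: real
  assumes "w \<noteq> 0" "P \<noteq> 0" "iw = 1 / w" "q = - w * T / P" "R = T - P * iw * s"
    "hH = - (1 / 2 * P * iw * Sl) + 1 / 2 * T * Wl + q * yl"
    "yH = 1 / 2 * T * w + q * P" "WH = - (1 / 2 * P * iw * s) + 1 / 2 * T + q * w"
  shows "4 * (1 / 2 * P * iw * iw * hH + iw * iw * yl * yH - P * iw * iw * iw * (yl * WH + Wl * yH)
      + 3 / 4 * P * P * iw * iw * iw * iw * Wl * WH)
    = - 2 * P * iw * iw * iw * yl * R + 3 / 2 * P * P * iw * iw * iw * iw * Wl * R - P * P * iw * iw * iw * Sl"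
  unfolding assms(3-) using assms(1,2) by (simp add: field_simps)

text \<open>The distortion contains logarithms and therefore lies outside \<open>rat\<close>; only
  its first derivatives are rational.\<close>

lemma tdiff_ln:
  assumes "tdiff \<phi> x y" "\<phi> x y > 0"
  shows "tdiff (\<lambda>x y. ln (\<phi> x y)) x y" and "dd s (\<lambda>x y. ln (\<phi> x y)) x y = dd s \<phi> x y / \<phi> x y"
proof -
  obtain D where D: "((\<lambda>p. \<phi> (fst p) (snd p)) has_derivative D) (at (x, y))"
    using assms(1) unfolding tdiff_def differentiable_def by blast
  have "((\<lambda>p. ln (\<phi> (fst p) (snd p))) has_derivative (\<lambda>q. D q / \<phi> x y)) (at (x, y))"
    using has_derivative_ln[OF _ D] assms(2) by (simp add: divide_inverse)
  then show "tdiff (\<lambda>x y. ln (\<phi> x y)) x y"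
    unfolding tdiff_def differentiable_def by blast
  have ln: "pd k (\<lambda>z. ln (g z)) z = pd k g z / g z" if g: "g differentiable at z" "g z > 0" for g k and z :: "real ^ 'a"
  proof -
    obtain g' where g': "(g has_derivative g') (at z)"
      using g(1) unfolding differentiable_def by blast
    have "((\<lambda>z. ln (g z)) has_derivative (\<lambda>q. g' q / g z)) (at z)"
      using has_derivative_ln[OF _ g'] g(2) by (simp add: divide_inverse)
    from pd_eq_derivative[OF this] pd_eq_derivative[OF g'] show ?thesis by simp
  qed
  from assms(1) obtain "(\<lambda>z. \<phi> z y) differentiable at x" "\<phi> x differentiable at y"
    by (rule tdiffE)
  with assms(2) show "dd s (\<lambda>x y. ln (\<phi> x y)) x y = dd s \<phi> x y / \<phi> x y"
    by (simp add: dd_def ln split: sum.split)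
qed

context navigation begin

definition T :: "real ^ 'n \<Rightarrow> real ^ 'n \<Rightarrow> real" where "T x y = R0 x y + P x y * iw x y * s0 x y"
definition p :: "real ^ 'n \<Rightarrow> real ^ 'n \<Rightarrow> real" where "p x y = - (w x y * R0 x y * inverse (P x y))"
text \<open>The part of the spray whose only denominator is \<open>w\<close>. The pole along
  \<open>P\<close> is confined to the multiple \<open>p\<close> of \<open>y\<close>, where
  projective invariance keeps it under control.\<close>

definition Ghat :: "'n \<Rightarrow> real ^ 'n \<Rightarrow> real ^ 'n \<Rightarrow> real" where
  "Ghat k x y = Gbar k x y - 1 / 2 * P x y * iw x y * A0 k x y + 1 / 2 * T x y * W x $ k - s0 x y * y $ k"
definition G :: "'n \<Rightarrow> real ^ 'n \<Rightarrow> real ^ 'n \<Rightarrow> real" where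
  "G k x y = Ghat k x y + p x y * y $ k"
text \<open>The deviation from the spray of \<open>h\<close>. Since
  \<open>p - s0 = - w T / P\<close>, it equals -F S^k_0 + (T/2)(W^k - y^k/F) with F =
  P/(2w).\<close>

definition H :: "'n \<Rightarrow> real ^ 'n \<Rightarrow> real ^ 'n \<Rightarrow> real" where
  "H k x y = G k x y - Gbar k x y"
text \<open>The rational form of F^2, with F = P/(2w).\<close>

definition L :: "real ^ 'n \<Rightarrow> real ^ 'n \<Rightarrow> real" where
  "L x y = 1 / 4 * (P x y * P x y * iw x y * iw x y)"
definition g :: "'n \<Rightarrow> 'n \<Rightarrow> real ^ 'n \<Rightarrow> real ^ 'n \<Rightarrow> real" where
  "g i j x y = 1 / 2 * P x y * iw x y * iw x y * h x $ i $ j + iw x y * iw x y * yl i x y * yl j x y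
    - P x y * iw x y * iw x y * iw x y * (yl i x y * Wl j x + Wl i x * yl j x y)
    + 3 / 4 * P x y * P x y * iw x y * iw x y * iw x y * iw x y * Wl i x * Wl j x"

lemma rat_T: "w \<in> dens \<Longrightarrow> T \<in> rat U \<Omega> dens"
  unfolding T_def[abs_def] by (intro rat_add rat_mult rat_R0 rat_P rat_iw rat_s0)

lemma rat_Ghat: "w \<in> dens \<Longrightarrow> Ghat k \<in> rat U \<Omega> dens"
  unfolding Ghat_def[abs_def]
  by (intro rat_add rat_diff rat_mult rat_const rat_Gbar rat_P rat_iw rat_A0 rat_T rat_W rat_s0 rat_var)

lemma P_neq_0: "(x, y) \<in> \<Omega> \<Longrightarrow> P x y \<noteq> 0"
  using P_pos by force

lemma rats_p: "p \<in> rats"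
  unfolding p_def[abs_def]
  by (intro rat_minus rat_mult rat_w rat_R0 rat_inverse rat_P) (auto simp: P_neq_0)

lemma rats_Ghat: "Ghat k \<in> rats"
  by (rule rat_Ghat) simp

lemma rats_G: "G k \<in> rats"
  unfolding G_def[abs_def] by (intro rat_add rat_mult rats_Ghat rats_p rat_var)

lemma rats_L: "L \<in> rats"
  unfolding L_def[abs_def] by (intro rat_mult rat_const rat_P rats_iw)

lemma p_P: "(x, y) \<in> \<Omega> \<Longrightarrow> p x y * P x y = - (w x y * R0 x y)"
  using P_neq_0 by (simp add: p_def)

lemma dr_L:
  assumes "(x, y) \<in> \<Omega>"
  shows "dd (Inr i) L x y = P x y * iw x y * iw x y * yl i x y - 1 / 2 * P x y * P x y * iw x y * iw x y * iw x y * Wl i x"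
  unfolding L_def[abs_def] using assms
  by (simp add: rats_dd_simps rats_base dr_P d_iw dr_w) (simp add: algebra_simps)

lemma drr_L:
  assumes "(x, y) \<in> \<Omega>"
  shows "dd (Inr j) (dd (Inr i) L) x y = 2 * g i j x y"
proof -
  have "dd (Inr j) (dd (Inr i) L) x y = dd (Inr j) (\<lambda>x y. P x y * iw x y * iw x y * yl i x y
      - 1 / 2 * P x y * P x y * iw x y * iw x y * iw x y * Wl i x) x y"
    by (rule dd_cong'[OF assms dr_L])
  also have "\<dots> = 2 * g i j x y"
    using assms by (simp add: rats_dd_simps rats_base dr_P d_iw dr_w dr_yl) (simp add: g_def field_simps)
  finally show ?thesis .
qed

lemma dl_L:
  assumes "(x, y) \<in> \<Omega>"
  shows "dd (Inl k) L x y = (\<Sum>m\<in>UNIV. N m k x y * dd (Inr m) L x y)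
    - 1 / 2 * P x y * P x y * iw x y * iw x y * iw x y * wc k x y"
proof -
  have "dd (Inl k) L x y = 1 / 2 * P x y * iw x y * iw x y * dd (Inl k) P x y
      - 1 / 2 * P x y * P x y * iw x y * iw x y * iw x y * dd (Inl k) w x y"
    unfolding L_def[abs_def] using assms
    by (simp add: rats_dd_simps rats_base d_iw) (simp add: algebra_simps)
  also have "\<dots> = (\<Sum>m\<in>UNIV. N m k x y * (P x y * iw x y * iw x y * yl m x y))
      - (\<Sum>m\<in>UNIV. N m k x y * (1 / 2 * P x y * P x y * iw x y * iw x y * iw x y * Wl m x))
      - 1 / 2 * P x y * P x y * iw x y * iw x y * iw x y * wc k x y"
    unfolding dl_P[OF assms] dl_w[OF assms]
    by (simp add: distrib_left sum_distrib_left sum_divide_distrib add_divide_distrib mult_ac)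
  finally show ?thesis
    by (simp add: dr_L[OF assms] right_diff_distrib sum_subtractf)
qed

lemma contractions:
  assumes "x \<in> U"
  shows "(\<Sum>m\<in>UNIV. h x $ l $ m * W x $ m) = Wl l x"
    "(\<Sum>m\<in>UNIV. h x $ l $ m * y $ m) = yl l x y"
    "(\<Sum>m\<in>UNIV. yl m x y * W x $ m) = w x y"
    "(\<Sum>m\<in>UNIV. yl m x y * y $ m) = P x y"
    "(\<Sum>m\<in>UNIV. Wl m x * W x $ m) = 1"
    "(\<Sum>m\<in>UNIV. Wl m x * y $ m) = w x y"
proof -
  show "(\<Sum>m\<in>UNIV. yl m x y * W x $ m) = w x y"
  proof -
    have "(\<Sum>m\<in>UNIV. yl m x y * W x $ m) = (\<Sum>m\<in>UNIV. \<Sum>j\<in>UNIV. h x $ m $ j * y $ j * W x $ m)"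
      by (simp add: yl_def sum_distrib_right)
    also have "\<dots> = (\<Sum>j\<in>UNIV. \<Sum>m\<in>UNIV. h x $ m $ j * y $ j * W x $ m)"
      by (rule sum.swap)
    also have "\<dots> = (\<Sum>j\<in>UNIV. \<Sum>m\<in>UNIV. h x $ j $ m * W x $ m * y $ j)"
      by (intro sum.cong refl) (use h_sym[OF assms] in simp)
    finally show ?thesis by (simp add: w_def Wl_eq sum_distrib_right)
  qed
  show "(\<Sum>m\<in>UNIV. Wl m x * W x $ m) = 1"
    using W_unit[OF assms] unfolding quad_def Wl_eq
    by (simp add: sum_distrib_left sum_distrib_right mult_ac)
qed (simp_all add: Wl_eq yl_def P_eq_sum w_def)

lemma H_eq:
  "H k x y = - (1 / 2 * P x y * iw x y) * A0 k x y + 1 / 2 * T x y * W x $ k + (p x y - s0 x y) * y $ k"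
  by (simp add: H_def G_def Ghat_def algebra_simps)

lemma sum_H:
  "(\<Sum>m\<in>UNIV. c m * H m x y) = - (1 / 2 * P x y * iw x y) * (\<Sum>m\<in>UNIV. c m * A0 m x y)
    + 1 / 2 * T x y * (\<Sum>m\<in>UNIV. c m * W x $ m) + (p x y - s0 x y) * (\<Sum>m\<in>UNIV. c m * y $ m)"
  unfolding H_eq sum_distrib_left sum.distrib[symmetric]
  by (intro sum.cong refl) (simp add: algebra_simps)

lemma q_eq:
  assumes "(x, y) \<in> \<Omega>"
  shows "p x y - s0 x y = - w x y * T x y / P x y"
  using P_neq_0[OF assms] w_neq_0[OF assms] by (simp add: p_def T_def iw_def field_simps)

lemma yl_H:
  assumes "(x, y) \<in> \<Omega>"
  shows "(\<Sum>m\<in>UNIV. yl m x y * H m x y) = - 1 / 2 * T x y * w x y"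
  unfolding sum_H contractions[OF \<Omega>_base[OF assms]] yl_A0[OF \<Omega>_base[OF assms]] q_eq[OF assms]
  using P_neq_0[OF assms] by (simp add: field_simps)

lemma Wl_H:
  assumes "(x, y) \<in> \<Omega>"
  shows "(\<Sum>m\<in>UNIV. Wl m x * H m x y) =
    - (1 / 2 * P x y * iw x y) * s0 x y + 1 / 2 * T x y + (p x y - s0 x y) * w x y"
  unfolding sum_H contractions[OF \<Omega>_base[OF assms]] by (simp add: s0_def)

text \<open>The candidate \<open>G\<close> is verified rather than derived: it satisfies the linear
  system that defines the spray, and inverting the fundamental tensor then identifies it. The
  \<open>Gbar\<close> part matches the geodesics of \<open>h\<close>; the terms in R and S match
  \<open>H\<close>.\<close>

lemma euler_lagrange:
  assumes xy: "(x, y) \<in> \<Omega>"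
  shows "(\<Sum>k\<in>UNIV. dd (Inr l) (dd (Inl k) L) x y * y $ k) - dd (Inl l) L x y = 4 * (\<Sum>m\<in>UNIV. g l m x y * G m x y)"
proof -
  note x = \<Omega>_base[OF xy]
  let ?Q = "\<lambda>x y. 1 / 2 * P x y * P x y * iw x y * iw x y * iw x y * R0 x y"
  have g_sym: "g i j x y = g j i x y" for i j
    using h_sym[OF x, of i j] by (simp add: g_def algebra_simps)
  \<comment> \<open>The derivative of F^2 along y in position. Its defect \<open>?Q\<close> from the
    value for an \<open>h\<close>-geodesic involves W only through R_00.\<close>
  have K: "(\<Sum>k\<in>UNIV. dd (Inl k) L x y * y $ k) = 2 * (\<Sum>m\<in>UNIV. Gbar m x y * dd (Inr m) L x y) - ?Q x y"
    if "(x, y) \<in> \<Omega>" for x y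
  proof -
    have "(\<Sum>k\<in>UNIV. dd (Inl k) L x y * y $ k) = (\<Sum>k\<in>UNIV. \<Sum>m\<in>UNIV. N m k x y * y $ k * dd (Inr m) L x y) - ?Q x y"
    proof -
      have "(\<Sum>k\<in>UNIV. dd (Inl k) L x y * y $ k) = (\<Sum>k\<in>UNIV. (\<Sum>m\<in>UNIV. N m k x y * dd (Inr m) L x y) * y $ k)
          - 1 / 2 * P x y * P x y * iw x y * iw x y * iw x y * (\<Sum>k\<in>UNIV. wc k x y * y $ k)"
        unfolding dl_L[OF that] left_diff_distrib sum_subtractf sum_distrib_left by (simp only: mult.assoc)
      then show ?thesis by (simp add: R0_def sum_distrib_right sum_distrib_left mult_ac)
    qed
    also have "(\<Sum>k\<in>UNIV. \<Sum>m\<in>UNIV. N m k x y * y $ k * dd (Inr m) L x y)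
        = (\<Sum>m\<in>UNIV. (\<Sum>k\<in>UNIV. N m k x y * y $ k) * dd (Inr m) L x y)"
      by (subst sum.swap) (simp add: sum_distrib_right)
    also have "\<dots> = 2 * (\<Sum>m\<in>UNIV. Gbar m x y * dd (Inr m) L x y)"
      unfolding sum_N_y by (simp add: sum_distrib_left mult_ac)
    finally show ?thesis .
  qed
  \<comment> \<open>Differentiating \<open>K\<close> in direction \<open>l\<close> produces the
    wanted expression plus twice \<open>dd (Inl l) L\<close>; by \<open>dl_L\<close> the
    \<open>N\<close> terms of the latter cancel those coming from \<open>Gbar\<close>.\<close>
  have "dd (Inr l) (\<lambda>x y. \<Sum>k\<in>UNIV. dd (Inl k) L x y * y $ k) x y =
      dd (Inr l) (\<lambda>x y. 2 * (\<Sum>m\<in>UNIV. Gbar m x y * dd (Inr m) L x y) - ?Q x y) x y"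
    by (rule dd_cong'[OF xy K])
  moreover have "dd (Inr l) (\<lambda>x y. \<Sum>k\<in>UNIV. dd (Inl k) L x y * y $ k) x y =
      (\<Sum>k\<in>UNIV. dd (Inr l) (dd (Inl k) L) x y * y $ k) + dd (Inl l) L x y"
    using xy by (simp add: rats_dd_simps rats_base rats_L mult_kronecker sum.distrib)
  moreover have "dd (Inr l) (\<lambda>x y. 2 * (\<Sum>m\<in>UNIV. Gbar m x y * dd (Inr m) L x y) - ?Q x y) x y =
      2 * (\<Sum>m\<in>UNIV. N m l x y * dd (Inr m) L x y) + 4 * (\<Sum>m\<in>UNIV. g l m x y * Gbar m x y) - dd (Inr l) ?Q x y"
    using xy by (simp add: rats_dd_simps rats_base rats_L dr_Gbar drr_L sum.distrib)
      (simp add: g_sym[of _ l] sum_distrib_left mult_ac)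
  ultimately have eq: "(\<Sum>k\<in>UNIV. dd (Inr l) (dd (Inl k) L) x y * y $ k) - dd (Inl l) L x y =
      4 * (\<Sum>m\<in>UNIV. g l m x y * Gbar m x y) - dd (Inr l) ?Q x y
      + P x y * P x y * iw x y * iw x y * iw x y * wc l x y"
    unfolding dl_L[OF xy, of l] by simp
  let ?R = "\<Sum>k\<in>UNIV. R_tensor h W x $ l $ k * y $ k"
  let ?S = "\<Sum>k\<in>UNIV. S_tensor h W x $ l $ k * y $ k"
  have dQ: "dd (Inr l) ?Q x y = 2 * P x y * iw x y * iw x y * iw x y * yl l x y * R0 x y
      - 3 / 2 * P x y * P x y * iw x y * iw x y * iw x y * iw x y * Wl l x * R0 x y
      + P x y * P x y * iw x y * iw x y * iw x y * ?R"
    using xy by (simp add: rats_dd_simps rats_base dr_P d_iw dr_w dr_R0) (simp add: algebra_simps)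
  have "4 * (\<Sum>m\<in>UNIV. g l m x y * H m x y) =
      4 * (1 / 2 * P x y * iw x y * iw x y * (\<Sum>m\<in>UNIV. h x $ l $ m * H m x y)
       + iw x y * iw x y * yl l x y * (\<Sum>m\<in>UNIV. yl m x y * H m x y)
       - P x y * iw x y * iw x y * iw x y * (yl l x y * (\<Sum>m\<in>UNIV. Wl m x * H m x y) + Wl l x * (\<Sum>m\<in>UNIV. yl m x y * H m x y))
       + 3 / 4 * P x y * P x y * iw x y * iw x y * iw x y * iw x y * Wl l x * (\<Sum>m\<in>UNIV. Wl m x * H m x y))"
    unfolding g_def
    by (simp add: algebra_simps sum.distrib sum_subtractf sum_distrib_left sum_divide_distrib)
  also have "\<dots> = - 2 * P x y * iw x y * iw x y * iw x y * yl l x y * R0 x y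
      + 3 / 2 * P x y * P x y * iw x y * iw x y * iw x y * iw x y * Wl l x * R0 x y
      - P x y * P x y * iw x y * iw x y * iw x y * ?S"
  proof (rule kropina_spray_contraction[OF w_neq_0[OF xy] P_neq_0[OF xy] _ q_eq[OF xy]])
    show "(\<Sum>m\<in>UNIV. h x $ l $ m * H m x y) =
        - (1 / 2 * P x y * iw x y * ?S) + 1 / 2 * T x y * Wl l x + (p x y - s0 x y) * yl l x y"
      unfolding sum_H contractions[OF x] h_A0[OF x] by simp
    show "(\<Sum>m\<in>UNIV. yl m x y * H m x y) = 1 / 2 * T x y * w x y + (p x y - s0 x y) * P x y"
      unfolding sum_H contractions[OF x] yl_A0[OF x] by simp
    show "(\<Sum>m\<in>UNIV. Wl m x * H m x y) = - (1 / 2 * P x y * iw x y * s0 x y) + 1 / 2 * T x y + (p x y - s0 x y) * w x y"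
      unfolding Wl_H[OF xy] by simp
  qed (simp_all add: iw_def T_def divide_inverse)
  finally have gH: "4 * (\<Sum>m\<in>UNIV. g l m x y * H m x y) = - 2 * P x y * iw x y * iw x y * iw x y * yl l x y * R0 x y
      + 3 / 2 * P x y * P x y * iw x y * iw x y * iw x y * iw x y * Wl l x * R0 x y
      - P x y * P x y * iw x y * iw x y * iw x y * ?S" .
  have "4 * (\<Sum>m\<in>UNIV. g l m x y * G m x y) =
      4 * (\<Sum>m\<in>UNIV. g l m x y * Gbar m x y) + 4 * (\<Sum>m\<in>UNIV. g l m x y * H m x y)"
    by (simp add: H_def right_diff_distrib sum_subtractf)
  then show ?thesis
    unfolding eq dQ gH wc_split by (simp add: algebra_simps)
qed

section \<open>Determinant of the fundamental tensor\<close>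

definition gmat :: "real ^ 'n \<Rightarrow> real ^ 'n \<Rightarrow> real ^ 'n ^ 'n" where "gmat x y = (\<chi> i j. g i j x y)"

text \<open>Up to the scalar r = P/(2 w^2), the tensor is \<open>h\<close> times two rank-one
  perturbations of the identity. The scalar contributes r to the power n, the first perturbation 1,
  and the second one more factor r.\<close>

lemma det_gmat:
  assumes xy: "(x, y) \<in> \<Omega>"
  shows "det (gmat x y) = (1 / 2 * P x y * iw x y * iw x y) ^ (CARD('n) + 1) * det (h x)"
proof -
  note x = \<Omega>_base[OF xy]
  \<comment> \<open>\<open>u\<close> is chosen \<open>h\<close>-orthogonal to \<open>y\<close>, so
    its perturbation has determinant 1; \<open>v\<close> absorbs the remaining terms of the
    tensor.\<close>
  define u where "u = (2 / P x y) *\<^sub>R (y - (P x y * iw x y) *\<^sub>R W x)"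
  define v where "v = iw x y *\<^sub>R ((1 / 2 * P x y * iw x y) *\<^sub>R W x - y)"
  let ?y = "h x *v y" and ?W = "h x *v W x"
  have comp: "?y $ i = yl i x y" "?W $ i = Wl i x" for i
    by (simp_all add: yl_def Wl_eq matrix_vector_mult_def)
  have dots: "y \<bullet> ?y = P x y" "W x \<bullet> ?y = w x y" "y \<bullet> ?W = w x y" "W x \<bullet> ?W = 1"
    using contractions[OF x] by (simp_all add: inner_vec_def comp mult.commute)
  have uy: "u \<bullet> ?y = 0"
    using w_iw[OF xy] P_neq_0[OF xy] by (simp add: u_def inner_diff_left dots mult_ac)
  have vW: "v \<bullet> ?W = 1 / 2 * P x y * iw x y * iw x y - 1"
    using w_iw[OF xy] by (simp add: v_def inner_diff_left dots algebra_simps)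
  have vy: "?y \<bullet> v = - 1 / 2 * P x y * iw x y"
    using w_iw[OF xy] by (simp add: v_def inner_diff_left inner_commute[of ?y] dots algebra_simps)
  have hu: "(h x *v u) $ i = 2 / P x y * (yl i x y - P x y * iw x y * Wl i x)" for i
    by (simp add: u_def matrix_vector_mult_diff_distrib matrix_vector_mult_scaleR comp)
  have hv: "(h x *v v) $ i = iw x y * (1 / 2 * P x y * iw x y * Wl i x - yl i x y)" for i
    by (simp add: v_def matrix_vector_mult_diff_distrib matrix_vector_mult_scaleR comp)
  have "gmat x y = (1 / 2 * P x y * iw x y * iw x y) *\<^sub>R (h x ** (mat 1 + outer u ?y) ** (mat 1 + outer v ?W))"
  proof -
    have "h x ** (mat 1 + outer u ?y) ** (mat 1 + outer v ?W) =
        h x + outer (h x *v u) ?y + outer (h x *v v) ?W + (?y \<bullet> v) *\<^sub>R outer (h x *v u) ?W"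
      by (simp add: matrix_add_ldistrib matrix_add_mult_distrib matrix_mult_outer
          matrix_vector_mult_add_rdistrib outer_mult_vec outer_add_left outer_scaleR_left)
    then show ?thesis
      unfolding vy using P_neq_0[OF xy]
      by (simp add: vec_eq_iff gmat_def g_def outer_def comp hu hv) (simp add: field_simps)
  qed
  then have "det (gmat x y) = (1 / 2 * P x y * iw x y * iw x y) ^ CARD('n)
      * (det (h x) * det (mat 1 + outer u ?y) * det (mat 1 + outer v ?W))"
    by (simp add: det_scaleR det_mul)
  then show ?thesis
    by (simp add: det_mat1_add_outer uy vW)
qed

lemma det_gmat_pos: "(x, y) \<in> \<Omega> \<Longrightarrow> det (gmat x y) > 0"
  unfolding det_gmat using P_pos[of x y] w_pos[of x y] det_h_pos[OF \<Omega>_base[of x y]]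
  by (simp add: iw_def)

lemma along_Gbar_P: "(x, y) \<in> \<Omega> \<Longrightarrow> along Gbar P x y = 0"
  unfolding along_def
  by (simp add: dl_P dr_P sum_distrib_left mult_ac Gbar_def sum_distrib_right)
    (subst sum.swap, simp add: mult_ac)

text \<open>Along geodesics of \<open>h\<close> the rate of change of W_0 is R_00, so a Killing
  field yields a conserved quantity. The \<open>N\<close> terms cancel.\<close>

lemma along_Gbar_w:
  assumes "(x, y) \<in> \<Omega>"
  shows "along Gbar w x y = R0 x y"
proof -
  have "(\<Sum>k\<in>UNIV. y $ k * (\<Sum>m\<in>UNIV. N m k x y * Wl m x)) = (\<Sum>m\<in>UNIV. (\<Sum>k\<in>UNIV. N m k x y * y $ k) * Wl m x)"
    unfolding sum_distrib_left sum_distrib_right by (subst sum.swap) (simp add: mult_ac)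
  also have "\<dots> = 2 * (\<Sum>m\<in>UNIV. Gbar m x y * Wl m x)"
    unfolding sum_N_y by (simp add: sum_distrib_left mult_ac)
  finally have eq: "(\<Sum>k\<in>UNIV. y $ k * (\<Sum>m\<in>UNIV. N m k x y * Wl m x)) = \<dots>" .
  show ?thesis
    unfolding along_def dl_w[OF assms] dr_w[OF assms] distrib_left sum.distrib eq
    by (simp add: R0_def mult.commute)
qed

lemma along_G: "along G \<phi> x y = along Gbar \<phi> x y - 2 * (\<Sum>k\<in>UNIV. H k x y * dd (Inr k) \<phi> x y)"
  by (simp add: along_def H_def algebra_simps sum_subtractf sum_distrib_left)

lemma along_G_P: "(x, y) \<in> \<Omega> \<Longrightarrow> along G P x y = 2 * T x y * w x y"
  using yl_H[of x y] by (simp add: along_G along_Gbar_P dr_P mult.left_commute[of _ 2] mult.commute[of "H _ x y"]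
      flip: sum_distrib_left)

lemma along_G_w:
  assumes "(x, y) \<in> \<Omega>"
  shows "along G w x y = 2 * (w x y)\<^sup>2 * T x y / P x y"
proof -
  have "along G w x y = R0 x y - 2 * (\<Sum>k\<in>UNIV. Wl k x * H k x y)"
    using assms by (simp add: along_G along_Gbar_w dr_w mult.commute)
  then show ?thesis
    unfolding Wl_H[OF assms] q_eq[OF assms] using P_neq_0[OF assms] w_neq_0[OF assms]
    by (simp add: T_def iw_def field_simps power2_eq_square)
qed

end

locale kropina = navigation U h W
  for U :: "(real ^ 'n::finite) set" and h :: "real ^ 'n \<Rightarrow> real ^ 'n ^ 'n" and W :: "real ^ 'n \<Rightarrow> real ^ 'n" +
  fixes F :: "real ^ 'n \<Rightarrow> real ^ 'n \<Rightarrow> real"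
  assumes F_eq: "\<And>x y. (x, y) \<in> \<Omega> \<Longrightarrow> F x y = P x y / (2 * w x y)"
begin

lemma F_sq: "(x, y) \<in> \<Omega> \<Longrightarrow> (F x y)\<^sup>2 = L x y"
  by (simp add: F_eq L_def iw_def power2_eq_square field_simps)

lemma fundamental_tensor_eq:
  assumes "(x, y) \<in> \<Omega>"
  shows "fundamental_tensor F x y = gmat x y"
proof -
  have 1: "dd s (\<lambda>x y. (F x y)\<^sup>2) x y = dd s L x y" if "(x, y) \<in> \<Omega>" for s x y
    by (rule dd_cong'[OF that F_sq])
  have "dd s (dd t (\<lambda>x y. (F x y)\<^sup>2)) x y = dd s (dd t L) x y" for s t
    by (rule dd_cong'[OF assms 1])
  moreover have "fundamental_tensor F x y = (\<chi> i j. 1 / 2 * dd (Inr j) (dd (Inr i) (\<lambda>x y. (F x y)\<^sup>2)) x y)"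
    by (simp add: fundamental_tensor_def dd_def[abs_def])
  ultimately show ?thesis
    by (simp add: gmat_def drr_L[OF assms])
qed

lemma spray_eq:
  assumes xy: "(x, y) \<in> \<Omega>"
  shows "spray F x y $ k = G k x y"
proof -
  have 1: "dd s (\<lambda>x y. (F x y)\<^sup>2) x y = dd s L x y" if "(x, y) \<in> \<Omega>" for s x y
    by (rule dd_cong'[OF that F_sq])
  have 2: "dd s (dd t (\<lambda>x y. (F x y)\<^sup>2)) x y = dd s (dd t L) x y" for s t
    by (rule dd_cong'[OF xy 1])
  have "spray F x y $ k = 1 / 4 * (\<Sum>l\<in>UNIV. matrix_inv (gmat x y) $ k $ l *
      ((\<Sum>j\<in>UNIV. dd (Inr l) (dd (Inl j) (\<lambda>x y. (F x y)\<^sup>2)) x y * y $ j) - dd (Inl l) (\<lambda>x y. (F x y)\<^sup>2) x y))"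
    by (simp add: spray_def dd_def[abs_def] fundamental_tensor_eq[OF xy])
  also have "\<dots> = 1 / 4 * (\<Sum>l\<in>UNIV. matrix_inv (gmat x y) $ k $ l * (4 * (\<Sum>m\<in>UNIV. g l m x y * G m x y)))"
    unfolding 1[OF xy] 2 euler_lagrange[OF xy] ..
  also have "\<dots> = (matrix_inv (gmat x y) *v (gmat x y *v (\<chi> m. G m x y))) $ k"
    by (simp add: matrix_vector_mult_def gmat_def sum_distrib_left)
  also have "\<dots> = G k x y"
    using det_gmat_pos[OF xy] by (simp add: matrix_vector_mul_assoc matrix_inv_right_left)
  finally show ?thesis .
qed

text \<open>Zermelo navigation: as W has unit length, F < 1 means P - 2w + 1 < 1, so the indicatrix
  is the \<open>h\<close>-unit sphere centred at W. The condition w > 0 comes for free from P \<ge>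
  0.\<close>

lemma BH_density_eq:
  assumes "x \<in> U"
  shows "BH_density F \<Omega> x = sqrt (det (h x))"
proof -
  have q: "quad (h x) (y - W x) = P x y - 2 * w x y + 1" for y
  proof -
    have "quad (h x) (y - W x) = (\<Sum>i\<in>UNIV. \<Sum>j\<in>UNIV. h x $ i $ j * y $ i * y $ j)
      - (\<Sum>i\<in>UNIV. y $ i * (\<Sum>j\<in>UNIV. h x $ i $ j * W x $ j)) - (\<Sum>i\<in>UNIV. W x $ i * (\<Sum>j\<in>UNIV. h x $ i $ j * y $ j))
      + quad (h x) (W x)"
      unfolding quad_def
      by (simp add: algebra_simps sum.distrib sum_subtractf sum_distrib_left)
    also have "(\<Sum>i\<in>UNIV. W x $ i * (\<Sum>j\<in>UNIV. h x $ i $ j * y $ j)) = w x y"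
      using contractions(3)[OF assms, of y] by (simp add: yl_def mult.commute)
    also have "(\<Sum>i\<in>UNIV. y $ i * (\<Sum>j\<in>UNIV. h x $ i $ j * W x $ j)) = w x y"
      by (simp add: w_def Wl_eq mult.commute)
    finally show ?thesis by (simp add: P_def quad_def[symmetric] W_unit[OF assms])
  qed
  have P_nonneg: "P x y \<ge> 0" for y
    using h_pos[OF assms, of y] by (cases "y = 0") (auto simp: P_def quad_def)
  have "(x, y) \<in> \<Omega> \<and> F x y < 1 \<longleftrightarrow> quad (h x) (y - W x) < 1" for y
  proof
    assume A: "(x, y) \<in> \<Omega> \<and> F x y < 1"
    then show "quad (h x) (y - W x) < 1"
      using w_pos[of x y] by (auto simp: q F_eq divide_less_eq)
  next
    assume "quad (h x) (y - W x) < 1"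
    then have lt: "P x y < 2 * w x y" by (simp add: q)
    with P_nonneg[of y] have "w x y > 0" by linarith
    with lt assms show "(x, y) \<in> \<Omega> \<and> F x y < 1"
      by (simp add: \<Omega>_def F_eq)
  qed
  then have "measure lborel {y. (x, y) \<in> \<Omega> \<and> F x y < 1} = measure lborel (ball (0 :: real ^ 'n) 1) / sqrt (det (h x))"
    using measure_ellipsoid[OF h_transpose h_pos, OF assms assms] by simp
  moreover have "measure lborel (ball (0 :: real ^ 'n) 1) > 0"
    by (simp add: content_ball_pos)
  ultimately show ?thesis
    by (simp add: BH_density_def)
qed

end

section \<open>Distortion, S-curvature and weighted Ricci curvature\<close>

locale weighted_kropina = kropina U h W F
  for U :: "(real ^ 'n::finite) set" and h :: "real ^ 'n \<Rightarrow> real ^ 'n ^ 'n" and W :: "real ^ 'n \<Rightarrow> real ^ 'n"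
    and F :: "real ^ 'n \<Rightarrow> real ^ 'n \<Rightarrow> real" +
  fixes vol \<phi> :: "real ^ 'n \<Rightarrow> real"
  assumes smooth_\<phi>: "smooth_on U \<phi>"
    and vol_eq: "\<And>x. x \<in> U \<Longrightarrow> vol x = exp (- (real CARD('n) + 1) * \<phi> x) * BH_density F \<Omega> x"
begin

definition f0 :: "real ^ 'n \<Rightarrow> real ^ 'n \<Rightarrow> real" where "f0 x y = (\<Sum>i\<in>UNIV. pd i \<phi> x * y $ i)"

lemma rat_pd_\<phi>: "(\<lambda>x y. pd i \<phi> x) \<in> rat U \<Omega> dens"
  by (intro rat_coef smooth_on_pd smooth_\<phi>)

lemma rat_f0: "f0 \<in> rat U \<Omega> dens"
  unfolding f0_def[abs_def] by (intro rat_sum rat_mult rat_pd_\<phi> rat_var)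

text \<open>The square root of \<open>det (h x)\<close> cancels against the Busemann-Hausdorff
  density. What remains is a power with exponent n + 1, the source of the factor n + 1 in the
  S-curvature.\<close>

lemma distortion_eq:
  assumes xy: "(x, y) \<in> \<Omega>"
  shows "distortion F vol x y =
    (real CARD('n) + 1) * (1 / 2 * ln (P x y) + ln (iw x y) + \<phi> x + ln (1 / 2) / 2)"
proof -
  let ?n = "real CARD('n) + 1"
  let ?r = "1 / 2 * P x y * iw x y * iw x y"
  have pos: "P x y > 0" "iw x y > 0" "det (h x) > 0"
    using P_pos[OF xy] w_pos[OF xy] det_h_pos[OF \<Omega>_base[OF xy]] by (simp_all add: iw_def)
  then have r: "?r > 0" by simp
  have "distortion F vol x y = ln (sqrt (?r ^ (CARD('n) + 1) * det (h x)) / (exp (- ?n * \<phi> x) * sqrt (det (h x))))"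
    by (simp add: distortion_def fundamental_tensor_eq[OF xy] det_gmat[OF xy] vol_eq[OF \<Omega>_base[OF xy]]
        BH_density_eq[OF \<Omega>_base[OF xy]])
  also have "sqrt (?r ^ (CARD('n) + 1) * det (h x)) / (exp (- ?n * \<phi> x) * sqrt (det (h x)))
      = sqrt (?r ^ (CARD('n) + 1)) / exp (- ?n * \<phi> x)"
    unfolding real_sqrt_mult[of "?r ^ (CARD('n) + 1)"] using pos(3) by simp
  also have "ln \<dots> = ln (sqrt (?r ^ (CARD('n) + 1))) + ?n * \<phi> x"
    using r by (subst ln_div) (auto simp: algebra_simps)
  also have "ln (sqrt (?r ^ (CARD('n) + 1))) = ?n * (ln ?r / 2)"
  proof -
    have "ln (sqrt (t ^ k)) = real k * (ln t / 2)" if "t > 0" for t :: real and k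
      using that by (simp add: ln_sqrt ln_realpow)
    from this[OF r, of "CARD('n) + 1"] show ?thesis by simp
  qed
  also have "ln ?r = ln (1 / 2) + ln (P x y) + ln (iw x y) + ln (iw x y)"
    using pos by (simp add: ln_mult ln_div)
  finally show ?thesis by (simp add: field_simps)
qed

text \<open>Along the spray, half of ln P grows at rate Tw/P and ln w at rate 2wT/P; the difference
  -wT/P is \<open>p - s0\<close>.\<close>

lemma S_curvature_eq:
  assumes xy: "(x, y) \<in> \<Omega>"
  shows "S_curvature F \<Omega> vol x y = (real CARD('n) + 1) * (f0 x y + p x y - s0 x y)"
proof -
  let ?n = "real CARD('n) + 1"
  have iw_pos: "iw x y > 0" using w_pos[OF xy] by (simp add: iw_def)
  note lnP = tdiff_ln[OF rats_tdiff[OF rat_P xy] P_pos[OF xy]]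
  note lniw = tdiff_ln[OF rats_tdiff[OF rats_iw xy] iw_pos]
  have td\<phi>: "tdiff (\<lambda>x y. \<phi> x) x y"
    by (rule rats_tdiff[OF rat_coef[OF smooth_\<phi>] xy])
  have tdc: "tdiff (\<lambda>x y. c) x y" for c
    by (rule rats_tdiff[OF rat_const xy])
  let ?\<psi> = "\<lambda>x y. ?n * (1 / 2 * ln (P x y) + ln (iw x y) + \<phi> x + ln (1 / 2) / 2)"
  have td: "tdiff ?\<psi> x y"
    by (intro tdiff_mult tdiff_add tdc td\<phi> lnP lniw)
  \<comment> \<open>The two coefficients are made opaque so that simplification treats them as
    constants while the sums are rearranged.\<close>
  define \<alpha> where "\<alpha> = 1 / (2 * P x y)"
  define \<beta> where "\<beta> = iw x y"
  have dd\<psi>: "dd s ?\<psi> x y = ?n * (\<alpha> * dd s P x y - \<beta> * dd s w x y + dd s (\<lambda>x y. \<phi> x) x y)" for s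
  proof -
    have "dd s ?\<psi> x y = ?n * (1 / 2 * (dd s P x y / P x y) + dd s iw x y / iw x y + dd s (\<lambda>x y. \<phi> x) x y)"
      by (simp only: dd_mult dd_add tdc tdiff_mult tdiff_add td\<phi> lnP lniw dd_const
          mult_zero_left add_0_left add_0_right)
    then show ?thesis
      using iw_pos by (simp add: d_iw[OF xy] \<alpha>_def \<beta>_def mult.commute)
  qed
  have "S_curvature F \<Omega> vol x y = along G ?\<psi> x y"
    by (rule S_curvature_eq_along[OF rats_G spray_eq xy td distortion_eq])
  also have "\<dots> = ?n * (\<alpha> * along G P x y - \<beta> * along G w x y + along G (\<lambda>x y. \<phi> x) x y)"
    unfolding along_def dd\<psi>
    by (simp add: algebra_simps sum.distrib sum_subtractf sum_distrib_left)
  also have "along G (\<lambda>x y. \<phi> x) x y = f0 x y"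
    by (simp add: along_def f0_def mult.commute)
  finally show ?thesis
    unfolding along_G_P[OF xy] along_G_w[OF xy] diff_conv_add_uminus add.assoc q_eq[OF xy, unfolded diff_conv_add_uminus]
    using P_neq_0[OF xy] w_neq_0[OF xy] by (simp add: \<alpha>_def \<beta>_def iw_def field_simps power2_eq_square)
qed

lemma rats_S: "(\<lambda>x y. (real CARD('n) + 1) * (f0 x y + p x y - s0 x y)) \<in> rats"
  by (intro rat_mult rat_const rat_diff rat_add rat_f0 rats_p rat_s0)

lemma weighted_ricci_eq:
  assumes xy: "(x, y) \<in> \<Omega>"
  shows "weighted_ricci F \<Omega> vol a c x y = spray_ricci G x y
    + a * (real CARD('n) + 1) * along G (\<lambda>x y. f0 x y + p x y - s0 x y) x y
    - c * (real CARD('n) + 1)\<^sup>2 * (f0 x y + p x y - s0 x y)\<^sup>2"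
proof -
  have "S_dot F \<Omega> vol x y = along G (\<lambda>x y. (real CARD('n) + 1) * (f0 x y + p x y - s0 x y)) x y"
    by (rule S_dot_eq_along[OF rats_G spray_eq xy rats_S S_curvature_eq])
  also have "\<dots> = (real CARD('n) + 1) * along G (\<lambda>x y. f0 x y + p x y - s0 x y) x y"
    by (rule along_cmult[OF _ xy]) (intro rat_diff rat_add rat_f0 rats_p rat_s0)
  finally show ?thesis
    by (simp add: weighted_ricci_def ricci_curvature_spray[OF rats_G spray_eq xy] S_curvature_eq[OF xy]
        power_mult_distrib)
qed

end

subsection \<open>The polar part of the weighted Ricci curvature\<close>

lemma symmetric_quad_zero:
  fixes M :: "real ^ 'n::finite ^ 'n"
  assumes "\<And>i j. M $ i $ j = M $ j $ i" "\<And>y. quad M y = 0"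
  shows "M $ i $ j = 0"
proof -
  have "quad M (axis i 1 + axis j 1) = quad M (axis i 1) + (\<Sum>k\<in>UNIV. \<Sum>l\<in>UNIV. M $ k $ l * (axis i 1 $ k * axis j 1 $ l + axis j 1 $ k * axis i 1 $ l)) + quad M (axis j 1)"
    by (simp add: quad_def algebra_simps sum.distrib)
  moreover have "(\<Sum>k\<in>UNIV. \<Sum>l\<in>UNIV. M $ k $ l * (axis i 1 $ k * axis j 1 $ l + axis j 1 $ k * axis i 1 $ l)) = M $ i $ j + M $ j $ i"
    by (simp add: distrib_left sum.distrib axis_def mult_kronecker if_distrib[of "\<lambda>a. _ * a"] cong: if_cong)
  ultimately show ?thesis
    using assms(1)[of i j] assms(2) by simp
qed

text \<open>Modulo \<open>1 + k * t\<^sup>2\<close> the squared polynomial reduces to \<delta> +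
  \<beta> t, whose square leaves a remainder of degree at most 1. Divisibility forces
  2\<delta>\<beta> = 0 and \<delta>^2 = \<beta>^2/k; as k > 0, both vanish.\<close>

lemma square_divisible_by_definite_quadratic:
  fixes q :: "real poly"
  assumes "k > 0" "\<And>t. (1 + k * t\<^sup>2) * poly q t = (\<alpha> + \<beta> * t + \<gamma> * t\<^sup>2)\<^sup>2"
  shows "\<beta> = 0" "k * \<alpha> = \<gamma>"
proof -
  define D where "D = [:1, 0, k:]"
  define \<delta> where "\<delta> = \<alpha> - \<gamma> / k"
  define r where "r = [:\<delta>\<^sup>2 - \<beta>\<^sup>2 / k, 2 * \<delta> * \<beta>:]"
  \<comment> \<open>The quotient, obtained from the quadratic written as (\<gamma>/k) D + \<delta> +
    \<beta> t by squaring and replacing t^2 by (D - 1)/k.\<close>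
  define s where "s = smult ((\<gamma> / k)\<^sup>2) D + smult (2 * \<gamma> / k) [:\<delta>, \<beta>:] + [:\<beta>\<^sup>2 / k:]"
  have "D * (q - s) = r"
  proof (rule poly_eq_poly_eq_iff[THEN iffD1], rule ext)
    fix t
    have "poly (D * (q - s)) t = (\<alpha> + \<beta> * t + \<gamma> * t\<^sup>2)\<^sup>2 - poly (D * s) t"
      using assms(2)[of t] by (simp add: D_def algebra_simps power2_eq_square)
    also have "\<dots> = poly r t"
      using assms(1) by (simp add: r_def s_def D_def \<delta>_def field_simps power2_eq_square)
    finally show "poly (D * (q - s)) t = poly r t" .
  qed
  then have "D dvd r" by (metis dvd_triv_left)
  moreover have "degree D = 2" using assms(1) by (simp add: D_def)
  moreover have "degree r \<le> 1" by (simp add: r_def)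
  ultimately have "r = 0"
    using dvd_imp_degree_le[of D r] by fastforce
  then have 1: "\<delta>\<^sup>2 = \<beta>\<^sup>2 / k" and 2: "\<delta> * \<beta> = 0" by (simp_all add: r_def)
  from 1 2 assms(1) have "\<delta> = 0 \<and> \<beta> = 0" by auto
  then show "\<beta> = 0" "k * \<alpha> = \<gamma>"
    using assms(1) by (simp_all add: \<delta>_def field_simps)
qed

context navigation begin

lemma w_W: "x \<in> U \<Longrightarrow> w x (W x) = 1"
  by (simp add: w_def contractions)

lemma w_line:
  assumes "x \<in> U" "w x u = 0"
  shows "w x (W x + t *\<^sub>R u) = 1"
proof -
  have "w x (W x + t *\<^sub>R u) = w x (W x) + t * w x u"
    by (simp add: w_def algebra_simps sum.distrib sum_distrib_left)
  with assms show ?thesis by (simp add: w_W)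
qed

text \<open>On the affine lines \<open>W + t u\<close> with \<open>u\<close> orthogonal to \<open>W\<close> the denominator \<open>w\<close> is constant.\<close>

lemma rat_polynomial_on_line:
  assumes "\<phi> \<in> rat U \<Omega> {w}" "x \<in> U" "w x u = 0"
  shows "\<exists>q. \<forall>t. \<phi> x (W x + t *\<^sub>R u) = poly q t"
  using assms(1)
proof induction
  case (rat_coef g)
  show ?case by (intro exI[of _ "[:g x:]"]) simp
next
  case (rat_var i)
  show ?case by (intro exI[of _ "[:W x $ i, u $ i:]"]) simp
next
  case (rat_add \<phi> \<psi>)
  then obtain q r where "\<forall>t. \<phi> x (W x + t *\<^sub>R u) = poly q t" "\<forall>t. \<psi> x (W x + t *\<^sub>R u) = poly r t"
    by blast
  then show ?case by (intro exI[of _ "q + r"]) simp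
next
  case (rat_mult \<phi> \<psi>)
  then obtain q r where "\<forall>t. \<phi> x (W x + t *\<^sub>R u) = poly q t" "\<forall>t. \<psi> x (W x + t *\<^sub>R u) = poly r t"
    by blast
  then show ?case by (intro exI[of _ "q * r"]) simp
next
  \<comment> \<open>Membership in \<open>{w}\<close> identifies the denominator with
    \<open>w\<close>, whose value on the line is 1; the constant polynomial 1 serves.\<close>
  case (rat_inverse \<phi>)
  then show ?case by (intro exI[of _ 1]) (simp add: w_line assms)
next
  case (rat_cong \<phi> \<psi>)
  have "(x, W x + t *\<^sub>R u) \<in> \<Omega>" for t
    using assms by (simp add: \<Omega>_def w_line)
  with rat_cong show ?case by simp
qed

lemma homogeneity:
  assumes "s > 0"
  shows "w x (s *\<^sub>R y) = s * w x y" "P x (s *\<^sub>R y) = s\<^sup>2 * P x y" "R0 x (s *\<^sub>R y) = s\<^sup>2 * R0 x y"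
    "Gbar k x (s *\<^sub>R y) = s\<^sup>2 * Gbar k x y" "A0 k x (s *\<^sub>R y) = s * A0 k x y" "s0 x (s *\<^sub>R y) = s * s0 x y"
    "iw x (s *\<^sub>R y) = iw x y / s"
  by (simp_all add: w_def P_def quad_def R0_def wc_def Gbar_def N_def A0_def s0_def iw_def
      sum_distrib_left sum_distrib_right power2_eq_square mult_ac)
    (simp_all add: divide_inverse mult_ac flip: sum_distrib_left)

lemma Ghat_homogeneous: "s > 0 \<Longrightarrow> Ghat k x (s *\<^sub>R y) = s\<^sup>2 * Ghat k x y"
  by (simp add: Ghat_def T_def homogeneity) (simp add: algebra_simps power2_eq_square)

lemma p_homogeneous: "s > 0 \<Longrightarrow> p x (s *\<^sub>R y) = s ^ 1 * p x y"
  by (simp add: p_def homogeneity)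

text \<open>W has constant length. Three relations suffice: the derivatives of W_i W^i = 1 and of
  W_i = h_ij W^j, and the comparison of \<open>dl_P\<close> with \<open>dl_w\<close> at
  \<open>y = W\<close>.\<close>

lemma cov_W:
  assumes x: "x \<in> U"
  shows "(\<Sum>i\<in>UNIV. W x $ i * cov_deriv h W x i k) = 0"
proof -
  have xW: "(x, W x) \<in> \<Omega>"
    using x by (simp add: \<Omega>_def w_W)
  let ?a = "\<Sum>i\<in>UNIV. pd k (Wl i) x * W x $ i"
  let ?b = "\<Sum>i\<in>UNIV. \<Sum>j\<in>UNIV. pd k (\<lambda>z. h z $ i $ j) x * W x $ j * W x $ i"
  let ?c = "\<Sum>i\<in>UNIV. Wl i x * pd k (\<lambda>z. W z $ i) x"
  have "pd k (\<lambda>z. \<Sum>i\<in>UNIV. Wl i z * W z $ i) x = pd k (\<lambda>z. 1) x"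
    by (rule pd_cong[OF open_U x]) (simp add: contractions)
  moreover have "dd (Inl k) (\<lambda>x y. \<Sum>i\<in>UNIV. Wl i x * W x $ i) x (W x) = ?a + ?c"
    using xW by (simp add: rats_dd_sum rats_dd_mult rats_base sum.distrib del: dd_coef) (simp add: sum.distrib)
  ultimately have ac: "?a + ?c = 0" by simp
  have "pd k (Wl i) x = (\<Sum>j\<in>UNIV. pd k (\<lambda>z. h z $ i $ j) x * W x $ j + h x $ i $ j * pd k (\<lambda>z. W z $ j) x)" for i
  proof -
    have "pd k (Wl i) x = dd (Inl k) (\<lambda>x y. \<Sum>j\<in>UNIV. h x $ i $ j * W x $ j) x (W x)"
      by (simp add: Wl_eq[abs_def])
    then show ?thesis
      using xW by (simp add: rats_dd_sum rats_dd_mult rats_base del: dd_coef) simp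
  qed
  then have "?a = ?b + (\<Sum>i\<in>UNIV. \<Sum>j\<in>UNIV. h x $ i $ j * pd k (\<lambda>z. W z $ j) x * W x $ i)"
    by (simp add: sum_distrib_right sum.distrib distrib_right)
  also have "(\<Sum>i\<in>UNIV. \<Sum>j\<in>UNIV. h x $ i $ j * pd k (\<lambda>z. W z $ j) x * W x $ i) =
      (\<Sum>j\<in>UNIV. \<Sum>i\<in>UNIV. h x $ i $ j * pd k (\<lambda>z. W z $ j) x * W x $ i)"
    by (rule sum.swap)
  also have "\<dots> = (\<Sum>j\<in>UNIV. \<Sum>i\<in>UNIV. h x $ j $ i * W x $ i * pd k (\<lambda>z. W z $ j) x)"
    by (intro sum.cong refl) (use h_sym[OF x] in simp)
  also have "\<dots> = ?c" by (simp add: Wl_eq sum_distrib_right)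
  finally have ab: "?a = ?b + ?c" .
  have "dd (Inl k) P x (W x) = ?b"
    unfolding P_eq_sum[abs_def] yl_def[abs_def] using xW
    by (simp add: rats_dd_simps rats_base sum_distrib_right)
  moreover have "dd (Inl k) w x (W x) = ?a"
    unfolding w_def[abs_def] using xW by (simp add: rats_dd_simps rats_base)
  moreover have "yl m x (W x) = Wl m x" for m
    by (simp add: yl_def Wl_eq)
  \<comment> \<open>At y = W the lowered direction is \<open>Wl\<close>, so the connection terms of
    \<open>dl_P\<close> and \<open>dl_w\<close> agree up to the factor 2.\<close>
  ultimately have b: "?b = 2 * (?a - wc k x (W x))"
    using dl_P[OF xW, of k] dl_w[OF xW, of k] by simp
  define \<alpha> \<beta> \<gamma> where "\<alpha> = ?a" and "\<beta> = ?b" and "\<gamma> = ?c"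
  have abc: "\<alpha> + \<gamma> = 0" "\<alpha> = \<beta> + \<gamma>" "\<beta> = 2 * (\<alpha> - wc k x (W x))"
    unfolding \<alpha>_def \<beta>_def \<gamma>_def by (rule ac, rule ab, rule b)
  have "\<beta> = \<alpha> - \<gamma>" using abc(2) by simp
  also have "\<gamma> = - \<alpha>" using abc(1) by simp
  finally have "wc k x (W x) = 0" using abc(3) by simp
  then show ?thesis by (simp add: wc_def mult.commute)
qed

lemma R_tensor_eq_0I:
  assumes x: "x \<in> U" and R: "\<And>u. w x u = 0 \<Longrightarrow>
    (\<Sum>i\<in>UNIV. \<Sum>j\<in>UNIV. R_tensor h W x $ i $ j * (W x $ i * u $ j + u $ i * W x $ j)) = 0 \<and> quad (R_tensor h W x) u = 0"
  shows "R_tensor h W x $ i $ j = 0"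
proof -
  let ?R = "R_tensor h W x"
  have expand: "quad ?R (a + b) = quad ?R a + (\<Sum>i\<in>UNIV. \<Sum>j\<in>UNIV. ?R $ i $ j * (a $ i * b $ j + b $ i * a $ j)) + quad ?R b" for a b
    by (simp add: quad_def algebra_simps sum.distrib)
  have RW: "quad ?R (W x) = 0"
  proof -
    have "quad ?R (W x) = (\<Sum>k\<in>UNIV. (\<Sum>i\<in>UNIV. W x $ i * cov_deriv h W x i k) * W x $ k)"
      by (simp add: R0_eq_quad[symmetric] R0_def wc_def mult.commute)
    then show ?thesis by (simp add: cov_W[OF x])
  qed
  have R0: "quad ?R y = 0" for y
  proof -
    define u where "u = y - w x y *\<^sub>R W x"
    have "w x u = w x y - w x y * w x (W x)"
      by (simp add: u_def w_def algebra_simps sum_subtractf sum_distrib_left)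
    then have u: "w x u = 0" by (simp add: w_W[OF x])
    have "y = w x y *\<^sub>R W x + u" by (simp add: u_def)
    then have "quad ?R y = quad ?R (w x y *\<^sub>R W x) + w x y * (\<Sum>i\<in>UNIV. \<Sum>j\<in>UNIV. ?R $ i $ j * (W x $ i * u $ j + u $ i * W x $ j)) + quad ?R u"
      using expand[of "w x y *\<^sub>R W x" u] by (simp add: sum_distrib_left algebra_simps)
    also have "quad ?R (w x y *\<^sub>R W x) = (w x y)\<^sup>2 * quad ?R (W x)"
      by (simp add: quad_def sum_distrib_left power2_eq_square mult_ac)
    finally show ?thesis using R[OF u] RW by simp
  qed
  have "?R $ i $ j = ?R $ j $ i" for i j by (simp add: R_tensor_def)
  from symmetric_quad_zero[OF this R0] show ?thesis .
qed

end

context weighted_kropina begin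

text \<open>The S-curvature is n + 1 times \<open>e + p\<close>; this is the summand without a pole
  along \<open>P\<close>.\<close>

definition e :: "real ^ 'n \<Rightarrow> real ^ 'n \<Rightarrow> real" where "e x y = f0 x y - s0 x y"
definition Z :: "real ^ 'n \<Rightarrow> real ^ 'n \<Rightarrow> real" where "Z x y = w x y * R0 x y"
text \<open>What remains of \<open>P * along Ghat p\<close> besides -2 P p^2; here \<open>Z\<close>
  is -p P, so no division by \<open>P\<close> is left.\<close>

definition B1 :: "real ^ 'n \<Rightarrow> real ^ 'n \<Rightarrow> real" where
  "B1 x y = 2 * Z x y * s0 x y - along Ghat Z x y"
text \<open>The part of P Ric_{a,c} whose only denominator is \<open>w\<close>.\<close>

definition B :: "real \<Rightarrow> real \<Rightarrow> real ^ 'n \<Rightarrow> real ^ 'n \<Rightarrow> real" where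
  "B a c x y = P x y * spray_ricci Ghat x y - (real CARD('n) - 1) * B1 x y
    + a * (real CARD('n) + 1) * (P x y * along Ghat e x y + B1 x y + 2 * Z x y * e x y)
    - c * (real CARD('n) + 1)\<^sup>2 * (P x y * e x y * e x y - 2 * Z x y * e x y)"

lemma rat_e: "e \<in> rat U \<Omega> dens"
  unfolding e_def[abs_def] by (intro rat_diff rat_f0 rat_s0)

lemma rat_Z: "Z \<in> rat U \<Omega> dens"
  unfolding Z_def[abs_def] by (intro rat_mult rat_w rat_R0)

lemma rat_B: "B a c \<in> rat U \<Omega> {w}"
proof -
  have G: "Ghat k \<in> rat U \<Omega> {w}" for k by (intro rat_Ghat) simp
  have "B1 \<in> rat U \<Omega> {w}"
    unfolding B1_def[abs_def] by (intro rat_diff rat_mult rat_const rat_Z rat_s0 rat_along G)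
  then show ?thesis
    unfolding B_def[abs_def]
    by (intro rat_diff rat_add rat_mult rat_const rat_P rat_spray_ricci rat_along rat_Z rat_e G)
qed

lemma e_homogeneous: "s > 0 \<Longrightarrow> e x (s *\<^sub>R y) = s ^ 1 * e x y"
  by (simp add: e_def homogeneity f0_def sum_distrib_left algebra_simps)

text \<open>After multiplication by \<open>P\<close>, single factors \<open>p\<close> become -Z and
  only \<open>P * p\<^sup>2\<close> keeps a pole. Its coefficient collects 1 + 2 times n - 1 from
  the projective term, -2 - 2 times a(n+1) from the derivative of the S-curvature, and -c(n+1)^2
  from its square.\<close>

lemma P_weighted_ricci:
  assumes xy: "(x, y) \<in> \<Omega>"
  shows "P x y * weighted_ricci F \<Omega> vol a c x y =
    (3 * (real CARD('n) - 1) - 4 * a * (real CARD('n) + 1) - c * (real CARD('n) + 1)\<^sup>2) * (P x y * (p x y)\<^sup>2) + B a c x y"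
proof -
  let ?n = "real CARD('n)"
  have G_eq: "G = (\<lambda>k x y. Ghat k x y + p x y * y $ k)"
    by (simp add: G_def fun_eq_iff)
  have Ghat_euler: "(\<Sum>j\<in>UNIV. y $ j * dd (Inr j) (Ghat k) x y) = 2 * Ghat k x y" if "(x, y) \<in> \<Omega>" for k x y
    using euler_homogeneous[OF rats_tdiff[OF rats_Ghat that] Ghat_homogeneous] by simp
  have p_euler: "(\<Sum>j\<in>UNIV. y $ j * dd (Inr j) p x y) = p x y" if "(x, y) \<in> \<Omega>" for x y
    using euler_homogeneous[OF rats_tdiff[OF rats_p that] p_homogeneous] by simp
  have e_euler: "(\<Sum>j\<in>UNIV. y $ j * dd (Inr j) e x y) = e x y"
    using euler_homogeneous[OF rats_tdiff[OF rat_e xy] e_homogeneous] by simp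
  have P_euler: "(\<Sum>j\<in>UNIV. y $ j * dd (Inr j) P x y) = 2 * P x y"
    using euler_homogeneous[OF rats_tdiff[OF rat_P xy] homogeneity(2)] by simp
  have along_shift: "along G \<phi> x y = along Ghat \<phi> x y - 2 * p x y * (\<Sum>k\<in>UNIV. y $ k * dd (Inr k) \<phi> x y)" for \<phi>
    unfolding G_eq by (rule along_homogeneous_shift)
  have ricci: "spray_ricci G x y = spray_ricci Ghat x y + (?n - 1) * ((p x y)\<^sup>2 - along Ghat p x y)"
    unfolding G_eq by (rule spray_ricci_projective[OF rats_Ghat rats_p Ghat_euler p_euler xy])
  have "along G (\<lambda>x y. f0 x y + p x y - s0 x y) x y = along G (\<lambda>x y. e x y + p x y) x y"
    by (rule along_cong[OF xy]) (simp add: e_def)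
  also have "\<dots> = along G e x y + along G p x y"
    by (rule along_add[OF rat_e rats_p xy])
  finally have S': "along G (\<lambda>x y. f0 x y + p x y - s0 x y) x y =
      along Ghat e x y + along Ghat p x y - 2 * p x y * e x y - 2 * (p x y)\<^sup>2"
    unfolding along_shift e_euler p_euler[OF xy] by (simp add: power2_eq_square)
  have pP: "p x y * P x y = - Z x y" by (simp add: p_P[OF xy] Z_def)
  have "along Ghat P x y = 2 * (T x y * w x y) + 4 * (p x y * P x y)"
    using along_shift[of P] along_G_P[OF xy] unfolding P_euler by simp
  also have "T x y * w x y = Z x y + P x y * s0 x y"
    using w_iw[OF xy] by (simp add: T_def Z_def algebra_simps)
  finally have along_P: "along Ghat P x y = - 2 * Z x y + 2 * P x y * s0 x y"
    unfolding pP by simp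
  \<comment> \<open>Differentiating the product \<open>p * P\<close> gives the derivative of
    \<open>p\<close> without expanding that of 1/P.\<close>
  have "along Ghat (\<lambda>x y. p x y * P x y) x y = along Ghat (\<lambda>x y. - 1 * Z x y) x y"
    by (rule along_cong[OF xy]) (simp add: p_P Z_def)
  then have "along Ghat p x y * P x y + p x y * along Ghat P x y = - along Ghat Z x y"
    by (simp only: along_mult[OF rats_p rat_P xy] along_cmult[OF rat_Z xy])
  then have Pp: "P x y * along Ghat p x y = - 2 * (P x y * (p x y)\<^sup>2) + B1 x y"
    unfolding along_P B1_def using pP by (simp add: algebra_simps power2_eq_square) algebra
  have ricci_eq: "weighted_ricci F \<Omega> vol a c x y = spray_ricci Ghat x y + (?n - 1) * ((p x y)\<^sup>2 - along Ghat p x y)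
    + a * (?n + 1) * (along Ghat e x y + along Ghat p x y - 2 * p x y * e x y - 2 * (p x y)\<^sup>2)
    - c * (?n + 1)\<^sup>2 * (e x y + p x y)\<^sup>2"
    unfolding weighted_ricci_eq[OF xy] ricci S' by (simp add: e_def algebra_simps)
  have "P x y * weighted_ricci F \<Omega> vol a c x y = P x y * spray_ricci Ghat x y
    + (?n - 1) * (P x y * (p x y)\<^sup>2 - P x y * along Ghat p x y)
    + a * (?n + 1) * (P x y * along Ghat e x y + P x y * along Ghat p x y - 2 * (p x y * P x y) * e x y - 2 * (P x y * (p x y)\<^sup>2))
    - c * (?n + 1)\<^sup>2 * (P x y * e x y * e x y + 2 * (p x y * P x y) * e x y + P x y * (p x y)\<^sup>2)"
    unfolding ricci_eq by (simp add: algebra_simps power2_eq_square)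
  then show ?thesis
    unfolding Pp pP B_def by (simp add: algebra_simps)
qed

theorem einstein_imp_R_tensor_zero:
  assumes \<nu>: "3 * (real CARD('n) - 1) - 4 * a * (real CARD('n) + 1) - c * (real CARD('n) + 1)\<^sup>2 \<noteq> 0"
    and x: "x \<in> U"
    and einstein: "\<And>y. (x, y) \<in> \<Omega> \<Longrightarrow> weighted_ricci F \<Omega> vol a c x y =
      (real CARD('n) - 1) * (3 * (\<theta> \<bullet> y) / F x y + \<sigma>) * (F x y)\<^sup>2"
  shows "R_tensor h W x $ i $ j = 0"
proof (rule R_tensor_eq_0I[OF x])
  fix u assume u: "w x u = 0"
  let ?\<nu> = "3 * (real CARD('n) - 1) - 4 * a * (real CARD('n) + 1) - c * (real CARD('n) + 1)\<^sup>2"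
  let ?R = "R_tensor h W x"
  let ?\<beta> = "\<Sum>i\<in>UNIV. \<Sum>j\<in>UNIV. ?R $ i $ j * (W x $ i * u $ j + u $ i * W x $ j)"
  show "?\<beta> = 0 \<and> quad ?R u = 0"
  proof (cases "u = 0")
    case True
    then show ?thesis by (simp add: quad_def)
  next
    case False
    let ?y = "\<lambda>t. W x + t *\<^sub>R u"
    have in_\<Omega>: "(x, ?y t) \<in> \<Omega>" for t
      using x u by (simp add: \<Omega>_def w_line)
    obtain b where b: "\<And>t. B a c x (?y t) = poly b t"
      using rat_polynomial_on_line[OF rat_B x u] by blast
    define k where "k = P x u"
    have k: "k > 0" using h_pos[OF x False] by (simp add: k_def P_def)
    have P_line: "P x (?y t) = 1 + k * t\<^sup>2" for t
    proof -
      have "P x (?y t) = P x (W x) + t * (w x u + (\<Sum>m\<in>UNIV. yl m x u * W x $ m)) + t\<^sup>2 * P x u"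
        unfolding w_def Wl_eq
        by (simp add: P_eq_sum yl_def algebra_simps sum.distrib sum_distrib_left power2_eq_square)
      then show ?thesis
        using u x by (simp add: contractions k_def) (simp add: P_def W_unit)
    qed
    have R_line: "R0 x (?y t) = 0 + ?\<beta> * t + quad ?R u * t\<^sup>2" for t
    proof -
      have "R0 x (?y t) = quad ?R (W x) + ?\<beta> * t + quad ?R u * t\<^sup>2"
        unfolding R0_eq_quad
        by (simp add: quad_def algebra_simps sum.distrib sum_distrib_left power2_eq_square)
      moreover have "quad ?R (W x) = (\<Sum>k\<in>UNIV. (\<Sum>i\<in>UNIV. W x $ i * cov_deriv h W x i k) * W x $ k)"
        by (simp add: R0_eq_quad[symmetric] R0_def wc_def mult.commute)
      ultimately show ?thesis by (simp add: cov_W[OF x])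
    qed
    \<comment> \<open>On the line w = 1 and F = P/2, so the Einstein right-hand side is a polynomial
      in t. The polynomial \<open>q\<close> then solves the decomposition of P Ric_{a,c} for P p^2,
      which requires division by \<nu>.\<close>
    define rhs where "rhs = smult (real CARD('n) - 1)
      (smult (3 / 2) ([:\<theta> \<bullet> W x, \<theta> \<bullet> u:] * [:1, 0, k:]) + smult (\<sigma> / 4) ([:1, 0, k:] * [:1, 0, k:]))"
    define q where "q = smult (1 / ?\<nu>) ([:1, 0, k:] * rhs - b)"
    have "(1 + k * t\<^sup>2) * poly q t = (0 + ?\<beta> * t + quad ?R u * t\<^sup>2)\<^sup>2" for t
    proof -
      let ?P = "1 + k * t\<^sup>2"
      have Ppos: "?P > 0" using k by (simp add: add_pos_nonneg)
      have F_line: "F x (?y t) = ?P / 2"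
        using F_eq[OF in_\<Omega>] by (simp add: P_line w_line[OF x u])
      have "weighted_ricci F \<Omega> vol a c x (?y t) = poly rhs t"
        unfolding einstein[OF in_\<Omega>] F_line using Ppos
        by (simp add: rhs_def inner_add_right field_simps power2_eq_square)
      then have "?P * poly rhs t = ?\<nu> * (?P * (p x (?y t))\<^sup>2) + poly b t"
        using P_weighted_ricci[OF in_\<Omega>, of t a c] by (simp add: P_line b)
      then have q: "poly q t = ?P * (p x (?y t))\<^sup>2"
        using \<nu> by (simp add: q_def field_simps power2_eq_square)
      have "(p x (?y t) * P x (?y t))\<^sup>2 = (R0 x (?y t))\<^sup>2"
        by (simp add: p_P[OF in_\<Omega>] w_line[OF x u])
      then show ?thesis
        unfolding q R_line[symmetric] by (simp add: P_line power2_eq_square mult_ac)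
    qed
    from square_divisible_by_definite_quadratic[OF k this] show ?thesis by simp
  qed
qed

end

subsection \<open>The Ricci tensor of the navigation metric\<close>

context navigation begin

lemmas smooth_intros =
  smooth_on_const smooth_on_add[OF open_U] smooth_on_mult[OF open_U] smooth_on_minus[OF open_U] smooth_on_diff[OF open_U]
  smooth_on_sum[OF open_U] smooth_on_pd smooth_h smooth_W smooth_Wl smooth_\<Gamma> smooth_cov smooth_A smooth_h_inv

lemma pd_add_U: "x \<in> U \<Longrightarrow> smooth_on U f \<Longrightarrow> smooth_on U f' \<Longrightarrow> pd i (\<lambda>z. f z + f' z) x = pd i f x + pd i f' x"
  by (simp add: pd_add smooth_diff)

lemma pd_mult_U: "x \<in> U \<Longrightarrow> smooth_on U f \<Longrightarrow> smooth_on U f' \<Longrightarrow> pd i (\<lambda>z. f z * f' z) x = pd i f x * f' x + f x * pd i f' x"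
  by (simp add: pd_mult smooth_diff)

lemma pd_sum_U:
  "x \<in> U \<Longrightarrow> (\<And>j. j \<in> J \<Longrightarrow> smooth_on U (f j)) \<Longrightarrow> pd i (\<lambda>z. \<Sum>j\<in>J. f j z) x = (\<Sum>j\<in>J. pd i (f j) x)"
  by (induction J rule: infinite_finite_induct) (auto simp: pd_add_U smooth_on_sum[OF open_U])

lemmas pd_simps = pd_add_U pd_mult_U pd_sum_U smooth_intros

lemma pd_commute: "x \<in> U \<Longrightarrow> smooth_on U f \<Longrightarrow> pd i (pd j f) x = pd j (pd i f) x"
  by (rule pd_pd_commute[OF open_U])

lemma pd_\<Gamma>_sym: "x \<in> U \<Longrightarrow> pd k (\<Gamma> m i j) x = pd k (\<Gamma> m j i) x"
  by (rule pd_cong[OF open_U]) (auto intro: \<Gamma>_sym)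

lemma h_inv_transpose:
  assumes "x \<in> U"
  shows "transpose (matrix_inv (h x)) = matrix_inv (h x)"
proof -
  have "transpose (matrix_inv (h x)) ** h x = mat 1"
    using arg_cong[OF h_inv(1)[OF assms], of transpose] by (simp add: matrix_transpose_mul h_transpose[OF assms])
  then have "transpose (matrix_inv (h x)) ** h x ** matrix_inv (h x) = matrix_inv (h x)"
    by simp
  then show ?thesis
    by (simp add: h_inv[OF assms] flip: matrix_mul_assoc)
qed

lemma h_inv_sym: "x \<in> U \<Longrightarrow> matrix_inv (h x) $ i $ j = matrix_inv (h x) $ j $ i"
  using h_inv_transpose[of x] by (simp add: transpose_def vec_eq_iff)

lemma \<Gamma>_trace:
  assumes x: "x \<in> U"
  shows "(\<Sum>m\<in>UNIV. \<Gamma> m i m x) = 1 / 2 * (\<Sum>m\<in>UNIV. \<Sum>k\<in>UNIV. matrix_inv (h x) $ m $ k * pd i (\<lambda>z. h z $ k $ m) x)"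
proof -
  let ?t = "\<lambda>m k. matrix_inv (h x) $ m $ k * pd m (\<lambda>z. h z $ k $ i) x"
  have "(\<Sum>m\<in>UNIV. \<Sum>k\<in>UNIV. matrix_inv (h x) $ m $ k * pd k (\<lambda>z. h z $ i $ m) x) = (\<Sum>m\<in>UNIV. \<Sum>k\<in>UNIV. ?t k m)"
    by (intro sum.cong refl) (simp add: h_inv_sym[OF x, of _ "_ :: 'n"] pd_h_sym[OF x, of _ i])
  also have "\<dots> = (\<Sum>m\<in>UNIV. \<Sum>k\<in>UNIV. ?t m k)"
    by (rule sum.swap)
  finally have eq: "(\<Sum>m\<in>UNIV. \<Sum>k\<in>UNIV. matrix_inv (h x) $ m $ k * pd k (\<lambda>z. h z $ i $ m) x) = \<dots>" .
  have "(\<Sum>m\<in>UNIV. \<Gamma> m i m x) = 1 / 2 * ((\<Sum>m\<in>UNIV. \<Sum>k\<in>UNIV. matrix_inv (h x) $ m $ k * pd i (\<lambda>z. h z $ k $ m) x)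
      + (\<Sum>m\<in>UNIV. \<Sum>k\<in>UNIV. ?t m k) - (\<Sum>m\<in>UNIV. \<Sum>k\<in>UNIV. matrix_inv (h x) $ m $ k * pd k (\<lambda>z. h z $ i $ m) x))"
    unfolding christoffel_def sum_distrib_left[symmetric] sum.distrib[symmetric] sum_subtractf[symmetric]
    by (simp add: algebra_simps)
  then show ?thesis unfolding eq by simp
qed

text \<open>The trace of the connection is the gradient of half the logarithm of det h. Instead of
  differentiating the determinant, the proof differentiates the identity for the inverse; the
  first-order terms form a trace that is symmetric by cyclicity. This gives symmetry of the Ricci
  tensor.\<close>

lemma pd_\<Gamma>_trace_sym:
  assumes x: "x \<in> U"
  shows "(\<Sum>m\<in>UNIV. pd j (\<Gamma> m i m) x) = (\<Sum>m\<in>UNIV. pd i (\<Gamma> m j m) x)"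
proof -
  define K where "K j = (\<chi> m k. pd j (\<lambda>z. matrix_inv (h z) $ m $ k) x)" for j
  define D where "D j = (\<chi> k m. pd j (\<lambda>z. h z $ k $ m) x)" for j
  let ?I = "matrix_inv (h x)"
  have K_h: "K j ** h x + ?I ** D j = 0" for j
  proof -
    have "(\<Sum>p\<in>UNIV. pd j (\<lambda>z. matrix_inv (h z) $ m $ p) x * h x $ p $ q + ?I $ m $ p * pd j (\<lambda>z. h z $ p $ q) x) = 0" for m q
    proof -
      have "pd j (\<lambda>z. \<Sum>p\<in>UNIV. matrix_inv (h z) $ m $ p * h z $ p $ q) x = pd j (\<lambda>z. mat 1 $ m $ q) x"
      proof (rule pd_cong[OF open_U x])
        fix z assume "z \<in> U"
        from h_inv(2)[OF this] show "(\<Sum>p\<in>UNIV. matrix_inv (h z) $ m $ p * h z $ p $ q) = mat 1 $ m $ q"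
          by (simp add: matrix_matrix_mult_def vec_eq_iff)
      qed
      then show ?thesis by (simp add: pd_simps x)
    qed
    then show ?thesis
      by (simp add: K_def D_def matrix_matrix_mult_def vec_eq_iff sum.distrib)
  qed
  have K_eq: "K j = - (?I ** D j ** ?I)" for j
  proof -
    have "K j ** h x = - (?I ** D j)"
      using K_h[of j] by (simp add: eq_neg_iff_add_eq_0)
    then have "K j ** h x ** ?I = - (?I ** D j) ** ?I" by simp
    also have "- (?I ** D j) ** ?I = - (?I ** D j ** ?I)"
      by (simp add: matrix_matrix_mult_def vec_eq_iff sum_negf)
    finally show ?thesis
      by (simp add: h_inv[OF x] flip: matrix_mul_assoc)
  qed
  have eq: "(\<Sum>m\<in>UNIV. pd j (\<Gamma> m i m) x) =
      1 / 2 * (trace (K j ** D i) + (\<Sum>m\<in>UNIV. \<Sum>k\<in>UNIV. ?I $ m $ k * pd j (pd i (\<lambda>z. h z $ k $ m)) x))" for i j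
  proof -
    have "(\<Sum>m\<in>UNIV. pd j (\<Gamma> m i m) x) = pd j (\<lambda>z. \<Sum>m\<in>UNIV. \<Gamma> m i m z) x"
      by (simp add: pd_simps x)
    also have "\<dots> = pd j (\<lambda>z. 1 / 2 * (\<Sum>m\<in>UNIV. \<Sum>k\<in>UNIV. matrix_inv (h z) $ m $ k * pd i (\<lambda>z. h z $ k $ m) z)) x"
      by (rule pd_cong[OF open_U x \<Gamma>_trace])
    also have "\<dots> = 1 / 2 * (\<Sum>m\<in>UNIV. \<Sum>k\<in>UNIV. K j $ m $ k * D i $ k $ m + ?I $ m $ k * pd j (pd i (\<lambda>z. h z $ k $ m)) x)"
      by (subst pd_mult_U[OF x], (intro smooth_intros)+, simp add: pd_simps x K_def D_def)
    finally show ?thesis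
      by (simp add: trace_def matrix_matrix_mult_def sum.distrib)
  qed
  have "trace (K j ** D i) = - trace (?I ** D j ** (?I ** D i))" for i j
    unfolding K_eq by (simp add: matrix_mul_assoc) (simp add: trace_def matrix_matrix_mult_def sum_negf)
  moreover have "trace (?I ** D j ** (?I ** D i)) = trace (?I ** D i ** (?I ** D j))"
    by (rule trace_mul_sym)
  moreover have "pd j (pd i (\<lambda>z. h z $ k $ m)) x = pd i (pd j (\<lambda>z. h z $ k $ m)) x" for k m
    by (intro pd_commute x smooth_h)
  ultimately show ?thesis unfolding eq by simp
qed

lemma riem_ricci_eq:
  assumes x: "x \<in> U"
  shows "riem_ricci h x $ i $ j = (\<Sum>m\<in>UNIV. pd m (\<Gamma> m i j) x) - (\<Sum>m\<in>UNIV. pd j (\<Gamma> m i m) x)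
    + (\<Sum>m\<in>UNIV. \<Sum>p\<in>UNIV. \<Gamma> m m p x * \<Gamma> p i j x) - (\<Sum>m\<in>UNIV. \<Sum>p\<in>UNIV. \<Gamma> m j p x * \<Gamma> p i m x)"
  by (simp add: riem_ricci_def sum_subtractf)

lemma riem_ricci_sym:
  assumes x: "x \<in> U"
  shows "riem_ricci h x $ i $ j = riem_ricci h x $ j $ i"
proof -
  have "(\<Sum>m\<in>UNIV. \<Sum>p\<in>UNIV. \<Gamma> m j p x * \<Gamma> p i m x) = (\<Sum>p\<in>UNIV. \<Sum>m\<in>UNIV. \<Gamma> m j p x * \<Gamma> p i m x)"
    by (rule sum.swap)
  also have "\<dots> = (\<Sum>m\<in>UNIV. \<Sum>p\<in>UNIV. \<Gamma> m i p x * \<Gamma> p j m x)"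
    by (simp add: mult.commute)
  finally show ?thesis
    unfolding riem_ricci_eq[OF x] pd_\<Gamma>_trace_sym[OF x, of j i]
    using pd_\<Gamma>_sym[OF x, of _ _ i j] \<Gamma>_sym[OF x, of _ i j] by simp
qed

text \<open>As \<open>Gbar\<close> is quadratic in \<open>y\<close>, the four groups of terms in the
  spray curvature become quadratic forms matching the four groups of the Ricci tensor.\<close>

lemma spray_ricci_Gbar:
  assumes xy: "(x, y) \<in> \<Omega>"
  shows "spray_ricci Gbar x y = quad (riem_ricci h x) y"
proof -
  note x = \<Omega>_base[OF xy]
  have dvg: "dvg Gbar x y = (\<Sum>m\<in>UNIV. N m m x y)" if "(x, y) \<in> \<Omega>" for x y
    using that by (simp add: dvg_def dr_Gbar)
  have "along Gbar (dvg Gbar) x y = along Gbar (\<lambda>x y. \<Sum>m\<in>UNIV. N m m x y) x y"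
    by (rule along_cong[OF xy dvg])
  also have "\<dots> = (\<Sum>k\<in>UNIV. y $ k * (\<Sum>m\<in>UNIV. \<Sum>j\<in>UNIV. pd k (\<Gamma> m m j) x * y $ j))
      - 2 * (\<Sum>k\<in>UNIV. Gbar k x y * (\<Sum>m\<in>UNIV. \<Gamma> m m k x))"
    unfolding along_def using xy
    by (simp add: rats_dd_sum rats_base dr_N) (simp add: N_def[abs_def] rats_dd_simps rats_base)
  finally have al: "along Gbar (dvg Gbar) x y = \<dots>" .
  have dl: "dd (Inl m) (Gbar m) x y = 1 / 2 * (\<Sum>k\<in>UNIV. \<Sum>j\<in>UNIV. pd m (\<Gamma> m k j) x * y $ j * y $ k)" for m
    unfolding Gbar_def[abs_def] N_def[abs_def] using xy
    by (simp add: rats_dd_simps rats_base sum_distrib_right)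
  let ?s = "\<lambda>f. \<Sum>i\<in>UNIV. \<Sum>j\<in>UNIV. f i j * y $ i * y $ j"
  have 1: "2 * (\<Sum>m\<in>UNIV. dd (Inl m) (Gbar m) x y) = ?s (\<lambda>i j. \<Sum>m\<in>UNIV. pd m (\<Gamma> m i j) x)"
  proof -
    have "2 * (\<Sum>m\<in>UNIV. dd (Inl m) (Gbar m) x y) = (\<Sum>m\<in>UNIV. \<Sum>i\<in>UNIV. \<Sum>j\<in>UNIV. pd m (\<Gamma> m i j) x * y $ i * y $ j)"
      by (simp add: dl sum_distrib_left mult_ac)
    also have "\<dots> = (\<Sum>i\<in>UNIV. \<Sum>m\<in>UNIV. \<Sum>j\<in>UNIV. pd m (\<Gamma> m i j) x * y $ i * y $ j)"
      by (rule sum.swap)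
    also have "\<dots> = (\<Sum>i\<in>UNIV. \<Sum>j\<in>UNIV. \<Sum>m\<in>UNIV. pd m (\<Gamma> m i j) x * y $ i * y $ j)"
      by (intro sum.cong refl sum.swap)
    finally show ?thesis by (simp add: sum_distrib_right)
  qed
  have 2: "(\<Sum>k\<in>UNIV. y $ k * (\<Sum>m\<in>UNIV. \<Sum>j\<in>UNIV. pd k (\<Gamma> m m j) x * y $ j)) = ?s (\<lambda>i j. \<Sum>m\<in>UNIV. pd j (\<Gamma> m i m) x)"
  proof -
    have "(\<Sum>k\<in>UNIV. y $ k * (\<Sum>m\<in>UNIV. \<Sum>j\<in>UNIV. pd k (\<Gamma> m m j) x * y $ j)) =
        (\<Sum>k\<in>UNIV. \<Sum>m\<in>UNIV. \<Sum>j\<in>UNIV. pd k (\<Gamma> m j m) x * y $ j * y $ k)"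
      using pd_\<Gamma>_sym[OF x] by (simp add: sum_distrib_left mult_ac)
    also have "\<dots> = (\<Sum>k\<in>UNIV. \<Sum>j\<in>UNIV. \<Sum>m\<in>UNIV. pd k (\<Gamma> m j m) x * y $ j * y $ k)"
      by (intro sum.cong refl sum.swap)
    also have "\<dots> = (\<Sum>j\<in>UNIV. \<Sum>k\<in>UNIV. \<Sum>m\<in>UNIV. pd k (\<Gamma> m j m) x * y $ j * y $ k)"
      by (rule sum.swap)
    finally show ?thesis by (simp add: sum_distrib_right)
  qed
  have 3: "2 * (\<Sum>k\<in>UNIV. Gbar k x y * (\<Sum>m\<in>UNIV. \<Gamma> m m k x)) = ?s (\<lambda>i j. \<Sum>m\<in>UNIV. \<Sum>p\<in>UNIV. \<Gamma> m m p x * \<Gamma> p i j x)"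
  proof -
    have "2 * (\<Sum>k\<in>UNIV. Gbar k x y * (\<Sum>m\<in>UNIV. \<Gamma> m m k x)) =
        (\<Sum>p\<in>UNIV. \<Sum>i\<in>UNIV. \<Sum>j\<in>UNIV. (\<Sum>m\<in>UNIV. \<Gamma> m m p x) * \<Gamma> p i j x * y $ i * y $ j)"
    proof -
      have "2 * (\<Sum>k\<in>UNIV. Gbar k x y * (\<Sum>m\<in>UNIV. \<Gamma> m m k x)) =
          (\<Sum>p\<in>UNIV. (\<Sum>i\<in>UNIV. N p i x y * y $ i) * (\<Sum>m\<in>UNIV. \<Gamma> m m p x))"
        unfolding sum_N_y by (simp add: sum_distrib_left mult_ac)
      then show ?thesis
        by (simp add: N_def sum_distrib_left sum_distrib_right mult_ac)
    qed
    also have "\<dots> = (\<Sum>i\<in>UNIV. \<Sum>p\<in>UNIV. \<Sum>j\<in>UNIV. (\<Sum>m\<in>UNIV. \<Gamma> m m p x) * \<Gamma> p i j x * y $ i * y $ j)"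
      by (rule sum.swap)
    also have "\<dots> = (\<Sum>i\<in>UNIV. \<Sum>j\<in>UNIV. \<Sum>p\<in>UNIV. (\<Sum>m\<in>UNIV. \<Gamma> m m p x) * \<Gamma> p i j x * y $ i * y $ j)"
      by (intro sum.cong refl sum.swap)
    also have "\<dots> = ?s (\<lambda>i j. \<Sum>p\<in>UNIV. \<Sum>m\<in>UNIV. \<Gamma> m m p x * \<Gamma> p i j x)"
      by (simp add: sum_distrib_right)
    also have "\<dots> = ?s (\<lambda>i j. \<Sum>m\<in>UNIV. \<Sum>p\<in>UNIV. \<Gamma> m m p x * \<Gamma> p i j x)"
      by (intro sum.cong refl arg_cong2[where f = "(*)"] sum.swap)
    finally show ?thesis .
  qed
  have 4: "(\<Sum>m\<in>UNIV. \<Sum>k\<in>UNIV. dd (Inr k) (Gbar m) x y * dd (Inr m) (Gbar k) x y) =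
      ?s (\<lambda>i j. \<Sum>m\<in>UNIV. \<Sum>p\<in>UNIV. \<Gamma> m j p x * \<Gamma> p i m x)"
  proof -
    have "(\<Sum>m\<in>UNIV. \<Sum>k\<in>UNIV. dd (Inr k) (Gbar m) x y * dd (Inr m) (Gbar k) x y) =
        (\<Sum>m\<in>UNIV. \<Sum>p\<in>UNIV. \<Sum>i\<in>UNIV. \<Sum>j\<in>UNIV. \<Gamma> m j p x * \<Gamma> p i m x * y $ i * y $ j)"
    proof (intro sum.cong refl)
      fix m p
      have "N m p x y * N p m x y = (\<Sum>j\<in>UNIV. \<Sum>i\<in>UNIV. \<Gamma> m j p x * \<Gamma> p i m x * y $ i * y $ j)"
        unfolding N_def sum_product using \<Gamma>_sym[OF x] by (intro sum.cong refl) simp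
      also have "\<dots> = (\<Sum>i\<in>UNIV. \<Sum>j\<in>UNIV. \<Gamma> m j p x * \<Gamma> p i m x * y $ i * y $ j)"
        by (rule sum.swap)
      finally show "dd (Inr p) (Gbar m) x y * dd (Inr m) (Gbar p) x y = \<dots>"
        by (simp add: dr_Gbar[OF xy])
    qed
    also have "\<dots> = (\<Sum>m\<in>UNIV. \<Sum>i\<in>UNIV. \<Sum>p\<in>UNIV. \<Sum>j\<in>UNIV. \<Gamma> m j p x * \<Gamma> p i m x * y $ i * y $ j)"
      by (intro sum.cong refl sum.swap)
    also have "\<dots> = (\<Sum>i\<in>UNIV. \<Sum>m\<in>UNIV. \<Sum>p\<in>UNIV. \<Sum>j\<in>UNIV. \<Gamma> m j p x * \<Gamma> p i m x * y $ i * y $ j)"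
      by (rule sum.swap)
    also have "\<dots> = (\<Sum>i\<in>UNIV. \<Sum>m\<in>UNIV. \<Sum>j\<in>UNIV. \<Sum>p\<in>UNIV. \<Gamma> m j p x * \<Gamma> p i m x * y $ i * y $ j)"
      by (intro sum.cong refl sum.swap)
    also have "\<dots> = (\<Sum>i\<in>UNIV. \<Sum>j\<in>UNIV. \<Sum>m\<in>UNIV. \<Sum>p\<in>UNIV. \<Gamma> m j p x * \<Gamma> p i m x * y $ i * y $ j)"
      by (intro sum.cong refl sum.swap)
    finally show ?thesis by (simp add: sum_distrib_right)
  qed
  show ?thesis
    unfolding spray_ricci_def al 1 2 3 4 quad_def riem_ricci_eq[OF x]
    by (simp add: algebra_simps sum.distrib sum_subtractf sum_distrib_left sum_distrib_right)
qed

section \<open>The covariant derivative of the vector field W\<close>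

lemma pd_Wl:
  assumes "x \<in> U"
  shows "pd k (Wl l) x = (\<Sum>m\<in>UNIV. pd k (\<lambda>z. h z $ l $ m) x * W x $ m) + (\<Sum>m\<in>UNIV. h x $ l $ m * pd k (\<lambda>z. W z $ m) x)"
  unfolding Wl_eq[abs_def] using assms by (simp add: pd_simps sum.distrib)

text \<open>The mixed covariant derivative W^m_{|k}.\<close>

definition V :: "'n \<Rightarrow> 'n \<Rightarrow> real ^ 'n \<Rightarrow> real" where
  "V m k x = pd k (\<lambda>z. W z $ m) x + (\<Sum>q\<in>UNIV. \<Gamma> m k q x * W x $ q)"

text \<open>Lowering an index commutes with covariant differentiation, because \<open>h\<close> is
  parallel.\<close>

lemma h_V:
  assumes x: "x \<in> U"
  shows "(\<Sum>m\<in>UNIV. h x $ l $ m * V m k x) = cov_deriv h W x l k"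
proof -
  have "(\<Sum>m\<in>UNIV. pd k (\<lambda>z. h z $ l $ m) x * W x $ m) =
      (\<Sum>m\<in>UNIV. \<Sum>p\<in>UNIV. \<Gamma> p k l x * (h x $ p $ m * W x $ m)) + (\<Sum>m\<in>UNIV. \<Sum>p\<in>UNIV. h x $ l $ p * (\<Gamma> p k m x * W x $ m))"
    unfolding pd_h[OF x] using h_sym[OF x]
    by (simp add: distrib_right distrib_left sum.distrib sum_distrib_left mult_ac)
  also have "(\<Sum>m\<in>UNIV. \<Sum>p\<in>UNIV. \<Gamma> p k l x * (h x $ p $ m * W x $ m)) = (\<Sum>p\<in>UNIV. \<Gamma> p l k x * Wl p x)"
    using \<Gamma>_sym[OF x] by (subst sum.swap) (simp add: Wl_eq sum_distrib_left)
  also have "(\<Sum>m\<in>UNIV. \<Sum>p\<in>UNIV. h x $ l $ p * (\<Gamma> p k m x * W x $ m)) = (\<Sum>p\<in>UNIV. h x $ l $ p * (\<Sum>m\<in>UNIV. \<Gamma> p k m x * W x $ m))"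
    by (subst sum.swap) (simp add: sum_distrib_left)
  finally show ?thesis
    by (simp add: cov_deriv_Wl pd_Wl[OF x] V_def distrib_left sum.distrib)
qed

end

subsection \<open>The weighted Ricci curvature for a Killing field\<close>

context tangent_domain begin

lemma spray_ricci_cong:
  assumes "\<And>k x y. (x, y) \<in> \<Omega> \<Longrightarrow> X k x y = Y k x y" "(x, y) \<in> \<Omega>"
  shows "spray_ricci X x y = spray_ricci Y x y"
proof -
  have d: "dd s (X k) x y = dd s (Y k) x y" if "(x, y) \<in> \<Omega>" for s k x y
    by (rule dd_cong'[OF that assms(1)])
  have "dvg X x y = dvg Y x y" if "(x, y) \<in> \<Omega>" for x y
    by (simp add: dvg_def d[OF that])
  then have "along X (dvg X) x y = along X (dvg Y) x y"
    by (intro along_cong assms(2))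
  also have "\<dots> = along Y (dvg Y) x y"
    by (simp add: along_def assms(1)[OF assms(2)])
  finally show ?thesis
    by (simp add: spray_ricci_def d[OF assms(2)])
qed

end

locale killing_kropina = weighted_kropina U h W F vol \<phi>
  for U :: "(real ^ 'n::finite) set" and h :: "real ^ 'n \<Rightarrow> real ^ 'n ^ 'n" and W :: "real ^ 'n \<Rightarrow> real ^ 'n"
    and F :: "real ^ 'n \<Rightarrow> real ^ 'n \<Rightarrow> real" and vol \<phi> :: "real ^ 'n \<Rightarrow> real" +
  assumes R_zero: "\<And>x i j. x \<in> U \<Longrightarrow> R_tensor h W x $ i $ j = 0"
begin

abbreviation A :: "'n \<Rightarrow> 'n \<Rightarrow> real ^ 'n \<Rightarrow> real" where "A m k x \<equiv> S_endo h W x $ m $ k"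

lemma cov_antisym: "x \<in> U \<Longrightarrow> cov_deriv h W x i j = - cov_deriv h W x j i"
  using R_zero[of x i j] by (simp add: R_tensor_def)

lemma S_tensor_eq: "x \<in> U \<Longrightarrow> S_tensor h W x $ i $ j = cov_deriv h W x i j"
  using cov_antisym[of x i j] by (simp add: S_tensor_def)

lemma R0_zero: "x \<in> U \<Longrightarrow> R0 x y = 0"
  by (simp add: R0_eq_quad quad_def R_zero)

lemma h_A_sum: "x \<in> U \<Longrightarrow> (\<Sum>m\<in>UNIV. h x $ l $ m * A m k x) = cov_deriv h W x l k"
  using arg_cong[OF h_A[of x], of "\<lambda>M. M $ l $ k"] by (simp add: matrix_matrix_mult_def S_tensor_eq)

text \<open>For a Killing field the covariant derivative is already skew, so the endomorphism is all
  of it.\<close>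

lemma A_eq_V:
  assumes x: "x \<in> U"
  shows "A m k x = V m k x"
proof -
  have "h x *v (\<chi> m. A m k x) = h x *v (\<chi> m. V m k x)"
    by (simp add: matrix_vector_mult_def h_A_sum[OF x] h_V[OF x])
  then have "matrix_inv (h x) *v (h x *v (\<chi> m. A m k x)) = matrix_inv (h x) *v (h x *v (\<chi> m. V m k x))"
    by simp
  then show ?thesis
    by (simp add: matrix_vector_mul_assoc h_inv[OF x] vec_eq_iff)
qed

lemma Wl_A:
  assumes x: "x \<in> U"
  shows "(\<Sum>m\<in>UNIV. Wl m x * A m k x) = 0"
proof -
  have "(\<Sum>m\<in>UNIV. Wl m x * A m k x) = (\<Sum>m\<in>UNIV. \<Sum>l\<in>UNIV. W x $ l * (h x $ l $ m * A m k x))"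
    using h_sym[OF x] by (simp add: Wl_eq sum_distrib_left sum_distrib_right mult_ac)
  also have "\<dots> = (\<Sum>l\<in>UNIV. W x $ l * (\<Sum>m\<in>UNIV. h x $ l $ m * A m k x))"
    by (subst sum.swap) (simp add: sum_distrib_left)
  finally show ?thesis by (simp add: h_A_sum[OF x] cov_W[OF x])
qed

text \<open>Skew-symmetry turns differentiation in direction W into the contraction handled by
  \<open>cov_W\<close>; geometrically, the orbits of a unit Killing field are geodesics.\<close>

lemma A_W:
  assumes x: "x \<in> U"
  shows "(\<Sum>k\<in>UNIV. A m k x * W x $ k) = 0"
proof -
  have S: "(\<Sum>k\<in>UNIV. S_tensor h W x $ p $ k * W x $ k) = 0" for p
  proof -
    have "(\<Sum>k\<in>UNIV. S_tensor h W x $ p $ k * W x $ k) = - (\<Sum>k\<in>UNIV. W x $ k * cov_deriv h W x k p)"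
      unfolding sum_negf[symmetric]
      by (intro sum.cong refl) (simp add: S_tensor_eq[OF x] cov_antisym[OF x, of p])
    then show ?thesis by (simp add: cov_W[OF x])
  qed
  have "(\<Sum>k\<in>UNIV. A m k x * W x $ k) = (\<Sum>k\<in>UNIV. \<Sum>p\<in>UNIV. matrix_inv (h x) $ m $ p * (S_tensor h W x $ p $ k * W x $ k))"
    by (simp add: S_endo_def matrix_matrix_mult_def sum_distrib_left sum_distrib_right mult_ac)
  also have "\<dots> = (\<Sum>p\<in>UNIV. matrix_inv (h x) $ m $ p * (\<Sum>k\<in>UNIV. S_tensor h W x $ p $ k * W x $ k))"
    by (subst sum.swap) (simp add: sum_distrib_left)
  finally show ?thesis by (simp add: S)
qed

lemma A_trace:
  assumes x: "x \<in> U"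
  shows "(\<Sum>m\<in>UNIV. A m m x) = 0"
proof -
  have "(\<Sum>m\<in>UNIV. A m m x) = (\<Sum>m\<in>UNIV. \<Sum>p\<in>UNIV. matrix_inv (h x) $ m $ p * cov_deriv h W x p m)"
    by (simp add: S_endo_def matrix_matrix_mult_def S_tensor_eq[OF x])
  also have "\<dots> = (\<Sum>p\<in>UNIV. \<Sum>m\<in>UNIV. matrix_inv (h x) $ m $ p * cov_deriv h W x p m)"
    by (rule sum.swap)
  also have "\<dots> = - (\<Sum>p\<in>UNIV. \<Sum>m\<in>UNIV. matrix_inv (h x) $ p $ m * cov_deriv h W x m p)"
    unfolding sum_negf[symmetric]
    by (intro sum.cong refl) (simp add: h_inv_sym[OF x, of "_ :: 'n"], metis cov_antisym h_inv_sym mult_minus_right x)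
  also have "(\<Sum>p\<in>UNIV. \<Sum>m\<in>UNIV. matrix_inv (h x) $ p $ m * cov_deriv h W x m p) = (\<Sum>m\<in>UNIV. A m m x)"
    by (simp add: S_endo_def matrix_matrix_mult_def S_tensor_eq[OF x])
  finally show ?thesis by simp
qed

lemma Wl_A0: "x \<in> U \<Longrightarrow> s0 x y = 0"
proof -
  assume x: "x \<in> U"
  have "s0 x y = (\<Sum>m\<in>UNIV. \<Sum>k\<in>UNIV. Wl m x * A m k x * y $ k)"
    by (simp add: s0_def A0_def sum_distrib_left mult_ac)
  also have "\<dots> = (\<Sum>k\<in>UNIV. (\<Sum>m\<in>UNIV. Wl m x * A m k x) * y $ k)"
    by (subst sum.swap) (simp add: sum_distrib_right)
  finally show ?thesis by (simp add: Wl_A[OF x])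
qed

text \<open>\<open>divA k\<close> is \<open>S\<^bsup>m\<^esup>\<^sub>k\<^sub>|\<^sub>m\<close>.\<close>

definition divA :: "'n \<Rightarrow> real ^ 'n \<Rightarrow> real" where
  "divA k x = (\<Sum>m\<in>UNIV. pd m (A m k) x) + (\<Sum>m\<in>UNIV. \<Sum>j\<in>UNIV. \<Gamma> m m j x * A j k x)
    - (\<Sum>m\<in>UNIV. \<Sum>j\<in>UNIV. \<Gamma> m j k x * A j m x)"

definition trA2 :: "real ^ 'n \<Rightarrow> real" where
  "trA2 x = (\<Sum>m\<in>UNIV. \<Sum>k\<in>UNIV. A m k x * A k m x)"

lemma pd_V:
  assumes "x \<in> U"
  shows "pd i (V m k) x = pd i (pd k (\<lambda>z. W z $ m)) x
    + (\<Sum>q\<in>UNIV. pd i (\<Gamma> m k q) x * W x $ q) + (\<Sum>q\<in>UNIV. \<Gamma> m k q x * pd i (\<lambda>z. W z $ q) x)"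
  unfolding V_def[abs_def] using assms by (simp add: pd_simps sum.distrib)

text \<open>The contracted Ricci identity: exchanging the derivatives in W^m_{|k|m} costs a Ricci
  term, and W^m_{|m|k} vanishes because a Killing field is divergence free.\<close>

lemma divA_eq_ricci:
  assumes x: "x \<in> U"
  shows "divA k x = (\<Sum>q\<in>UNIV. riem_ricci h x $ q $ k * W x $ q)"
proof -
  let ?dW = "\<lambda>i m. pd i (\<lambda>z. W z $ m) x"
  have pdA: "pd i (A m k) x = pd i (V m k) x" for i m k
    by (rule pd_cong[OF open_U x]) (simp add: A_eq_V)
  have "pd k (\<lambda>z. \<Sum>m\<in>UNIV. A m m z) x = pd k (\<lambda>z. 0) x"
    by (rule pd_cong[OF open_U x]) (simp add: A_trace)
  then have "(\<Sum>m\<in>UNIV. pd k (V m m) x) = 0"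
    by (simp add: pd_simps x pdA)
  then have tr: "(\<Sum>m\<in>UNIV. pd m (pd k (\<lambda>z. W z $ m)) x) + (\<Sum>m\<in>UNIV. \<Sum>q\<in>UNIV. pd k (\<Gamma> m m q) x * W x $ q)
      + (\<Sum>m\<in>UNIV. \<Sum>q\<in>UNIV. \<Gamma> m m q x * ?dW k q) = 0"
    by (simp add: pd_V[OF x] sum.distrib pd_commute[OF x smooth_W, of k])
  have 1: "(\<Sum>m\<in>UNIV. pd m (A m k) x) = (\<Sum>m\<in>UNIV. pd m (pd k (\<lambda>z. W z $ m)) x)
      + (\<Sum>m\<in>UNIV. \<Sum>q\<in>UNIV. pd m (\<Gamma> m k q) x * W x $ q) + (\<Sum>m\<in>UNIV. \<Sum>q\<in>UNIV. \<Gamma> m k q x * ?dW m q)"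
    by (simp add: pdA pd_V[OF x] sum.distrib)
  have 2: "(\<Sum>m\<in>UNIV. \<Sum>j\<in>UNIV. \<Gamma> m m j x * A j k x) = (\<Sum>m\<in>UNIV. \<Sum>j\<in>UNIV. \<Gamma> m m j x * ?dW k j)
      + (\<Sum>m\<in>UNIV. \<Sum>j\<in>UNIV. \<Sum>q\<in>UNIV. \<Gamma> m m j x * \<Gamma> j k q x * W x $ q)"
    by (simp add: A_eq_V[OF x] V_def distrib_left sum.distrib sum_distrib_left mult.assoc)
  have 3: "(\<Sum>m\<in>UNIV. \<Sum>j\<in>UNIV. \<Gamma> m j k x * A j m x) = (\<Sum>m\<in>UNIV. \<Sum>j\<in>UNIV. \<Gamma> m k j x * ?dW m j)
      + (\<Sum>m\<in>UNIV. \<Sum>j\<in>UNIV. \<Sum>q\<in>UNIV. \<Gamma> m k j x * \<Gamma> j m q x * W x $ q)"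
    using \<Gamma>_sym[OF x, of _ _ k]
    by (simp add: A_eq_V[OF x] V_def distrib_left sum.distrib sum_distrib_left mult.assoc)
  have 4: "(\<Sum>m\<in>UNIV. \<Sum>j\<in>UNIV. \<Sum>q\<in>UNIV. f m j q * W x $ q) = (\<Sum>q\<in>UNIV. (\<Sum>m\<in>UNIV. \<Sum>j\<in>UNIV. f m j q) * W x $ q)"
    for f :: "'n \<Rightarrow> 'n \<Rightarrow> 'n \<Rightarrow> real"
  proof -
    have "(\<Sum>m\<in>UNIV. \<Sum>j\<in>UNIV. \<Sum>q\<in>UNIV. f m j q * W x $ q) = (\<Sum>m\<in>UNIV. \<Sum>q\<in>UNIV. \<Sum>j\<in>UNIV. f m j q * W x $ q)"
      by (intro sum.cong refl sum.swap)
    also have "\<dots> = (\<Sum>q\<in>UNIV. \<Sum>m\<in>UNIV. \<Sum>j\<in>UNIV. f m j q * W x $ q)"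
      by (rule sum.swap)
    finally show ?thesis by (simp add: sum_distrib_right)
  qed
  have 5: "(\<Sum>m\<in>UNIV. \<Sum>q\<in>UNIV. f m q * W x $ q) = (\<Sum>q\<in>UNIV. (\<Sum>m\<in>UNIV. f m q) * W x $ q)"
    for f :: "'n \<Rightarrow> 'n \<Rightarrow> real"
    by (subst sum.swap) (simp add: sum_distrib_right)
  have "divA k x = (\<Sum>m\<in>UNIV. \<Sum>q\<in>UNIV. pd m (\<Gamma> m k q) x * W x $ q) - (\<Sum>m\<in>UNIV. \<Sum>q\<in>UNIV. pd k (\<Gamma> m m q) x * W x $ q)
      + (\<Sum>m\<in>UNIV. \<Sum>j\<in>UNIV. \<Sum>q\<in>UNIV. \<Gamma> m m j x * \<Gamma> j k q x * W x $ q)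
      - (\<Sum>m\<in>UNIV. \<Sum>j\<in>UNIV. \<Sum>q\<in>UNIV. \<Gamma> m k j x * \<Gamma> j m q x * W x $ q)"
    unfolding divA_def 1 2 3 using tr by linarith
  also have "\<dots> = (\<Sum>q\<in>UNIV. ((\<Sum>m\<in>UNIV. pd m (\<Gamma> m k q) x) - (\<Sum>m\<in>UNIV. pd k (\<Gamma> m m q) x)
      + (\<Sum>m\<in>UNIV. \<Sum>j\<in>UNIV. \<Gamma> m m j x * \<Gamma> j k q x) - (\<Sum>m\<in>UNIV. \<Sum>j\<in>UNIV. \<Gamma> m k j x * \<Gamma> j m q x)) * W x $ q)"
    unfolding 4 5 by (simp add: distrib_right left_diff_distrib sum.distrib sum_subtractf)
  also have "\<dots> = (\<Sum>q\<in>UNIV. riem_ricci h x $ q $ k * W x $ q)"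
  proof (intro sum.cong refl arg_cong2[where f = "(*)"])
    fix q
    have s: "(\<Sum>m\<in>UNIV. pd m (\<Gamma> m k q) x) = (\<Sum>m\<in>UNIV. pd m (\<Gamma> m q k) x)"
      "(\<Sum>m\<in>UNIV. pd k (\<Gamma> m m q) x) = (\<Sum>m\<in>UNIV. pd k (\<Gamma> m q m) x)"
      "(\<Sum>m\<in>UNIV. \<Sum>j\<in>UNIV. \<Gamma> m m j x * \<Gamma> j k q x) = (\<Sum>m\<in>UNIV. \<Sum>j\<in>UNIV. \<Gamma> m m j x * \<Gamma> j q k x)"
      "(\<Sum>m\<in>UNIV. \<Sum>j\<in>UNIV. \<Gamma> m k j x * \<Gamma> j m q x) = (\<Sum>m\<in>UNIV. \<Sum>j\<in>UNIV. \<Gamma> m k j x * \<Gamma> j q m x)"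
      by (intro sum.cong refl arg_cong2[where f = "(*)"] pd_\<Gamma>_sym \<Gamma>_sym x)+
    show "(\<Sum>m\<in>UNIV. pd m (\<Gamma> m k q) x) - (\<Sum>m\<in>UNIV. pd k (\<Gamma> m m q) x)
      + (\<Sum>m\<in>UNIV. \<Sum>j\<in>UNIV. \<Gamma> m m j x * \<Gamma> j k q x) - (\<Sum>m\<in>UNIV. \<Sum>j\<in>UNIV. \<Gamma> m k j x * \<Gamma> j m q x) = riem_ricci h x $ q $ k"
      unfolding s riem_ricci_eq[OF x] ..
  qed
  finally show ?thesis .
qed

text \<open>Differentiating A W = 0 and contracting gives -A^m_k W^k_{|m}, and A is the covariant
  derivative of W. Together with the preceding identity, Ric(W,W) = -tr A^2.\<close>

lemma divA_W:
  assumes x: "x \<in> U"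
  shows "(\<Sum>k\<in>UNIV. divA k x * W x $ k) = - trA2 x"
proof -
  let ?dW = "\<lambda>i m. pd i (\<lambda>z. W z $ m) x"
  have "(\<Sum>k\<in>UNIV. pd m (A m k) x * W x $ k) = - (\<Sum>k\<in>UNIV. A m k x * ?dW m k)" for m
  proof -
    have "pd m (\<lambda>z. \<Sum>k\<in>UNIV. A m k z * W z $ k) x = pd m (\<lambda>z. 0) x"
      by (rule pd_cong[OF open_U x]) (simp add: A_W)
    then show ?thesis by (simp add: pd_simps x sum.distrib)
  qed
  then have 1: "(\<Sum>k\<in>UNIV. \<Sum>m\<in>UNIV. pd m (A m k) x * W x $ k) = - (\<Sum>m\<in>UNIV. \<Sum>k\<in>UNIV. A m k x * ?dW m k)"
    by (subst sum.swap) (simp add: sum_negf)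
  have 2: "(\<Sum>k\<in>UNIV. \<Sum>m\<in>UNIV. \<Sum>j\<in>UNIV. \<Gamma> m m j x * A j k x * W x $ k) = 0"
  proof -
    have "(\<Sum>k\<in>UNIV. \<Sum>m\<in>UNIV. \<Sum>j\<in>UNIV. \<Gamma> m m j x * A j k x * W x $ k) =
        (\<Sum>m\<in>UNIV. \<Sum>k\<in>UNIV. \<Sum>j\<in>UNIV. \<Gamma> m m j x * A j k x * W x $ k)"
      by (rule sum.swap)
    also have "\<dots> = (\<Sum>m\<in>UNIV. \<Sum>j\<in>UNIV. \<Sum>k\<in>UNIV. \<Gamma> m m j x * A j k x * W x $ k)"
      by (intro sum.cong refl sum.swap)
    also have "\<dots> = (\<Sum>m\<in>UNIV. \<Sum>j\<in>UNIV. \<Gamma> m m j x * (\<Sum>k\<in>UNIV. A j k x * W x $ k))"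
      by (simp add: sum_distrib_left mult.assoc)
    finally show ?thesis by (simp add: A_W[OF x])
  qed
  have 3: "(\<Sum>k\<in>UNIV. \<Sum>m\<in>UNIV. \<Sum>j\<in>UNIV. \<Gamma> m j k x * A j m x * W x $ k) =
      (\<Sum>m\<in>UNIV. \<Sum>k\<in>UNIV. A m k x * (\<Sum>q\<in>UNIV. \<Gamma> k m q x * W x $ q))"
  proof -
    have "(\<Sum>k\<in>UNIV. \<Sum>m\<in>UNIV. \<Sum>j\<in>UNIV. \<Gamma> m j k x * A j m x * W x $ k) =
        (\<Sum>m\<in>UNIV. \<Sum>k\<in>UNIV. \<Sum>j\<in>UNIV. \<Gamma> m j k x * A j m x * W x $ k)"
      by (rule sum.swap)
    also have "\<dots> = (\<Sum>m\<in>UNIV. \<Sum>j\<in>UNIV. \<Sum>k\<in>UNIV. \<Gamma> m j k x * A j m x * W x $ k)"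
      by (intro sum.cong refl sum.swap)
    also have "\<dots> = (\<Sum>j\<in>UNIV. \<Sum>m\<in>UNIV. \<Sum>k\<in>UNIV. \<Gamma> m j k x * A j m x * W x $ k)"
      by (rule sum.swap)
    finally show ?thesis by (simp add: sum_distrib_left mult_ac)
  qed
  have "(\<Sum>k\<in>UNIV. divA k x * W x $ k) =
      (\<Sum>k\<in>UNIV. \<Sum>m\<in>UNIV. pd m (A m k) x * W x $ k) + (\<Sum>k\<in>UNIV. \<Sum>m\<in>UNIV. \<Sum>j\<in>UNIV. \<Gamma> m m j x * A j k x * W x $ k)
      - (\<Sum>k\<in>UNIV. \<Sum>m\<in>UNIV. \<Sum>j\<in>UNIV. \<Gamma> m j k x * A j m x * W x $ k)"
    by (simp add: divA_def distrib_right left_diff_distrib sum.distrib sum_subtractf sum_distrib_right)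
  also have "\<dots> = - ((\<Sum>m\<in>UNIV. \<Sum>k\<in>UNIV. A m k x * ?dW m k)
      + (\<Sum>m\<in>UNIV. \<Sum>k\<in>UNIV. A m k x * (\<Sum>q\<in>UNIV. \<Gamma> k m q x * W x $ q)))"
    unfolding 1 2 3 by simp
  also have "\<dots> = - (\<Sum>m\<in>UNIV. \<Sum>k\<in>UNIV. A m k x * V k m x)"
    by (simp add: V_def distrib_left sum.distrib)
  finally show ?thesis by (simp add: trA2_def A_eq_V[OF x])
qed

text \<open>This is -F S^k_0, all that remains of \<open>H\<close> for a Killing field.\<close>

definition HH :: "'n \<Rightarrow> real ^ 'n \<Rightarrow> real ^ 'n \<Rightarrow> real" where
  "HH k x y = - (1 / 2 * P x y * iw x y) * A0 k x y"

lemma rats_HH: "HH k \<in> rats"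
  unfolding HH_def[abs_def] by (intro rat_mult rat_minus rat_const rat_P rats_iw rat_A0)

lemma G_killing: "(x, y) \<in> \<Omega> \<Longrightarrow> G k x y = Gbar k x y + HH k x y"
  using Wl_A0[OF \<Omega>_base[of x y]] R0_zero[OF \<Omega>_base[of x y]]
  by (simp add: G_def Ghat_def T_def p_def HH_def)

text \<open>\<open>HH\<close> has no vertical divergence: A is trace free, and S_0 is orthogonal to
  both y and W and hence annihilates the vertical differential of F. So
  \<open>spray_ricci_add\<close> applies.\<close>

lemma spray_ricci_killing:
  assumes xy: "(x, y) \<in> \<Omega>"
  shows "spray_ricci G x y = quad (riem_ricci h x) y - P x y * iw x y * (\<Sum>k\<in>UNIV. divA k x * y $ k)
    - (1 / 2 * P x y * iw x y)\<^sup>2 * trA2 x"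
proof -
  note x = \<Omega>_base[OF xy]
  define Fh where "Fh x y = 1 / 2 * P x y * iw x y" for x y
  \<comment> \<open>The vertical differential of \<open>Fh\<close>, the rational form of F.\<close>
  define f where "f k x y = yl k x y * iw x y - 1 / 2 * P x y * iw x y * iw x y * Wl k x" for k x y
  have rats_Fh: "Fh \<in> rats"
    unfolding Fh_def[abs_def] by (intro rat_mult rat_const rat_P rats_iw)
  have HH: "HH k = (\<lambda>x y. - (Fh x y * A0 k x y))" for k
    by (simp add: HH_def Fh_def fun_eq_iff)
  have dr_Fh: "dd (Inr k) Fh x y = f k x y" if "(x, y) \<in> \<Omega>" for k x y
    unfolding Fh_def[abs_def] using that
    by (simp add: rats_dd_simps rats_base dr_P d_iw dr_w) (simp add: f_def algebra_simps)
  have dl_Fh: "dd (Inl m) Fh x y = (\<Sum>k\<in>UNIV. N k m x y * f k x y) - 1 / 2 * P x y * iw x y * iw x y * wc m x y" for m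
  proof -
    have "dd (Inl m) Fh x y = dd (Inl m) P x y / 2 * iw x y - 1 / 2 * P x y * iw x y * iw x y * dd (Inl m) w x y"
      unfolding Fh_def[abs_def] using xy by (simp add: rats_dd_simps rats_base d_iw)
    also have "\<dots> = (\<Sum>k\<in>UNIV. N k m x y * (yl k x y * iw x y)) - (\<Sum>k\<in>UNIV. N k m x y * (1 / 2 * P x y * iw x y * iw x y * Wl k x))
        - 1 / 2 * P x y * iw x y * iw x y * wc m x y"
      unfolding dl_P[OF xy] dl_w[OF xy]
      by (simp add: algebra_simps sum_distrib_left sum_distrib_right add_divide_distrib sum_divide_distrib)
    finally show ?thesis by (simp add: f_def right_diff_distrib sum_subtractf)
  qed
  have f_A0: "(\<Sum>k\<in>UNIV. f k x y * A0 k x y) = 0" if "(x, y) \<in> \<Omega>" for x y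
  proof -
    have "(\<Sum>k\<in>UNIV. f k x y * A0 k x y) = iw x y * (\<Sum>k\<in>UNIV. yl k x y * A0 k x y)
        - 1 / 2 * P x y * iw x y * iw x y * s0 x y"
      by (simp add: f_def s0_def algebra_simps sum_subtractf sum_distrib_left sum_divide_distrib)
    then show ?thesis using that by (simp add: yl_A0 Wl_A0 \<Omega>_base)
  qed
  have dr_HH: "dd (Inr k) (HH m) x y = - (f k x y * A0 m x y + Fh x y * A m k x)" if "(x, y) \<in> \<Omega>" for m k x y
    unfolding HH using that by (simp add: rats_dd_simps rats_base rats_Fh dr_Fh dr_A0)
  have dvg_HH: "dvg HH x y = 0" if "(x, y) \<in> \<Omega>" for x y
    using f_A0[OF that] A_trace[OF \<Omega>_base[OF that]]
    by (simp add: dvg_def dr_HH[OF that] sum_negf sum.distrib sum_subtractf flip: sum_distrib_left)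
  have dl_HH: "dd (Inl m) (HH m) x y = - (dd (Inl m) Fh x y * A0 m x y + Fh x y * (\<Sum>k\<in>UNIV. pd m (A m k) x * y $ k))" for m
  proof -
    have "dd (Inl m) (A0 m) x y = (\<Sum>k\<in>UNIV. pd m (A m k) x * y $ k)"
      unfolding A0_def[abs_def] using xy by (simp add: rats_dd_simps rats_base)
    then show ?thesis
      unfolding HH using xy by (simp add: rats_dd_simps rats_base rats_Fh)
  qed
  let ?E = "\<Sum>m\<in>UNIV. wc m x y * A0 m x y"
  let ?D = "\<Sum>k\<in>UNIV. divA k x * y $ k"
  have dvg_Gbar: "dd (Inr k) (dvg Gbar) x y = (\<Sum>m\<in>UNIV. \<Gamma> m m k x)" for k
  proof -
    have "dd (Inr k) (dvg Gbar) x y = dd (Inr k) (\<lambda>x y. \<Sum>m\<in>UNIV. N m m x y) x y"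
      by (rule dd_cong'[OF xy]) (simp add: dvg_def dr_Gbar)
    then show ?thesis using xy by (simp add: rats_dd_simps rats_base dr_N)
  qed
  have t1: "(\<Sum>m\<in>UNIV. dd (Inl m) (HH m) x y) = - (\<Sum>m\<in>UNIV. \<Sum>k\<in>UNIV. N k m x y * f k x y * A0 m x y)
      + 1 / 2 * P x y * iw x y * iw x y * ?E - Fh x y * (\<Sum>m\<in>UNIV. \<Sum>k\<in>UNIV. pd m (A m k) x * y $ k)"
    unfolding dl_HH dl_Fh
    by (simp add: algebra_simps sum_negf sum.distrib sum_subtractf sum_distrib_left sum_distrib_right sum_divide_distrib)
  have t2: "(\<Sum>k\<in>UNIV. HH k x y * dd (Inr k) (dvg Gbar) x y) = - Fh x y * (\<Sum>m\<in>UNIV. \<Sum>k\<in>UNIV. \<Gamma> m m k x * A0 k x y)"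
  proof -
    have "(\<Sum>k\<in>UNIV. HH k x y * dd (Inr k) (dvg Gbar) x y) = - Fh x y * (\<Sum>k\<in>UNIV. \<Sum>m\<in>UNIV. \<Gamma> m m k x * A0 k x y)"
      by (simp add: dvg_Gbar HH sum_negf sum_distrib_left mult_ac)
    then show ?thesis by (subst sum.swap)
  qed
  have t3: "(\<Sum>m\<in>UNIV. \<Sum>k\<in>UNIV. dd (Inr k) (Gbar m) x y * dd (Inr m) (HH k) x y) =
      - (\<Sum>m\<in>UNIV. \<Sum>k\<in>UNIV. N k m x y * f k x y * A0 m x y) - Fh x y * (\<Sum>m\<in>UNIV. \<Sum>k\<in>UNIV. N m k x y * A k m x)"
  proof -
    have "(\<Sum>m\<in>UNIV. \<Sum>k\<in>UNIV. dd (Inr k) (Gbar m) x y * dd (Inr m) (HH k) x y) =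
        - (\<Sum>m\<in>UNIV. \<Sum>k\<in>UNIV. N m k x y * f m x y * A0 k x y) - Fh x y * (\<Sum>m\<in>UNIV. \<Sum>k\<in>UNIV. N m k x y * A k m x)"
      by (simp add: dr_Gbar[OF xy] dr_HH[OF xy] algebra_simps sum_negf sum.distrib sum_subtractf sum_distrib_left)
    also have "(\<Sum>m\<in>UNIV. \<Sum>k\<in>UNIV. N m k x y * f m x y * A0 k x y) = (\<Sum>m\<in>UNIV. \<Sum>k\<in>UNIV. N k m x y * f k x y * A0 m x y)"
      by (rule sum.swap)
    finally show ?thesis .
  qed
  have div: "?D = (\<Sum>m\<in>UNIV. \<Sum>k\<in>UNIV. pd m (A m k) x * y $ k) + (\<Sum>m\<in>UNIV. \<Sum>k\<in>UNIV. \<Gamma> m m k x * A0 k x y)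
      - (\<Sum>m\<in>UNIV. \<Sum>k\<in>UNIV. N m k x y * A k m x)"
  proof -
    have "?D = (\<Sum>k\<in>UNIV. \<Sum>m\<in>UNIV. pd m (A m k) x * y $ k) + (\<Sum>k\<in>UNIV. \<Sum>m\<in>UNIV. \<Sum>j\<in>UNIV. \<Gamma> m m j x * (A j k x * y $ k))
        - (\<Sum>k\<in>UNIV. \<Sum>m\<in>UNIV. \<Sum>j\<in>UNIV. \<Gamma> m j k x * y $ k * A j m x)"
      by (simp add: divA_def algebra_simps sum.distrib sum_subtractf sum_distrib_left sum_distrib_right)
    also have "(\<Sum>k\<in>UNIV. \<Sum>m\<in>UNIV. pd m (A m k) x * y $ k) = (\<Sum>m\<in>UNIV. \<Sum>k\<in>UNIV. pd m (A m k) x * y $ k)"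
      by (rule sum.swap)
    also have "(\<Sum>k\<in>UNIV. \<Sum>m\<in>UNIV. \<Sum>j\<in>UNIV. \<Gamma> m m j x * (A j k x * y $ k)) =
        (\<Sum>m\<in>UNIV. \<Sum>k\<in>UNIV. \<Sum>j\<in>UNIV. \<Gamma> m m j x * (A j k x * y $ k))"
      by (rule sum.swap)
    also have "\<dots> = (\<Sum>m\<in>UNIV. \<Sum>j\<in>UNIV. \<Sum>k\<in>UNIV. \<Gamma> m m j x * (A j k x * y $ k))"
      by (intro sum.cong refl sum.swap)
    also have "(\<Sum>k\<in>UNIV. \<Sum>m\<in>UNIV. \<Sum>j\<in>UNIV. \<Gamma> m j k x * y $ k * A j m x) =
        (\<Sum>m\<in>UNIV. \<Sum>k\<in>UNIV. \<Sum>j\<in>UNIV. \<Gamma> m j k x * y $ k * A j m x)"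
      by (rule sum.swap)
    also have "\<dots> = (\<Sum>m\<in>UNIV. \<Sum>j\<in>UNIV. \<Sum>k\<in>UNIV. \<Gamma> m j k x * y $ k * A j m x)"
      by (intro sum.cong refl sum.swap)
    finally show ?thesis by (simp add: A0_def N_def sum_distrib_left sum_distrib_right)
  qed
  have t4: "(\<Sum>m\<in>UNIV. \<Sum>k\<in>UNIV. dd (Inr k) (HH m) x y * dd (Inr m) (HH k) x y) =
      2 * Fh x y * iw x y * ?E + (Fh x y)\<^sup>2 * trA2 x"
  proof -
    have fA: "(\<Sum>k\<in>UNIV. f k x y * A k m x) = iw x y * wc m x y" for m
    proof -
      have "(\<Sum>k\<in>UNIV. yl k x y * A k m x) = (\<Sum>k\<in>UNIV. \<Sum>l\<in>UNIV. y $ l * (h x $ l $ k * A k m x))"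
        using h_sym[OF x] by (simp add: yl_def sum_distrib_left sum_distrib_right mult_ac)
      also have "\<dots> = (\<Sum>l\<in>UNIV. y $ l * (\<Sum>k\<in>UNIV. h x $ l $ k * A k m x))"
        by (subst sum.swap) (simp add: sum_distrib_left)
      finally have yA: "(\<Sum>k\<in>UNIV. yl k x y * A k m x) = wc m x y"
        by (simp add: h_A_sum[OF x] wc_def mult.commute)
      have "(\<Sum>k\<in>UNIV. f k x y * A k m x) = iw x y * (\<Sum>k\<in>UNIV. yl k x y * A k m x)
          - 1 / 2 * P x y * iw x y * iw x y * (\<Sum>k\<in>UNIV. Wl k x * A k m x)"
        by (simp add: f_def algebra_simps sum_subtractf sum_distrib_left sum_divide_distrib)
      then show ?thesis by (simp add: yA Wl_A[OF x])
    qed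
    have "(\<Sum>m\<in>UNIV. \<Sum>k\<in>UNIV. dd (Inr k) (HH m) x y * dd (Inr m) (HH k) x y) =
        (\<Sum>m\<in>UNIV. \<Sum>k\<in>UNIV. (f m x y * A0 m x y) * (f k x y * A0 k x y)
          + Fh x y * (A0 m x y * (f k x y * A k m x)) + Fh x y * (A0 k x y * (f m x y * A m k x))
          + (Fh x y)\<^sup>2 * (A m k x * A k m x))"
      unfolding dr_HH[OF xy] by (intro sum.cong refl) (simp add: algebra_simps power2_eq_square)
    also have "\<dots> = (\<Sum>m\<in>UNIV. f m x y * A0 m x y) * (\<Sum>k\<in>UNIV. f k x y * A0 k x y)
        + Fh x y * (\<Sum>m\<in>UNIV. A0 m x y * (\<Sum>k\<in>UNIV. f k x y * A k m x))
        + Fh x y * (\<Sum>m\<in>UNIV. \<Sum>k\<in>UNIV. A0 k x y * (f m x y * A m k x)) + (Fh x y)\<^sup>2 * trA2 x"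
      unfolding trA2_def sum_product by (simp only: sum.distrib sum_distrib_left)
    also have "(\<Sum>m\<in>UNIV. \<Sum>k\<in>UNIV. A0 k x y * (f m x y * A m k x)) = (\<Sum>k\<in>UNIV. A0 k x y * (\<Sum>m\<in>UNIV. f m x y * A m k x))"
      by (subst sum.swap) (simp only: sum_distrib_left)
    finally show ?thesis
      unfolding fA f_A0[OF xy] by (simp add: sum_distrib_left mult_ac)
  qed
  have "spray_ricci G x y = spray_ricci (\<lambda>k x y. Gbar k x y + HH k x y) x y"
    by (rule spray_ricci_cong[OF G_killing xy])
  also have "\<dots> = spray_ricci Gbar x y
      + 2 * ((\<Sum>m\<in>UNIV. dd (Inl m) (HH m) x y) + (\<Sum>k\<in>UNIV. HH k x y * dd (Inr k) (dvg Gbar) x y)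
           - (\<Sum>m\<in>UNIV. \<Sum>k\<in>UNIV. dd (Inr k) (Gbar m) x y * dd (Inr m) (HH k) x y))
      - (\<Sum>m\<in>UNIV. \<Sum>k\<in>UNIV. dd (Inr k) (HH m) x y * dd (Inr m) (HH k) x y)"
    by (rule spray_ricci_add[OF rat_Gbar rats_HH dvg_HH xy])
  \<comment> \<open>The mixed terms with \<open>N\<close> and \<open>f\<close> cancel between
    \<open>t1\<close> and \<open>t3\<close>; the \<open>?E\<close> terms from the linear and the
    quadratic part then cancel because 2 Fh = P/w.\<close>
  also have "\<dots> = quad (riem_ricci h x) y + 2 * (1 / 2 * P x y * iw x y * iw x y * ?E - Fh x y * ?D)
      - (2 * Fh x y * iw x y * ?E + (Fh x y)\<^sup>2 * trA2 x)"
    unfolding spray_ricci_Gbar[OF xy] t1 t2 t3 t4 div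
    by (simp add: algebra_simps)
  finally show ?thesis by (simp add: Fh_def algebra_simps)
qed

lemma along_f0:
  assumes xy: "(x, y) \<in> \<Omega>"
  shows "along G f0 x y = quad (hessian h \<phi> x) y + P x y * iw x y * (\<Sum>k\<in>UNIV. pd k \<phi> x * A0 k x y)"
proof -
  have dl: "dd (Inl k) f0 x y = (\<Sum>i\<in>UNIV. pd k (pd i \<phi>) x * y $ i)" for k
    unfolding f0_def[abs_def] using xy by (simp add: rats_dd_simps rats_base rat_pd_\<phi>)
  have dr: "dd (Inr k) f0 x y = pd k \<phi> x" for k
    unfolding f0_def[abs_def] using xy by (simp add: rats_dd_simps rats_base rat_pd_\<phi> mult_kronecker)
  have "(\<Sum>k\<in>UNIV. Gbar k x y * pd k \<phi> x) = 1 / 2 * (\<Sum>m\<in>UNIV. \<Sum>i\<in>UNIV. \<Sum>j\<in>UNIV. \<Gamma> m i j x * pd m \<phi> x * y $ i * y $ j)"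
    by (simp add: Gbar_def N_def sum_distrib_left sum_distrib_right sum_divide_distrib mult_ac)
  also have "(\<Sum>m\<in>UNIV. \<Sum>i\<in>UNIV. \<Sum>j\<in>UNIV. \<Gamma> m i j x * pd m \<phi> x * y $ i * y $ j) =
      (\<Sum>i\<in>UNIV. \<Sum>m\<in>UNIV. \<Sum>j\<in>UNIV. \<Gamma> m i j x * pd m \<phi> x * y $ i * y $ j)"
    by (rule sum.swap)
  also have "\<dots> = (\<Sum>i\<in>UNIV. \<Sum>j\<in>UNIV. \<Sum>m\<in>UNIV. \<Gamma> m i j x * pd m \<phi> x * y $ i * y $ j)"
    by (intro sum.cong refl sum.swap)
  finally have "2 * (\<Sum>k\<in>UNIV. Gbar k x y * pd k \<phi> x) = (\<Sum>i\<in>UNIV. \<Sum>j\<in>UNIV. \<Sum>m\<in>UNIV. \<Gamma> m i j x * pd m \<phi> x * y $ i * y $ j)"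
    by linarith
  then have G: "2 * (\<Sum>k\<in>UNIV. Gbar k x y * pd k \<phi> x) = (\<Sum>i\<in>UNIV. \<Sum>j\<in>UNIV. (\<Sum>m\<in>UNIV. \<Gamma> m i j x * pd m \<phi> x) * y $ i * y $ j)"
    by (simp only: sum_distrib_right)
  have H: "(\<Sum>k\<in>UNIV. y $ k * dd (Inl k) f0 x y) = (\<Sum>i\<in>UNIV. \<Sum>j\<in>UNIV. pd j (pd i \<phi>) x * y $ i * y $ j)"
    by (subst sum.swap) (simp add: dl sum_distrib_left mult_ac)
  have "along G f0 x y = (\<Sum>k\<in>UNIV. y $ k * dd (Inl k) f0 x y) - 2 * (\<Sum>k\<in>UNIV. Gbar k x y * pd k \<phi> x)
      + P x y * iw x y * (\<Sum>k\<in>UNIV. pd k \<phi> x * A0 k x y)"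
    by (simp add: along_def dr G_killing[OF xy] HH_def algebra_simps sum.distrib sum_subtractf sum_distrib_left)
  then show ?thesis
    unfolding G H quad_def hessian_def
    by (simp add: left_diff_distrib sum_subtractf)
qed

lemma weighted_ricci_killing:
  assumes xy: "(x, y) \<in> \<Omega>"
  shows "weighted_ricci F \<Omega> vol a c x y =
    quad (riem_ricci h x) y + a * (real CARD('n) + 1) * quad (hessian h \<phi> x) y - c * (real CARD('n) + 1)\<^sup>2 * (f0 x y)\<^sup>2
    - 2 * F x y * ((\<Sum>k\<in>UNIV. divA k x * y $ k) - a * (real CARD('n) + 1) * (\<Sum>k\<in>UNIV. pd k \<phi> x * A0 k x y))
    - (F x y)\<^sup>2 * trA2 x"
proof -
  have eq: "f0 x y + p x y - s0 x y = f0 x y" if "(x, y) \<in> \<Omega>" for x y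
    using Wl_A0[OF \<Omega>_base[OF that]] R0_zero[OF \<Omega>_base[OF that]] by (simp add: p_def)
  have "along G (\<lambda>x y. f0 x y + p x y - s0 x y) x y = along G f0 x y"
    by (rule along_cong[OF xy eq])
  moreover have "F x y = 1 / 2 * P x y * iw x y"
    unfolding F_eq[OF xy] iw_def by (simp add: field_simps)
  ultimately show ?thesis
    unfolding weighted_ricci_eq[OF xy] eq[OF xy] along_f0[OF xy] spray_ricci_killing[OF xy]
    by (simp only:) (simp add: algebra_simps power2_eq_square)
qed

text \<open>The product rule for df(W), with A as the covariant derivative of W. It exhibits the
  bracket in the formula for \<theta> as a differential.\<close>

lemma gradient_along_W:
  assumes x: "x \<in> U"
  shows "pd i (\<lambda>z. \<Sum>q\<in>UNIV. pd q \<phi> z * W z $ q) x =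
    (\<Sum>q\<in>UNIV. hessian h \<phi> x $ i $ q * W x $ q) + (\<Sum>q\<in>UNIV. pd q \<phi> x * A q i x)"
proof -
  have "(\<Sum>q\<in>UNIV. \<Sum>m\<in>UNIV. \<Gamma> m i q x * pd m \<phi> x * W x $ q) = (\<Sum>m\<in>UNIV. \<Sum>q\<in>UNIV. \<Gamma> m i q x * pd m \<phi> x * W x $ q)"
    by (rule sum.swap)
  then have "(\<Sum>q\<in>UNIV. hessian h \<phi> x $ i $ q * W x $ q) + (\<Sum>q\<in>UNIV. pd q \<phi> x * V q i x) =
      (\<Sum>q\<in>UNIV. pd q (pd i \<phi>) x * W x $ q) + (\<Sum>q\<in>UNIV. pd q \<phi> x * pd i (\<lambda>z. W z $ q) x)"
    by (simp add: hessian_def V_def algebra_simps sum.distrib sum_subtractf sum_distrib_left sum_distrib_right)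
  also have "\<dots> = pd i (\<lambda>z. \<Sum>q\<in>UNIV. pd q \<phi> z * W z $ q) x"
    by (simp add: pd_simps x smooth_\<phi> sum.distrib pd_commute[OF x smooth_\<phi>, of i])
  finally show ?thesis by (simp add: A_eq_V[OF x])
qed

end

subsection \<open>The weighted Einstein equation in a chart\<close>

text \<open>Only positive t are assumed, since the lines u + t W lie in the conic domain only for t
  > 0; infinitely many roots still suffice.\<close>

lemma quartic_coefficients_zero:
  fixes c0 c1 c2 c3 c4 :: real
  assumes "\<And>t. t > 0 \<Longrightarrow> c0 + c1 * t + c2 * t ^ 2 + c3 * t ^ 3 + c4 * t ^ 4 = 0"
  shows "c0 = 0" "c1 = 0" "c2 = 0" "c3 = 0" "c4 = 0"
proof -
  let ?q = "[:c0, c1, c2, c3, c4:]"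
  have "{0<..} \<subseteq> {t. poly ?q t = 0}"
    using assms by (auto simp: algebra_simps power_numeral_reduce)
  then have "infinite {t. poly ?q t = 0}"
    using infinite_Ioi infinite_super by blast
  then have "?q = 0"
    using poly_roots_finite by blast
  then show "c0 = 0" "c1 = 0" "c2 = 0" "c3 = 0" "c4 = 0" by simp_all
qed

lemma einstein_rearrange:
  fixes F :: real
  assumes "F \<noteq> 0" "E - 2 * F * D - F\<^sup>2 * s = m * (3 * th / F + \<sigma>) * F\<^sup>2"
  shows "E = F * (3 * m * th + 2 * D) + (m * \<sigma> + s) * F\<^sup>2"
proof -
  have "m * (3 * th / F + \<sigma>) * F\<^sup>2 = m * (3 * th * F + \<sigma> * F\<^sup>2)"
    using assms(1) by (simp add: field_simps power2_eq_square)
  with assms(2) show ?thesis by (simp add: algebra_simps)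
qed

text \<open>Two coordinates give a vector in the kernel of W_0: a coordinate vector if its
  coefficient vanishes, otherwise W_j e_i - W_i e_j.\<close>

lemma (in navigation) exists_orthogonal_to_W:
  assumes "CARD('n) \<ge> 2"
  shows "\<exists>u. u \<noteq> 0 \<and> w x u = 0"
proof -
  obtain i j :: 'n where ij: "i \<noteq> j"
    using assms card_le_Suc0_iff_eq[of "UNIV :: 'n set"] by fastforce
  show ?thesis
  proof (cases "Wl i x = 0")
    case True
    have "(axis i 1 :: real ^ 'n) \<noteq> 0" by (simp add: axis_eq_0_iff)
    moreover have "w x (axis i 1) = 0"
      using True by (simp add: w_def axis_def mult_kronecker)
    ultimately show ?thesis by blast
  next
    case False
    let ?u = "Wl j x *\<^sub>R axis i 1 - Wl i x *\<^sub>R axis j 1 :: real ^ 'n"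
    have "?u $ j \<noteq> 0" using ij False by (simp add: axis_def)
    then have "?u \<noteq> 0" by (metis zero_index)
    moreover have "w x ?u = 0"
      by (simp add: w_def axis_def algebra_simps sum_subtractf if_distrib[of "\<lambda>a. _ * a"] cong: if_cong)
    ultimately show ?thesis by blast
  qed
qed

context killing_kropina begin

definition E :: "real \<Rightarrow> real \<Rightarrow> real ^ 'n \<Rightarrow> real ^ 'n \<Rightarrow> real" where
  "E a c x y = quad (riem_ricci h x) y + a * (real CARD('n) + 1) * quad (hessian h \<phi> x) y
    - c * (real CARD('n) + 1)\<^sup>2 * (f0 x y)\<^sup>2"

definition fW :: "real ^ 'n \<Rightarrow> real" where "fW x = (\<Sum>q\<in>UNIV. pd q \<phi> x * W x $ q)"

text \<open>The prescribed value of 3(n-1) \<theta>_k.\<close>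

definition \<eta> :: "real \<Rightarrow> real \<Rightarrow> 'n \<Rightarrow> real ^ 'n \<Rightarrow> real" where
  "\<eta> a c k x = 2 * a * (real CARD('n) + 1) *
      ((\<Sum>q\<in>UNIV. hessian h \<phi> x $ k $ q * W x $ q) + (\<Sum>q\<in>UNIV. pd q \<phi> x * A q k x))
    - 2 * c * (real CARD('n) + 1)\<^sup>2 * pd k \<phi> x * fW x"

text \<open>The covector multiplying -2F in the weighted Ricci curvature.\<close>

definition \<delta> :: "real \<Rightarrow> 'n \<Rightarrow> real ^ 'n \<Rightarrow> real" where
  "\<delta> a k x = divA k x - a * (real CARD('n) + 1) * (\<Sum>q\<in>UNIV. pd q \<phi> x * A q k x)"

lemma hessian_sym: "x \<in> U \<Longrightarrow> hessian h \<phi> x $ i $ j = hessian h \<phi> x $ j $ i"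
  using pd_commute[OF _ smooth_\<phi>, of x i j] \<Gamma>_sym[of x _ i j] by (simp add: hessian_def)

lemma weighted_ricci_E:
  assumes xy: "(x, y) \<in> \<Omega>"
  shows "weighted_ricci F \<Omega> vol a c x y = E a c x y - 2 * F x y * (\<Sum>k\<in>UNIV. \<delta> a k x * y $ k) - (F x y)\<^sup>2 * trA2 x"
proof -
  have "(\<Sum>q\<in>UNIV. pd q \<phi> x * A0 q x y) = (\<Sum>q\<in>UNIV. \<Sum>k\<in>UNIV. pd q \<phi> x * A q k x * y $ k)"
    by (simp add: A0_def sum_distrib_left mult.assoc)
  also have "\<dots> = (\<Sum>k\<in>UNIV. (\<Sum>q\<in>UNIV. pd q \<phi> x * A q k x) * y $ k)"
    by (subst sum.swap) (simp add: sum_distrib_right)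
  finally have "(\<Sum>k\<in>UNIV. (\<Sum>q\<in>UNIV. pd q \<phi> x * A q k x) * y $ k) = (\<Sum>q\<in>UNIV. pd q \<phi> x * A0 q x y)" ..
  then have "(\<Sum>k\<in>UNIV. \<delta> a k x * y $ k) = (\<Sum>k\<in>UNIV. divA k x * y $ k) - a * (real CARD('n) + 1) * (\<Sum>q\<in>UNIV. pd q \<phi> x * A0 q x y)"
    unfolding \<delta>_def left_diff_distrib sum_subtractf by (simp add: mult.assoc flip: sum_distrib_left)
  then show ?thesis
    by (simp add: weighted_ricci_killing[OF xy] E_def)
qed

lemma \<delta>_W:
  assumes x: "x \<in> U"
  shows "(\<Sum>k\<in>UNIV. \<delta> a k x * W x $ k) = - trA2 x"
proof -
  have "(\<Sum>k\<in>UNIV. (\<Sum>q\<in>UNIV. pd q \<phi> x * A q k x) * W x $ k) = (\<Sum>q\<in>UNIV. pd q \<phi> x * (\<Sum>k\<in>UNIV. A q k x * W x $ k))"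
    unfolding sum_distrib_left sum_distrib_right by (subst sum.swap) (simp add: mult.assoc)
  also have "\<dots> = 0" by (simp add: A_W[OF x])
  finally have "(\<Sum>k\<in>UNIV. (\<Sum>q\<in>UNIV. pd q \<phi> x * A q k x) * W x $ k) = 0" .
  then have "(\<Sum>k\<in>UNIV. \<delta> a k x * W x $ k) = (\<Sum>k\<in>UNIV. divA k x * W x $ k)"
    by (simp add: \<delta>_def left_diff_distrib sum_subtractf mult.assoc flip: sum_distrib_left)
  then show ?thesis by (simp add: divA_W[OF x])
qed

text \<open>Polarisation turns the condition on quadratic forms into one on symmetric tensors;
  contracting it with W and using div A = Ric(W, .) expresses div A through the other data.\<close>

lemma \<delta>_eq:
  assumes x: "x \<in> U" and E: "\<And>y. E a c x y = (real CARD('n) - 1) * \<mu> * P x y"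
  shows "\<delta> a k x = (real CARD('n) - 1) * \<mu> * Wl k x - 1 / 2 * \<eta> a c k x"
proof -
  let ?n = "real CARD('n)"
  define M where "M = (\<chi> i j. riem_ricci h x $ i $ j + a * (?n + 1) * hessian h \<phi> x $ i $ j
    - c * (?n + 1)\<^sup>2 * (pd i \<phi> x * pd j \<phi> x) - (?n - 1) * \<mu> * h x $ i $ j)"
  have f: "(\<Sum>i\<in>UNIV. \<Sum>j\<in>UNIV. c * (?n + 1)\<^sup>2 * (pd i \<phi> x * pd j \<phi> x) * y $ i * y $ j) = c * (?n + 1)\<^sup>2 * (f0 x y)\<^sup>2" for y
    by (simp add: f0_def power2_eq_square sum_product sum_distrib_left mult_ac)
  have "quad M y = E a c x y - (?n - 1) * \<mu> * P x y" for y
    unfolding E_def f[symmetric] M_def P_def quad_def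
    by (simp add: algebra_simps sum.distrib sum_subtractf sum_distrib_left)
  then have "quad M y = 0" for y by (simp add: E)
  then have "M $ q $ k = 0" for q
    using riem_ricci_sym[OF x] hessian_sym[OF x] h_sym[OF x]
    by (intro symmetric_quad_zero) (simp_all add: M_def mult.commute)
  then have ric: "riem_ricci h x $ q $ k = (?n - 1) * \<mu> * h x $ q $ k - a * (?n + 1) * hessian h \<phi> x $ q $ k
      + c * (?n + 1)\<^sup>2 * (pd q \<phi> x * pd k \<phi> x)" for q
    by (simp add: M_def algebra_simps)
  have "divA k x = (?n - 1) * \<mu> * (\<Sum>q\<in>UNIV. h x $ q $ k * W x $ q) - a * (?n + 1) * (\<Sum>q\<in>UNIV. hessian h \<phi> x $ q $ k * W x $ q)
      + c * (?n + 1)\<^sup>2 * pd k \<phi> x * fW x"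
    unfolding divA_eq_ricci[OF x] ric fW_def
    by (simp add: algebra_simps sum.distrib sum_subtractf sum_distrib_left)
  moreover have "(\<Sum>q\<in>UNIV. h x $ q $ k * W x $ q) = Wl k x"
    unfolding Wl_eq by (intro sum.cong refl arg_cong2[where f = "(*)"] h_sym x)
  moreover have "(\<Sum>q\<in>UNIV. hessian h \<phi> x $ q $ k * W x $ q) = (\<Sum>q\<in>UNIV. hessian h \<phi> x $ k $ q * W x $ q)"
    by (intro sum.cong refl arg_cong2[where f = "(*)"] hessian_sym x)
  ultimately show ?thesis
    by (simp add: \<delta>_def \<eta>_def algebra_simps)
qed

text \<open>With \<delta> = (n-1)(\<mu> W - 3/2 \<theta>), the \<mu> terms cancel because P = 2wF,
  which leaves the \<theta> term. Evaluating \<delta> at W gives -tr A^2 = (n-1)\<sigma>, the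
  coefficient of F^2.\<close>

lemma condition_imp_einstein:
  assumes x: "x \<in> U"
    and E: "\<And>y. E a c x y = (real CARD('n) - 1) * \<mu> * P x y"
    and \<theta>: "\<And>k. 3 * (real CARD('n) - 1) * \<theta> $ k = \<eta> a c k x"
    and \<sigma>: "\<sigma> = \<mu> - 3 / 2 * (\<theta> \<bullet> W x)" and xy: "(x, y) \<in> \<Omega>"
  shows "weighted_ricci F \<Omega> vol a c x y = (real CARD('n) - 1) * (3 * (\<theta> \<bullet> y) / F x y + \<sigma>) * (F x y)\<^sup>2"
proof -
  let ?n = "real CARD('n)"
  have \<delta>: "(\<Sum>k\<in>UNIV. \<delta> a k x * y $ k) = (?n - 1) * (\<mu> * w x y - 3 / 2 * (\<theta> \<bullet> y))" for y
  proof -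
    have "(\<Sum>k\<in>UNIV. \<delta> a k x * y $ k) = (\<Sum>k\<in>UNIV. (?n - 1) * (\<mu> * (Wl k x * y $ k) - 3 / 2 * (\<theta> $ k * y $ k)))"
      unfolding \<delta>_eq[OF x E] \<theta>[symmetric] by (intro sum.cong refl) (simp add: field_simps)
    then show ?thesis
      by (simp add: w_def inner_vec_def sum_subtractf flip: sum_distrib_left sum_divide_distrib)
  qed
  have tr: "- trA2 x = (?n - 1) * \<sigma>"
    using \<delta>[of "W x"] \<delta>_W[OF x, of a] by (simp add: w_W[OF x] \<sigma>)
  have FP: "F x y \<noteq> 0" "P x y = 2 * w x y * F x y"
    using P_pos[OF xy] w_pos[OF xy] by (simp_all add: F_eq[OF xy])
  have ricci: "weighted_ricci F \<Omega> vol a c x y = (?n - 1) * \<mu> * P x y - 2 * F x y * ((?n - 1) * (\<mu> * w x y - 3 / 2 * (\<theta> \<bullet> y)))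
      + (F x y)\<^sup>2 * (- trA2 x)"
    unfolding weighted_ricci_E[OF xy] E \<delta> by simp
  have rhs: "(?n - 1) * (3 * (\<theta> \<bullet> y) / F x y + \<sigma>) * (F x y)\<^sup>2 =
      (?n - 1) * (3 * (\<theta> \<bullet> y) * F x y + \<sigma> * (F x y)\<^sup>2)"
    using FP(1) by (simp add: field_simps power2_eq_square)
  show ?thesis
    unfolding rhs unfolding ricci tr FP(2) by (simp add: field_simps)
qed

text \<open>The equation reads E = F l + \<kappa> F^2 with l linear and \<kappa> constant in y. On u
  + t W with u orthogonal to W one has w = t and F = (k + t^2)/(2t); multiplication by 4 t^2 makes
  it a quartic identity in t.\<close>

lemma einstein_imp_condition:
  assumes x: "x \<in> U" and n: "CARD('n) \<ge> 2"
    and einstein: "\<And>y. (x, y) \<in> \<Omega> \<Longrightarrow> weighted_ricci F \<Omega> vol a c x y =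
      (real CARD('n) - 1) * (3 * (\<theta> \<bullet> y) / F x y + \<sigma>) * (F x y)\<^sup>2"
  shows "E a c x y = (real CARD('n) - 1) * (\<sigma> + 3 / 2 * (\<theta> \<bullet> W x)) * P x y"
    and "(real CARD('n) - 1) * \<sigma> = - trA2 x"
    and "3 * (real CARD('n) - 1) * \<theta> $ k = \<eta> a c k x"
proof -
  let ?n = "real CARD('n)"
  define l where "l y = 3 * (?n - 1) * (\<theta> \<bullet> y) + 2 * (\<Sum>k\<in>UNIV. \<delta> a k x * y $ k)" for y
  define \<kappa> where "\<kappa> = (?n - 1) * \<sigma> + trA2 x"
  have l_lin: "l (u + t *\<^sub>R v) = l u + t * l v" for u v t
    by (simp add: l_def inner_add_right algebra_simps sum.distrib sum_distrib_left)
  define b where "b u = (\<Sum>i\<in>UNIV. \<Sum>j\<in>UNIV. riem_ricci h x $ i $ j * (u $ i * W x $ j + W x $ i * u $ j))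
      + a * (?n + 1) * (\<Sum>i\<in>UNIV. \<Sum>j\<in>UNIV. hessian h \<phi> x $ i $ j * (u $ i * W x $ j + W x $ i * u $ j))
      - c * (?n + 1)\<^sup>2 * (2 * f0 x u * f0 x (W x))" for u
  have quad_line: "quad M (u + t *\<^sub>R v) = quad M u + t * (\<Sum>i\<in>UNIV. \<Sum>j\<in>UNIV. M $ i $ j * (u $ i * v $ j + v $ i * u $ j)) + t\<^sup>2 * quad M v"
    for M :: "real ^ 'n ^ 'n" and u v t
    by (simp add: quad_def algebra_simps sum.distrib sum_distrib_left power2_eq_square)
  have f_line: "f0 x (u + t *\<^sub>R v) = f0 x u + t * f0 x v" for u v t
    by (simp add: f0_def algebra_simps sum.distrib sum_distrib_left)
  have E_line: "E a c x (u + t *\<^sub>R W x) = E a c x u + t * b u + t\<^sup>2 * E a c x (W x)" for u t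
    unfolding E_def b_def quad_line f_line by (simp add: algebra_simps power2_eq_square)
  have w_line': "w x (u + t *\<^sub>R W x) = w x u + t" for u t
  proof -
    have "w x (u + t *\<^sub>R W x) = w x u + t * w x (W x)"
      by (simp add: w_def algebra_simps sum.distrib sum_distrib_left)
    then show ?thesis by (simp add: w_W[OF x])
  qed
  have P_line': "P x (u + t *\<^sub>R W x) = P x u + t\<^sup>2" if u: "w x u = 0" for u t
  proof -
    have "(\<Sum>i\<in>UNIV. \<Sum>j\<in>UNIV. h x $ i $ j * (u $ i * W x $ j + W x $ i * u $ j)) =
        (\<Sum>i\<in>UNIV. Wl i x * u $ i) + (\<Sum>i\<in>UNIV. yl i x u * W x $ i)"
      by (simp add: Wl_eq yl_def algebra_simps sum.distrib sum_distrib_left)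
    then show ?thesis
      using u contractions(3)[OF x, of u] W_unit[OF x] by (simp add: P_def quad_line w_def)
  qed
  have main: "\<kappa> = 0 \<and> l u = 0 \<and> E a c x u = l (W x) / 2 * P x u \<and> b u = 0 \<and> E a c x (W x) = l (W x) / 2"
    if u: "w x u = 0" "u \<noteq> 0" for u
  proof -
    define k where "k = P x u"
    have k: "k > 0" using h_pos[OF x u(2)] by (simp add: k_def P_def)
    \<comment> \<open>As k > 0, the constant term gives \<kappa> = 0 and the linear one l(u) = 0;
      the cubic term then kills the mixed part \<open>b\<close>, and the even ones give E on u and
      on W.\<close>
    have "(\<kappa> * k\<^sup>2) + (2 * k * l u) * t + (2 * k * l (W x) + 2 * \<kappa> * k - 4 * E a c x u) * t ^ 2
        + (2 * l u - 4 * b u) * t ^ 3 + (2 * l (W x) + \<kappa> - 4 * E a c x (W x)) * t ^ 4 = 0" if t: "t > 0" for t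
    proof -
      let ?y = "u + t *\<^sub>R W x"
      have xy: "(x, ?y) \<in> \<Omega>"
        using x t u by (simp add: \<Omega>_def w_line')
      have Fy: "F x ?y = (k + t\<^sup>2) / (2 * t)"
        using F_eq[OF xy] by (simp add: P_line'[OF u(1)] w_line' u k_def)
      have Fpos: "F x ?y \<noteq> 0"
        unfolding Fy using k t by (simp add: add_pos_nonneg order_less_imp_not_eq2)
      have "E a c x ?y = F x ?y * l ?y + \<kappa> * (F x ?y)\<^sup>2"
        using einstein[OF xy] unfolding weighted_ricci_E[OF xy] l_def \<kappa>_def
        by (rule einstein_rearrange[OF Fpos])
      then have "4 * t\<^sup>2 * E a c x ?y = 2 * t * (2 * t * F x ?y) * l ?y + \<kappa> * (2 * t * F x ?y)\<^sup>2"
        by (simp add: algebra_simps power2_eq_square)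
      also have "2 * t * F x ?y = k + t\<^sup>2"
        unfolding Fy using t by simp
      finally have "4 * t\<^sup>2 * E a c x ?y = 2 * t * (k + t\<^sup>2) * l ?y + \<kappa> * (k + t\<^sup>2)\<^sup>2" .
      then show ?thesis
        unfolding E_line l_lin by (simp add: algebra_simps power_numeral_reduce)
    qed
    note coeffs = quartic_coefficients_zero[OF this]
    show ?thesis
      using coeffs k by (auto simp: k_def field_simps)
  qed
  obtain u where u: "u \<noteq> 0" "w x u = 0"
    using exists_orthogonal_to_W[OF n, of x] by blast
  have \<kappa>: "\<kappa> = 0" and EW: "E a c x (W x) = l (W x) / 2"
    using main[OF u(2,1)] by auto
  from \<kappa> show tr: "(?n - 1) * \<sigma> = - trA2 x" by (simp add: \<kappa>_def)
  \<comment> \<open>The contraction of \<delta> with W is -tr A^2, which is (n-1)\<sigma> by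
    \<kappa> = 0; so l(W)/2 is (n-1)\<mu> for the asserted \<mu>.\<close>
  have lW: "l (W x) / 2 = (?n - 1) * (\<sigma> + 3 / 2 * (\<theta> \<bullet> W x))"
    unfolding l_def \<delta>_W[OF x] tr[symmetric] by (simp add: algebra_simps add_divide_distrib diff_divide_distrib)
  have decomp: "w x (y - w x y *\<^sub>R W x) = 0" "y = (y - w x y *\<^sub>R W x) + w x y *\<^sub>R W x" for y
    using w_line'[of y "- w x y"] by simp_all
  have E: "E a c x y = l (W x) / 2 * P x y" for y
  proof (cases "y - w x y *\<^sub>R W x = 0")
    case True
    have Z: "E a c x 0 = 0" "b 0 = 0" "P x 0 = 0" "w x 0 = 0"
      by (simp_all add: E_def b_def quad_def f0_def P_def w_def)
    have "y = 0 + w x y *\<^sub>R W x" using True by simp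
    then have "E a c x y = (w x y)\<^sup>2 * E a c x (W x)" "P x y = (w x y)\<^sup>2"
      using E_line[of 0 "w x y"] P_line'[OF Z(4), of "w x y"] by (simp_all add: Z)
    then show ?thesis by (simp add: EW)
  next
    case False
    let ?u = "y - w x y *\<^sub>R W x"
    have "E a c x y = E a c x ?u + w x y * b ?u + (w x y)\<^sup>2 * E a c x (W x)"
      using E_line[of ?u "w x y"] by simp
    moreover have "P x y = P x ?u + (w x y)\<^sup>2"
      using P_line'[OF decomp(1), of y "w x y"] by simp
    ultimately show ?thesis
      using main[OF decomp(1) False] by (simp add: algebra_simps)
  qed
  then show "E a c x y = (?n - 1) * (\<sigma> + 3 / 2 * (\<theta> \<bullet> W x)) * P x y"
    unfolding lW by simp
  \<comment> \<open>Being zero on the kernel of W_0, the form l is a multiple of W_0; comparing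
    components on coordinate vectors then isolates \<theta>.\<close>
  have l: "l y = w x y * l (W x)" for y
  proof -
    let ?u = "y - w x y *\<^sub>R W x"
    have "l ?u = 0"
      using main[OF decomp(1)] by (cases "?u = 0") (auto simp: l_def)
    then show ?thesis
      using l_lin[of ?u "w x y" "W x"] by simp
  qed
  have "l (axis k 1) = 3 * (?n - 1) * \<theta> $ k + 2 * \<delta> a k x"
  proof -
    have "\<theta> \<bullet> axis k 1 = \<theta> $ k" by (simp add: inner_axis)
    moreover have "(\<Sum>q\<in>UNIV. \<delta> a q x * (axis k 1 :: real ^ 'n) $ q) = \<delta> a k x"
      by (simp add: axis_def mult_kronecker)
    ultimately show ?thesis by (simp add: l_def)
  qed
  moreover have "w x (axis k 1) = Wl k x"
    by (simp add: w_def axis_def mult_kronecker)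
  moreover have "\<delta> a k x = l (W x) / 2 * Wl k x - 1 / 2 * \<eta> a c k x"
    using \<delta>_eq[OF x, of a c "\<sigma> + 3 / 2 * (\<theta> \<bullet> W x)" k] E unfolding lW by simp
  ultimately show "3 * (?n - 1) * \<theta> $ k = \<eta> a c k x"
    using l[of "axis k 1"] by (simp add: algebra_simps)
qed

end

subsection \<open>Change of charts\<close>

lemma pd_chain:
  fixes T :: "real ^ 'n::finite \<Rightarrow> real ^ 'n"
  assumes T: "\<And>i. (\<lambda>z. T z $ i) differentiable at x" and u: "u differentiable at (T x)"
  shows "pd i (\<lambda>z. u (T z)) x = (\<Sum>j\<in>UNIV. pd j u (T x) * pd i (\<lambda>z. T z $ j) x)"
proof -
  obtain T' where T': "\<And>j. ((\<lambda>z. T z $ j) has_derivative T' j) (at x)"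
    using T unfolding differentiable_def by metis
  obtain u' where u': "(u has_derivative u') (at (T x))"
    using u unfolding differentiable_def by blast
  have "(T has_derivative (\<lambda>v. \<chi> j. T' j v)) (at x)"
    unfolding has_derivative_componentwise_within[of T]
    by (auto simp: Basis_vec_real inner_axis T')
  from has_derivative_compose[OF this u']
  have "pd i (\<lambda>z. u (T z)) x = u' (\<chi> j. T' j (axis i 1))"
    by (rule pd_eq_derivative)
  also have "\<dots> = (\<Sum>j\<in>UNIV. pd j u (T x) * T' j (axis i 1))"
    by (simp add: derivative_eq_sum_pd[OF u'])
  finally show ?thesis
    by (simp add: pd_eq_derivative[OF T'])
qed

locale kropina_atlas =
  fixes \<A> :: "('m::{t2_space, second_countable_topology}, 'n::finite) chart set"
    and al :: "('m, 'n) chart \<Rightarrow> real ^ 'n \<Rightarrow> real ^ 'n ^ 'n"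
    and be :: "('m, 'n) chart \<Rightarrow> real ^ 'n \<Rightarrow> real ^ 'n"
    and h :: "('m, 'n) chart \<Rightarrow> real ^ 'n \<Rightarrow> real ^ 'n ^ 'n"
    and W :: "('m, 'n) chart \<Rightarrow> real ^ 'n \<Rightarrow> real ^ 'n"
  assumes atlas: "smooth_atlas \<A>" and data: "kropina_data \<A> al be" and nav: "(h, W) = navigation_data al be"
begin

lemma open_img: "C \<in> \<A> \<Longrightarrow> open (img C)"
  using atlas by (simp add: smooth_atlas_def)

lemma pt_in: "x \<in> img C \<Longrightarrow> pt C x \<in> fst C"
  unfolding pt_def img_def by (rule inv_into_into)

lemma snd_pt: "x \<in> img C \<Longrightarrow> snd C (pt C x) = x"
  unfolding pt_def img_def by (rule f_inv_into_f)

lemma pt_snd: "C \<in> \<A> \<Longrightarrow> q \<in> fst C \<Longrightarrow> pt C (snd C q) = q"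
  using atlas by (auto simp: smooth_atlas_def homeomorphism_def)

lemma img_snd: "q \<in> fst C \<Longrightarrow> snd C q \<in> img C"
  by (simp add: img_def)

text \<open>Written as a preimage under the continuous map \<open>pt C\<close>, the overlap is
  visibly open.\<close>

lemma overlap_eq:
  assumes "C \<in> \<A>"
  shows "overlap C D = img C \<inter> pt C -` fst D"
proof (intro equalityI subsetI)
  fix x assume "x \<in> overlap C D"
  then obtain q where "q \<in> fst C" "q \<in> fst D" "x = snd C q"
    by (auto simp: overlap_def)
  then show "x \<in> img C \<inter> pt C -` fst D"
    by (simp add: img_snd pt_snd[OF assms])
next
  fix x assume "x \<in> img C \<inter> pt C -` fst D"
  then have "snd C (pt C x) \<in> overlap C D"
    unfolding overlap_def by (intro imageI) (simp add: pt_in)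
  with \<open>x \<in> img C \<inter> pt C -` fst D\<close> show "x \<in> overlap C D"
    by (simp add: snd_pt)
qed

lemma open_overlap:
  assumes "C \<in> \<A>" "D \<in> \<A>"
  shows "open (overlap C D)"
proof -
  have "continuous_on (img C) (pt C)" "open (fst D)"
    using atlas assms by (auto simp: smooth_atlas_def homeomorphism_def)
  then show ?thesis
    unfolding overlap_eq[OF assms(1)] using open_img[OF assms(1)]
    by (intro continuous_open_preimage)
qed

lemma transition_in:
  assumes "C \<in> \<A>" "D \<in> \<A>" "x \<in> overlap C D"
  shows "x \<in> img C" "transition C D x \<in> img D" "pt D (transition C D x) = pt C x"
  using assms by (auto simp: overlap_eq transition_def img_snd pt_snd)

lemma smooth_transition: "C \<in> \<A> \<Longrightarrow> D \<in> \<A> \<Longrightarrow> smooth_on (overlap C D) (\<lambda>x. transition C D x $ i)"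
  using atlas by (simp add: smooth_atlas_def)

section \<open>Navigation data in charts and their transformation law\<close>

lemma al_props:
  assumes "C \<in> \<A>"
  shows "smooth_on (img C) (\<lambda>x. al C x $ i $ j)"
    and "x \<in> img C \<Longrightarrow> transpose (al C x) = al C x"
    and "x \<in> img C \<Longrightarrow> y \<noteq> 0 \<Longrightarrow> quad (al C x) y > 0"
  using data assms by (auto simp: kropina_data_def riemannian_metric_def)

lemma det_al_pos: "C \<in> \<A> \<Longrightarrow> x \<in> img C \<Longrightarrow> det (al C x) > 0"
  using al_props by (intro det_posdef_pos)

lemma be_props:
  assumes "C \<in> \<A>"
  shows "smooth_on (img C) (\<lambda>x. be C x $ i)" and "x \<in> img C \<Longrightarrow> be C x \<noteq> 0"
  using data assms by (auto simp: kropina_data_def one_form_def)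

definition b2 :: "('m, 'n) chart \<Rightarrow> real ^ 'n \<Rightarrow> real" where
  "b2 C x = be C x \<bullet> raise (al C x) (be C x)"

lemma h_eq: "h C x = (4 / b2 C x) *\<^sub>R al C x" and W_eq: "W C x = (1 / 2) *\<^sub>R raise (al C x) (be C x)"
  using nav by (simp_all add: navigation_data_def b2_def)

lemma al_raise:
  assumes "C \<in> \<A>" "x \<in> img C"
  shows "al C x *v raise (al C x) \<omega> = \<omega>"
  using matrix_inv_right_left(1)[of "al C x"] det_al_pos[OF assms]
  by (simp add: raise_def matrix_vector_mul_assoc)

lemma b2_pos:
  assumes "C \<in> \<A>" "x \<in> img C"
  shows "b2 C x > 0"
proof -
  let ?v = "raise (al C x) (be C x)"
  have "?v \<noteq> 0"
    using al_raise[OF assms, of "be C x"] be_props(2)[OF assms] by auto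
  then have "quad (al C x) ?v > 0" by (rule al_props(3)[OF assms])
  then show ?thesis
    by (simp add: b2_def quad_inner al_raise[OF assms] inner_commute)
qed

lemma quad_scaleR: "quad (k *\<^sub>R M) y = k * quad M y"
  by (simp add: quad_def sum_distrib_left mult.assoc)

lemma smooth_raise:
  assumes "C \<in> \<A>"
  shows "smooth_on (img C) (\<lambda>x. raise (al C x) (be C x) $ i)"
  unfolding raise_def matrix_vector_mult_def vec_lambda_beta
  by (intro smooth_on_sum smooth_on_mult smooth_on_matrix_inv open_img assms al_props be_props)
    (use det_al_pos[OF assms] in force)

lemma navigation_chart:
  assumes C: "C \<in> \<A>"
  shows "navigation (img C) (h C) (W C)"
proof
  have b2: "smooth_on (img C) (\<lambda>x. b2 C x)"
    unfolding b2_def inner_vec_def inner_real_def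
    by (intro smooth_on_sum smooth_on_mult smooth_raise be_props open_img C)
  show "smooth_on (img C) (\<lambda>x. h C x $ i $ j)" for i j
  proof -
    have "smooth_on (img C) (\<lambda>x. 4 / b2 C x * al C x $ i $ j)"
      using b2_pos[OF C]
      by (intro smooth_on_mult smooth_on_divide smooth_on_const b2 al_props open_img C) force
    then show ?thesis by (simp add: h_eq)
  qed
  show "smooth_on (img C) (\<lambda>x. W C x $ i)" for i
  proof -
    have "smooth_on (img C) (\<lambda>x. 1 / 2 * raise (al C x) (be C x) $ i)"
      by (intro smooth_on_mult smooth_on_const smooth_raise open_img C)
    then show ?thesis by (simp add: W_eq)
  qed
  show "transpose (h C x) = h C x" if "x \<in> img C" for x
    using al_props(2)[OF C that] by (simp add: h_eq transpose_def vec_eq_iff)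
  show "quad (h C x) y > 0" if "x \<in> img C" "y \<noteq> 0" for x y
    using al_props(3)[OF C that] b2_pos[OF C that(1)] by (simp add: h_eq quad_scaleR)
  show "quad (h C x) (W C x) = 1" if "x \<in> img C" for x
  proof -
    have "quad (al C x) (raise (al C x) (be C x)) = b2 C x"
      by (simp add: quad_inner al_raise[OF C that] b2_def inner_commute)
    moreover have "quad (al C x) (W C x) = 1 / 4 * quad (al C x) (raise (al C x) (be C x))"
      by (simp add: quad_def W_eq sum_distrib_left mult_ac)
    ultimately show ?thesis
      using b2_pos[OF C that] by (simp add: h_eq quad_scaleR)
  qed
qed (rule open_img[OF C])

text \<open>W is the unique solution of al W = be/2, an equation between covariant objects; solving
  it in both charts shows that W is contravariant.\<close>

lemma W_transition:
  assumes "C \<in> \<A>" "D \<in> \<A>" "x \<in> overlap C D"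
  shows "W D (transition C D x) = jac (transition C D) x *v W C x"
proof -
  let ?J = "jac (transition C D) x" and ?y = "transition C D x"
  note x = transition_in(1)[OF assms] and y = transition_in(2)[OF assms]
  have al: "al C x = transpose ?J ** al D ?y ** ?J" and be: "be C x = transpose ?J *v be D ?y"
    using data assms by (auto simp: kropina_data_def riemannian_metric_def one_form_def)
  \<comment> \<open>Invertibility of the Jacobian is read off from the transformation law of
    \<open>al\<close>, so the inverse transition map need not be differentiated.\<close>
  have "det ?J \<noteq> 0"
    using det_al_pos[OF assms(1) x] unfolding al by (auto simp: det_mul)
  then have J: "?J ** matrix_inv ?J = mat 1" by (rule matrix_inv_right_left(1))
  define X where "X = matrix_inv ?J *v W D ?y"
  have JX: "?J *v X = W D ?y"
    by (simp add: X_def matrix_vector_mul_assoc J)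
  have "al C x *v X = transpose ?J *v (al D ?y *v (?J *v X))"
    unfolding al by (simp only: matrix_vector_mul_assoc matrix_mul_assoc)
  also have "\<dots> = (1 / 2) *\<^sub>R be C x"
    unfolding JX W_eq matrix_vector_mult_scaleR al_raise[OF assms(2) y] be ..
  also have "\<dots> = al C x *v W C x"
    unfolding W_eq matrix_vector_mult_scaleR al_raise[OF assms(1) x] ..
  finally have "matrix_inv (al C x) *v (al C x *v X) = matrix_inv (al C x) *v (al C x *v W C x)" by simp
  then have "X = W C x"
    using matrix_inv_right_left(2)[of "al C x"] det_al_pos[OF assms(1) x]
    by (simp add: matrix_vector_mul_assoc)
  with JX show ?thesis by simp
qed

text \<open>The function \<open>\<omega>(W)\<close>, evaluated in an arbitrary chart around the point.\<close>

definition contract :: "(('m, 'n) chart \<Rightarrow> real ^ 'n \<Rightarrow> real ^ 'n) \<Rightarrow> 'm \<Rightarrow> real" where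
  "contract \<omega> q = (let C = SOME C. C \<in> \<A> \<and> q \<in> fst C in \<omega> C (snd C q) \<bullet> W C (snd C q))"

text \<open>The pairing of a covariant with a contravariant object does not depend on the chart, so
  the chart chosen inside \<open>contract\<close> is irrelevant.\<close>

lemma contract_eq:
  assumes "one_form \<A> \<omega>" "C \<in> \<A>" "x \<in> img C"
  shows "contract \<omega> (pt C x) = \<omega> C x \<bullet> W C x"
proof -
  define D where "D = (SOME D. D \<in> \<A> \<and> pt C x \<in> fst D)"
  have D: "D \<in> \<A> \<and> pt C x \<in> fst D"
    unfolding D_def
    by (rule someI[of "\<lambda>D. D \<in> \<A> \<and> pt C x \<in> fst D" C]) (simp add: assms pt_in)
  then have x: "x \<in> overlap C D"
    using assms by (simp add: overlap_eq)
  have "\<omega> C x = transpose (jac (transition C D) x) *v \<omega> D (transition C D x)"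
    using assms(1,2) D x unfolding one_form_def by blast
  then have "\<omega> C x \<bullet> W C x = (transpose (jac (transition C D) x) *v \<omega> D (transition C D x)) \<bullet> W C x"
    by simp
  also have "\<dots> = \<omega> D (transition C D x) \<bullet> (jac (transition C D) x *v W C x)"
    by (simp add: dot_lmul_matrix)
  also have "\<dots> = \<omega> D (transition C D x) \<bullet> W D (transition C D x)"
    using D assms(2) x by (simp add: W_transition)
  finally show ?thesis
    by (simp add: contract_def Let_def D_def transition_def)
qed

lemma smooth_contract:
  assumes "one_form \<A> \<omega>"
  shows "smooth_function \<A> (contract \<omega>)"
  unfolding smooth_function_def
proof
  fix C assume C: "C \<in> \<A>"
  interpret navigation "img C" "h C" "W C" by (rule navigation_chart[OF C])
  have "smooth_on (img C) (\<lambda>x. \<Sum>i\<in>UNIV. \<omega> C x $ i * W C x $ i)"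
    using assms C by (intro smooth_on_sum smooth_on_mult smooth_W open_U) (simp add: one_form_def)
  then show "smooth_on (img C) (contract \<omega> \<circ> pt C)"
    by (rule smooth_on_cong[OF open_U, rotated]) (simp add: contract_eq[OF assms C] inner_vec_def)
qed

section \<open>Global 1-forms and functions\<close>

lemma one_form_df:
  assumes f: "smooth_function \<A> f"
  shows "one_form \<A> (\<lambda>C. df (f \<circ> pt C))"
  unfolding one_form_def
proof (intro conjI ballI allI)
  fix C i assume "C \<in> \<A>"
  then have "smooth_on (img C) (pd i (f \<circ> pt C))"
    using f by (intro smooth_on_pd) (simp add: smooth_function_def)
  then show "smooth_on (img C) (\<lambda>x. df (f \<circ> pt C) x $ i)"
    by (simp add: df_def)
next
  fix C D x assume CD: "C \<in> \<A>" "D \<in> \<A>" "x \<in> overlap C D"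
  let ?T = "transition C D"
  have "pd i (f \<circ> pt C) x = (\<Sum>j\<in>UNIV. pd j (f \<circ> pt D) (?T x) * pd i (\<lambda>z. ?T z $ j) x)" for i
  proof -
    have "pd i (f \<circ> pt C) x = pd i (\<lambda>z. (f \<circ> pt D) (?T z)) x"
      using CD by (intro pd_cong[OF open_overlap]) (auto simp: transition_in)
    also have "\<dots> = (\<Sum>j\<in>UNIV. pd j (f \<circ> pt D) (?T x) * pd i (\<lambda>z. ?T z $ j) x)"
    proof (rule pd_chain)
      show "(\<lambda>z. ?T z $ j) differentiable at x" for j
        by (rule smooth_on_differentiable[OF open_overlap[OF CD(1,2)] CD(3) smooth_transition[OF CD(1,2)]])
      show "(f \<circ> pt D) differentiable at (?T x)"
        by (rule smooth_on_differentiable[OF open_img[OF CD(2)] transition_in(2)[OF CD]])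
          (use f CD(2) in \<open>simp add: smooth_function_def\<close>)
    qed
    finally show ?thesis .
  qed
  then show "df (f \<circ> pt C) x = transpose (jac ?T x) *v df (f \<circ> pt D) (?T x)"
    by (simp add: df_def jac_def transpose_def matrix_vector_mult_def vec_eq_iff mult.commute)
qed

lemma one_form_combination:
  assumes "one_form \<A> \<omega>" "one_form \<A> \<omega>'" "smooth_function \<A> s" "smooth_function \<A> s'"
  shows "one_form \<A> (\<lambda>C x. s (pt C x) *\<^sub>R \<omega> C x + s' (pt C x) *\<^sub>R \<omega>' C x)"
  unfolding one_form_def
proof (intro conjI ballI allI)
  fix C i assume C: "C \<in> \<A>"
  have "smooth_on (img C) (s \<circ> pt C)" "smooth_on (img C) (s' \<circ> pt C)"
    "smooth_on (img C) (\<lambda>x. \<omega> C x $ i)" "smooth_on (img C) (\<lambda>x. \<omega>' C x $ i)"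
    using assms C by (simp_all add: one_form_def smooth_function_def)
  then have "smooth_on (img C) (\<lambda>x. (s \<circ> pt C) x * \<omega> C x $ i + (s' \<circ> pt C) x * \<omega>' C x $ i)"
    by (intro smooth_on_add smooth_on_mult open_img C)
  then show "smooth_on (img C) (\<lambda>x. (s (pt C x) *\<^sub>R \<omega> C x + s' (pt C x) *\<^sub>R \<omega>' C x) $ i)"
    by simp
next
  fix C D x assume CD: "C \<in> \<A>" "D \<in> \<A>" "x \<in> overlap C D"
  then have "\<omega> C x = transpose (jac (transition C D) x) *v \<omega> D (transition C D x)"
    "\<omega>' C x = transpose (jac (transition C D) x) *v \<omega>' D (transition C D x)"
    using assms by (auto simp: one_form_def)
  then show "s (pt C x) *\<^sub>R \<omega> C x + s' (pt C x) *\<^sub>R \<omega>' C x = transpose (jac (transition C D) x) *v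
      (s (pt D (transition C D x)) *\<^sub>R \<omega> D (transition C D x) + s' (pt D (transition C D x)) *\<^sub>R \<omega>' D (transition C D x))"
    by (simp add: transition_in(3)[OF CD] matrix_vector_right_distrib matrix_vector_mult_scaleR)
qed

lemma smooth_function_const: "smooth_function \<A> (\<lambda>_. k)"
  by (simp add: smooth_function_def comp_def)

lemma smooth_function_add:
  "smooth_function \<A> s \<Longrightarrow> smooth_function \<A> s' \<Longrightarrow> smooth_function \<A> (\<lambda>q. s q + s' q)"
  using smooth_on_add[OF open_img] by (auto simp: smooth_function_def comp_def)

lemma smooth_function_cmult: "smooth_function \<A> s \<Longrightarrow> smooth_function \<A> (\<lambda>q. k * s q)"
  using smooth_on_mult[OF open_img _ smooth_on_const] by (auto simp: smooth_function_def comp_def mult.commute)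

text \<open>W_0 is \<beta> times the positive factor 2/b^2, so the cones agree; the factors of b^2
  cancel in P/(2w).\<close>

lemma \<Omega>_chart:
  assumes C: "C \<in> \<A>"
  shows "kropina_domain be C = navigation.\<Omega> (img C) (h C) (W C)"
    and "(x, y) \<in> kropina_domain be C \<Longrightarrow>
      kropina_metric al be C x y = navigation.P (h C) x y / (2 * navigation.w (h C) (W C) x y)"
proof -
  interpret navigation "img C" "h C" "W C" by (rule navigation_chart[OF C])
  have w_eq: "w x y = 2 / b2 C x * (be C x \<bullet> y)" if "x \<in> img C" for x y
  proof -
    have "h C x *v W C x = (2 / b2 C x) *\<^sub>R be C x"
      by (simp add: h_eq W_eq matrix_vector_mult_scaleR al_raise[OF C that] flip: scaleR_matrix_vector_assoc)
    moreover have "w x y = (h C x *v W C x) \<bullet> y"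
      by (simp add: w_def Wl_def inner_vec_def)
    ultimately show ?thesis by simp
  qed
  have "0 < w x y \<longleftrightarrow> 0 < be C x \<bullet> y" if "x \<in> img C" for x y
    unfolding w_eq[OF that] using b2_pos[OF C that] by (auto simp: zero_less_divide_iff)
  then show "kropina_domain be C = \<Omega>"
    by (auto simp: kropina_domain_def \<Omega>_def)
  show "kropina_metric al be C x y = P x y / (2 * w x y)" if "(x, y) \<in> kropina_domain be C"
  proof -
    have x: "x \<in> img C" using that by (simp add: kropina_domain_def)
    have "quad (al C x) y \<ge> 0"
      using al_props(3)[OF C x, of y] by (cases "y = 0") (auto simp: quad_def)
    then show ?thesis
      using b2_pos[OF C x] by (simp add: kropina_metric_def P_def h_eq quad_scaleR w_eq[OF x])
  qed
qed

lemma weighted_kropina_chart: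
  assumes C: "C \<in> \<A>" and f: "smooth_function \<A> f" and \<Omega>: "\<Omega> = kropina_domain be"
    and F: "F = kropina_metric al be"
    and vol: "\<And>C x. vol C x = exp (- (real CARD('n) + 1) * f (pt C x)) * BH_density (F C) (\<Omega> C) x"
  shows "weighted_kropina (img C) (h C) (W C) (F C) (vol C) (f \<circ> pt C)"
proof -
  interpret navigation "img C" "h C" "W C" by (rule navigation_chart[OF C])
  show ?thesis
  proof unfold_locales
    show "F C x y = P x y / (2 * w x y)" if "(x, y) \<in> navigation.\<Omega> (img C) (h C) (W C)" for x y
      using that \<Omega>_chart[OF C] by (simp add: F)
    show "smooth_on (img C) (f \<circ> pt C)"
      using f C by (simp add: smooth_function_def)
    show "vol C x = exp (- (real CARD('n) + 1) * (f \<circ> pt C) x) * BH_density (F C) (navigation.\<Omega> (img C) (h C) (W C)) x" for x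
      by (simp add: vol \<Omega> \<Omega>_chart(1)[OF C])
  qed
qed

end

theorem theorem4p1:
  fixes \<A> :: "('m::{t2_space, second_countable_topology}, 'n::finite) chart set"
    and al :: "('m, 'n) chart \<Rightarrow> real ^ 'n \<Rightarrow> real ^ 'n ^ 'n"
    and be :: "('m, 'n) chart \<Rightarrow> real ^ 'n \<Rightarrow> real ^ 'n"
    and h :: "('m, 'n) chart \<Rightarrow> real ^ 'n \<Rightarrow> real ^ 'n ^ 'n"
    and W :: "('m, 'n) chart \<Rightarrow> real ^ 'n \<Rightarrow> real ^ 'n"
    and F :: "('m, 'n) chart \<Rightarrow> real ^ 'n \<Rightarrow> real ^ 'n \<Rightarrow> real"
    and \<Omega> :: "('m, 'n) chart \<Rightarrow> ((real ^ 'n) \<times> (real ^ 'n)) set"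
    and vol :: "('m, 'n) chart \<Rightarrow> real ^ 'n \<Rightarrow> real"
    and f :: "'m \<Rightarrow> real"
    and a c n :: real
  assumes "n = real CARD('n)" and "CARD('n) \<ge> 2"
    and "smooth_atlas \<A>"
    and "kropina_data \<A> al be"
    and "F = kropina_metric al be" and "\<Omega> = kropina_domain be"
    and "(h, W) = navigation_data al be"
    and "smooth_function \<A> f"
    and "vol = (\<lambda>C x. exp (- (n + 1) * f (pt C x)) * BH_density (F C) (\<Omega> C) x)"
    and "3 * (n - 1) - 4 * a * (n + 1) - c * (n + 1)\<^sup>2 \<noteq> 0"
  shows "(weakly_weighted_einstein \<A> F \<Omega> vol a c \<longleftrightarrow>
            (\<exists>\<mu>. weighted_ricci_condition \<A> h f a c \<mu>) \<and>
            (\<forall>C\<in>\<A>. \<forall>x\<in>img C. \<forall>i j. R_tensor (h C) (W C) x $ i $ j = 0))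
    \<and> (\<forall>\<sigma> \<theta> \<mu>.
         weakly_weighted_einstein_with \<A> F \<Omega> vol a c \<sigma> \<theta> \<longrightarrow>
         weighted_ricci_condition \<A> h f a c \<mu> \<longrightarrow>
         (\<forall>C\<in>\<A>. \<forall>x\<in>img C.
            (let S = S_endo (h C) (W C) x;
                 w = W C x;
                 \<phi> = f \<circ> pt C;
                 Hess = hessian (h C) \<phi> x;
                 fW = (\<Sum>p\<in>UNIV. pd p \<phi> x * w $ p)
             in
               \<sigma> (pt C x) = \<mu> (pt C x) - 1 / (n - 1) *
                 (quad (riem_ricci (h C) x) w
                  + (\<Sum>p\<in>UNIV. \<Sum>q\<in>UNIV. S $ p $ q * S $ q $ p)
                  + a * (n + 1) * quad Hess w
                  - c * (n + 1)\<^sup>2 * fW\<^sup>2) \<and>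
               (\<forall>i. \<theta> C x $ i = 1 / (3 * (n - 1)) *
                 (2 * a * (n + 1) * ((\<Sum>p\<in>UNIV. Hess $ i $ p * w $ p)
                                    + (\<Sum>p\<in>UNIV. pd p \<phi> x * S $ p $ i))
                  - 2 * c * (n + 1)\<^sup>2 * pd i \<phi> x * fW)))))"
proof -
  note n = assms(1) and n2 = assms(2) and F = assms(5) and \<Omega> = assms(6) and f = assms(8) and vol = assms(9)
  interpret kropina_atlas \<A> al be h W
    using assms(3,4,7) by unfold_locales
  have n1: "n - 1 \<noteq> 0" using n n2 by simp
  have chart: "weighted_kropina (img C) (h C) (W C) (F C) (vol C) (f \<circ> pt C)" if "C \<in> \<A>" for C
    by (rule weighted_kropina_chart[OF that f \<Omega> F]) (simp add: vol n)
  have einstein: "weighted_ricci (F C) (navigation.\<Omega> (img C) (h C) (W C)) (vol C) a c x y =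
      (real CARD('n) - 1) * (3 * (\<theta> C x \<bullet> y) / F C x y + \<sigma> (pt C x)) * (F C x y)\<^sup>2"
    if "weakly_weighted_einstein_with \<A> F \<Omega> vol a c \<sigma> \<theta>" "C \<in> \<A>" "(x, y) \<in> navigation.\<Omega> (img C) (h C) (W C)"
    for \<sigma> \<theta> C x y
  proof -
    have "\<forall>p\<in>\<Omega> C. case p of (x, y) \<Rightarrow> weighted_ricci (F C) (\<Omega> C) (vol C) a c x y =
        (real CARD('n) - 1) * (3 * (\<theta> C x \<bullet> y) / F C x y + \<sigma> (pt C x)) * (F C x y)\<^sup>2"
      using that(1,2) unfolding weakly_weighted_einstein_with_def by blast
    from bspec[OF this, of "(x, y)"] that(3) show ?thesis
      by (simp add: \<Omega> \<Omega>_chart(1)[OF that(2)])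
  qed
  have R_zero: "R_tensor (h C) (W C) x $ i $ j = 0"
    if ein: "weakly_weighted_einstein_with \<A> F \<Omega> vol a c \<sigma> \<theta>" and C: "C \<in> \<A>" and x: "x \<in> img C" for \<sigma> \<theta> C x i j
  proof -
    interpret weighted_kropina "img C" "h C" "W C" "F C" "vol C" "f \<circ> pt C" by (rule chart[OF C])
    show ?thesis
      by (rule einstein_imp_R_tensor_zero[OF assms(10)[unfolded n] x einstein[OF ein C]])
  qed
  have killing: "killing_kropina (img C) (h C) (W C) (F C) (vol C) (f \<circ> pt C)"
    if "\<And>x i j. x \<in> img C \<Longrightarrow> R_tensor (h C) (W C) x $ i $ j = 0" "C \<in> \<A>" for C
    using chart[OF that(2)] that(1) by (intro killing_kropina.intro killing_kropina_axioms.intro)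
  have E_eq: "killing_kropina.E (h C) (f \<circ> pt C) a c x y = quad (riem_ricci (h C) x) y
      + a * (n + 1) * quad (hessian (h C) (f \<circ> pt C) x) y - c * (n + 1)\<^sup>2 * (df (f \<circ> pt C) x \<bullet> y)\<^sup>2"
    if "\<And>x i j. x \<in> img C \<Longrightarrow> R_tensor (h C) (W C) x $ i $ j = 0" "C \<in> \<A>" for C x y
  proof -
    interpret killing_kropina "img C" "h C" "W C" "F C" "vol C" "f \<circ> pt C" by (rule killing[OF that])
    show ?thesis by (simp add: E_def f0_def df_def inner_vec_def n)
  qed
  \<comment> \<open>The trace \<theta>(W) is formed by \<open>contract\<close>, which makes \<mu> a
    function on the manifold and not merely in one chart.\<close>
  have forward: "weighted_ricci_condition \<A> h f a c (\<lambda>q. \<sigma> q + 3 / 2 * contract \<theta> q)"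
    if ein: "weakly_weighted_einstein_with \<A> F \<Omega> vol a c \<sigma> \<theta>" for \<sigma> \<theta>
    unfolding weighted_ricci_condition_def
  proof (intro conjI ballI allI)
    have \<sigma>: "smooth_function \<A> \<sigma>" and \<theta>: "one_form \<A> \<theta>"
      using ein by (auto simp: weakly_weighted_einstein_with_def)
    show "smooth_function \<A> (\<lambda>q. \<sigma> q + 3 / 2 * contract \<theta> q)"
      by (intro smooth_function_add smooth_function_cmult \<sigma> smooth_contract \<theta>)
    fix C x y assume C: "C \<in> \<A>" and x: "x \<in> img C"
    interpret K: killing_kropina "img C" "h C" "W C" "F C" "vol C" "f \<circ> pt C"
      by (rule killing[OF R_zero[OF ein C] C])
    have "K.E a c x y = (n - 1) * (\<sigma> (pt C x) + 3 / 2 * (\<theta> C x \<bullet> W C x)) * K.P x y"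
      unfolding n by (rule K.einstein_imp_condition(1)[OF x n2]) (rule einstein[OF ein C])
    then show "quad (riem_ricci (h C) x) y + a * (real CARD('n) + 1) * quad (hessian (h C) (f \<circ> pt C) x) y
        - c * (real CARD('n) + 1)\<^sup>2 * (df (f \<circ> pt C) x \<bullet> y)\<^sup>2
      = (real CARD('n) - 1) * (\<sigma> (pt C x) + 3 / 2 * contract \<theta> (pt C x)) * quad (h C x) y"
      by (simp add: contract_eq[OF \<theta> C x] E_eq[OF R_zero[OF ein C] C] K.P_def n)
  qed
  have backward: "\<exists>\<sigma> \<theta>. weakly_weighted_einstein_with \<A> F \<Omega> vol a c \<sigma> \<theta>"
    if cond: "weighted_ricci_condition \<A> h f a c \<mu>"
      and R: "\<forall>C\<in>\<A>. \<forall>x\<in>img C. \<forall>i j. R_tensor (h C) (W C) x $ i $ j = 0" for \<mu>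
  proof -
    \<comment> \<open>The global function df(W). Combining its differential with df makes \<theta> a
      1-form without any transformation law for Hessians or for S.\<close>
    define \<psi> where "\<psi> = contract (\<lambda>C. df (f \<circ> pt C))"
    have \<psi>: "smooth_function \<A> \<psi>"
      unfolding \<psi>_def by (intro smooth_contract one_form_df f)
    \<comment> \<open>Chosen so that 3(n-1)\<theta> = 2a(n+1) d\<psi> - 2c(n+1)^2 \<psi> df, the
      prescribed bracket.\<close>
    define k l where "k = 2 * a * (n + 1) / (3 * (n - 1))" and "l = - 2 * c * (n + 1)\<^sup>2 / (3 * (n - 1))"
    define \<theta> :: "('m, 'n) chart \<Rightarrow> real ^ 'n \<Rightarrow> real ^ 'n" where "\<theta> C x = k *\<^sub>R df (\<psi> \<circ> pt C) x + (l * \<psi> (pt C x)) *\<^sub>R df (f \<circ> pt C) x" for C x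
    have \<theta>: "one_form \<A> \<theta>"
      unfolding \<theta>_def[abs_def]
      by (rule one_form_combination[OF one_form_df[OF \<psi>] one_form_df[OF f] smooth_function_const smooth_function_cmult[OF \<psi>]])
    \<comment> \<open>Inverts \<mu> = \<sigma> + 3/2 \<theta>(W).\<close>
    define \<sigma> where "\<sigma> q = \<mu> q + (- 3 / 2) * contract \<theta> q" for q
    have \<sigma>: "smooth_function \<A> \<sigma>"
      unfolding \<sigma>_def[abs_def] using cond
      by (intro smooth_function_add smooth_function_cmult smooth_contract \<theta>) (simp add: weighted_ricci_condition_def)
    have "weakly_weighted_einstein_with \<A> F \<Omega> vol a c \<sigma> \<theta>"
      unfolding weakly_weighted_einstein_with_def
    proof (intro conjI ballI \<sigma> \<theta>, clarify)
      fix C x y assume C: "C \<in> \<A>" and xy': "(x, y) \<in> \<Omega> C"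
      have RC: "R_tensor (h C) (W C) x $ i $ j = 0" if "x \<in> img C" for x i j
        using R C that by blast
      interpret K: killing_kropina "img C" "h C" "W C" "F C" "vol C" "f \<circ> pt C"
        by (rule killing[OF RC C])
      have xy: "(x, y) \<in> K.\<Omega>" using xy' \<Omega>_chart(1)[OF C] by (simp add: \<Omega>)
      note x = K.\<Omega>_base[OF xy]
      have E: "K.E a c x y = (real CARD('n) - 1) * \<mu> (pt C x) * K.P x y" for y
        unfolding K.P_def using cond C x by (simp add: E_eq[OF RC C] weighted_ricci_condition_def n)
      have \<psi>_chart: "\<psi> (pt C z) = (\<Sum>q\<in>UNIV. pd q (f \<circ> pt C) z * W C z $ q)" if "z \<in> img C" for z
        unfolding \<psi>_def by (simp add: contract_eq[OF one_form_df[OF f] C that] df_def inner_vec_def)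
      have "3 * (real CARD('n) - 1) * \<theta> C x $ i = K.\<eta> a c i x" for i
      proof -
        have "pd i (\<psi> \<circ> pt C) x = pd i (\<lambda>z. \<Sum>q\<in>UNIV. pd q (f \<circ> pt C) z * W C z $ q) x"
          by (rule pd_cong[OF K.open_U x]) (simp add: \<psi>_chart)
        then have "pd i (\<psi> \<circ> pt C) x = (\<Sum>q\<in>UNIV. hessian (h C) (f \<circ> pt C) x $ i $ q * W C x $ q)
            + (\<Sum>q\<in>UNIV. pd q (f \<circ> pt C) x * S_endo (h C) (W C) x $ q $ i)"
          by (simp only: K.gradient_along_W[OF x])
        moreover have "\<psi> (pt C x) = K.fW x"
          by (simp add: \<psi>_chart[OF x] K.fW_def)
        moreover have "3 * (n - 1) * \<theta> C x $ i = 2 * a * (n + 1) * pd i (\<psi> \<circ> pt C) x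
            - 2 * c * (n + 1)\<^sup>2 * pd i (f \<circ> pt C) x * \<psi> (pt C x)"
        proof -
          have "3 * (n - 1) * \<theta> C x $ i = (3 * (n - 1) * k) * pd i (\<psi> \<circ> pt C) x
              + (3 * (n - 1) * l) * pd i (f \<circ> pt C) x * \<psi> (pt C x)"
            by (simp add: \<theta>_def df_def algebra_simps)
          moreover have "3 * (n - 1) * k = 2 * a * (n + 1)" "3 * (n - 1) * l = - 2 * c * (n + 1)\<^sup>2"
            using n1 by (simp_all add: k_def l_def)
          ultimately show ?thesis by simp
        qed
        ultimately show ?thesis
          by (simp add: K.\<eta>_def n)
      qed
      from K.condition_imp_einstein[OF x E this _ xy, of "\<sigma> (pt C x)"]
      have "weighted_ricci (F C) K.\<Omega> (vol C) a c x y =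
          (real CARD('n) - 1) * (3 * (\<theta> C x \<bullet> y) / F C x y + \<sigma> (pt C x)) * (F C x y)\<^sup>2"
        by (simp add: \<sigma>_def contract_eq[OF \<theta> C x])
      then show "weighted_ricci (F C) (\<Omega> C) (vol C) a c x y =
          (real CARD('n) - 1) * (3 * (\<theta> C x \<bullet> y) / F C x y + \<sigma> (pt C x)) * (F C x y)\<^sup>2"
        by (simp add: \<Omega> \<Omega>_chart(1)[OF C])
    qed
    then show ?thesis by blast
  qed
  have formulas: "\<sigma> (pt C x) = \<mu> (pt C x) - 1 / (n - 1) *
        (quad (riem_ricci (h C) x) (W C x)
          + (\<Sum>p\<in>UNIV. \<Sum>q\<in>UNIV. S_endo (h C) (W C) x $ p $ q * S_endo (h C) (W C) x $ q $ p)
          + a * (n + 1) * quad (hessian (h C) (f \<circ> pt C) x) (W C x)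
          - c * (n + 1)\<^sup>2 * (\<Sum>p\<in>UNIV. pd p (f \<circ> pt C) x * W C x $ p)\<^sup>2)"
      "\<theta> C x $ i = 1 / (3 * (n - 1)) *
        (2 * a * (n + 1) * ((\<Sum>p\<in>UNIV. hessian (h C) (f \<circ> pt C) x $ i $ p * W C x $ p)
                          + (\<Sum>p\<in>UNIV. pd p (f \<circ> pt C) x * S_endo (h C) (W C) x $ p $ i))
          - 2 * c * (n + 1)\<^sup>2 * pd i (f \<circ> pt C) x * (\<Sum>p\<in>UNIV. pd p (f \<circ> pt C) x * W C x $ p))"
    if ein: "weakly_weighted_einstein_with \<A> F \<Omega> vol a c \<sigma> \<theta>" and cond: "weighted_ricci_condition \<A> h f a c \<mu>"
      and C: "C \<in> \<A>" and x: "x \<in> img C" for \<sigma> \<theta> \<mu> C x i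
  proof -
    interpret K: killing_kropina "img C" "h C" "W C" "F C" "vol C" "f \<circ> pt C"
      by (rule killing[OF R_zero[OF ein C] C])
    have tr: "(n - 1) * \<sigma> (pt C x) = - K.trA2 x"
      using K.einstein_imp_condition(2)[OF x n2 einstein[OF ein C]] by (simp add: n)
    \<comment> \<open>At y = W, where h^2 = 1, the condition gives (n-1)\<mu>. The formula for
      \<sigma> thereby collapses to -tr S^2/(n-1), which is \<open>tr\<close>.\<close>
    have "K.E a c x (W C x) = (n - 1) * \<mu> (pt C x)"
      using cond C x K.W_unit[OF x] by (simp add: E_eq[OF R_zero[OF ein C] C] weighted_ricci_condition_def n)
    then have "quad (riem_ricci (h C) x) (W C x) + a * (n + 1) * quad (hessian (h C) (f \<circ> pt C) x) (W C x)
        - c * (n + 1)\<^sup>2 * (\<Sum>p\<in>UNIV. pd p (f \<circ> pt C) x * W C x $ p)\<^sup>2 = (n - 1) * \<mu> (pt C x)"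
      by (simp add: E_eq[OF R_zero[OF ein C] C] df_def inner_vec_def)
    then show "\<sigma> (pt C x) = \<mu> (pt C x) - 1 / (n - 1) *
        (quad (riem_ricci (h C) x) (W C x)
          + (\<Sum>p\<in>UNIV. \<Sum>q\<in>UNIV. S_endo (h C) (W C) x $ p $ q * S_endo (h C) (W C) x $ q $ p)
          + a * (n + 1) * quad (hessian (h C) (f \<circ> pt C) x) (W C x)
          - c * (n + 1)\<^sup>2 * (\<Sum>p\<in>UNIV. pd p (f \<circ> pt C) x * W C x $ p)\<^sup>2)"
      using tr n1 unfolding K.trA2_def[symmetric] by (simp add: field_simps)
    show "\<theta> C x $ i = 1 / (3 * (n - 1)) *
        (2 * a * (n + 1) * ((\<Sum>p\<in>UNIV. hessian (h C) (f \<circ> pt C) x $ i $ p * W C x $ p)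
                          + (\<Sum>p\<in>UNIV. pd p (f \<circ> pt C) x * S_endo (h C) (W C) x $ p $ i))
          - 2 * c * (n + 1)\<^sup>2 * pd i (f \<circ> pt C) x * (\<Sum>p\<in>UNIV. pd p (f \<circ> pt C) x * W C x $ p))"
      using K.einstein_imp_condition(3)[OF x n2 einstein[OF ein C], of i] n1
      unfolding K.\<eta>_def K.fW_def n[symmetric] by (simp add: field_simps)
  qed
  show ?thesis
    unfolding Let_def weakly_weighted_einstein_def
    using forward backward R_zero formulas by blast
qed

end
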